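(* Let $\mu,\nu>-1$, $0\le\theta\le\pi$ and $\alpha\in\mathbb{R}$, and let $a_n^2$, $b_n$ be the recurrence coefficients of the monic polynomials $P_n$ corresponding to $H_n^{(\mu,\nu)}(z;\alpha,\theta)$, with Jacobi matrix $J$ (all as given in the context). Then $\lim_{n\to\infty}a_n^2=0$ and $\lim_{n\to\infty}b_n=0$, and in fact $a_n^2=\mathcal{O}(1/n^4)$ and $b_n=\mathcal{O}(1/n^2)$. This implies that $J$ is a compact operator, and in fact it is a trace class operator. This implies that the spectrum of $J$ is a countable set $\{x_k,\ k\in\mathbb{N}\}$ with one accumulation point at $0$, hence $\lim_{k\to\infty}x_k=0$. The trace class condition implies that $\sum_{k=0}^\infty|x_k|$ is finite. Consequently the orthogonality measure for the polynomials $H_n^{(\mu,\nu)}(z;\alpha,\theta)$ is a discrete measure supported on this countable set.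
   Context: The polynomials $H_n=H_n^{(\mu,\nu)}(z;\alpha,\theta)$, with $0\le\theta\le\pi$, $\mu,\nu>-1$ and $\alpha\in\mathbb{R}$, form a four-parameter family of orthogonal polynomials defined by $H_{-1}=0$, $H_0=1$ and $$\cos\theta\, H_n = \left( z\sin\theta\left[\left(n+\tfrac{\mu+\nu+1}{2}\right)^2+\alpha\right] + \frac{\nu^2-\mu^2}{(2n+\mu+\nu)(2n+\mu+\nu+2)}\right)H_n + \frac{2(n+\mu)(n+\nu)}{(2n+\mu+\nu)(2n+\mu+\nu+1)}H_{n-1} + \frac{2(n+1)(n+\mu+\nu+1)}{(2n+\mu+\nu+1)(2n+\mu+\nu+2)}H_{n+1}.$$ The monic polynomials are $P_n(z)=H_n^{(\mu,\nu)}(z;\alpha,\theta)/k_n$, where $k_n$ is the leading coefficient of $H_n$. They satisfy $$zP_n(z)=P_{n+1}(z)+b_nP_n(z)+a_n^2P_{n-1}(z),$$ with recurrence coefficients $$a_n^2=\frac{4n(n+\mu)(n+\nu)(n+\mu+\nu)}{\sin^2\theta\left[\left(n+\frac{\mu+\nu+1}{2}\right)^2+\alpha\right]\left[\left(n+\frac{\mu+\nu-1}{2}\right)^2+\alpha\right](2n+\mu+\nu+1)(2n+\mu+\nu)^2(2n+\mu+\nu-1)},$$ $$b_n=\frac{1}{\sin\theta\left[\left(n+\frac{\mu+\nu+1}{2}\right)^2+\alpha\right]}\left(\cos\theta+\frac{\mu^2-\nu^2}{(2n+\mu+\nu)(2n+\mu+\nu+2)}\right).$$ The Jacobi matrix $J$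 is the infinite symmetric tridiagonal matrix with diagonal entries $b_0,b_1,b_2,\dots$ and off-diagonal entries $a_1,a_2,a_3,\dots$ (the entries next to the diagonal, both above and below it), viewed as an operator on the Hilbert space of square-summable sequences.
   Formalization: Assumes sin θ ≠ 0 and (n+(μ+ν+1)/2)²+α ≠ 0 for all n≥0, since otherwise a_n², b_n and P_n are undefined; existence of a positive orthogonality measure is claimed only when all a_n²>0 (n≥1), as none exists otherwise. Removable 0/0 values are filled by cancellation. *)

theory Defs
  imports
    "HOL-Analysis.Analysis"
    "HOL-Computational_Algebra.Polynomial"
    "HOL-Library.Landau_Symbols"
begin

section \<open>The polynomials and their recurrence coefficients\<close>

definition bracket :: "real \<Rightarrow> real \<Rightarrow> real \<Rightarrow> nat \<Rightarrow> real" where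
  "bracket \<mu> \<nu> \<alpha> n = (real n + (\<mu> + \<nu> + 1) / 2)\<^sup>2 + \<alpha>"

text \<open>
  For \<open>\<mu>, \<nu> > -1\<close> a few rational expressions take the form \<open>0/0\<close> at the exceptional parameters
  \<open>\<mu> + \<nu> = 0\<close> or \<open>\<mu> + \<nu> = -1\<close>, and only for the lowest index that occurs. There the common factor
  is cancelled, which is the value by continuity in \<open>\<mu>\<close> and \<open>\<nu>\<close>; HOL's \<open>0/0 = 0\<close> would be wrong.
\<close>

definition diag_term :: "real \<Rightarrow> real \<Rightarrow> nat \<Rightarrow> real" where
  "diag_term \<mu> \<nu> n =
     (if 2 * real n + \<mu> + \<nu> = 0 then (\<nu> - \<mu>) / (2 * real n + \<mu> + \<nu> + 2)
      else (\<nu>\<^sup>2 - \<mu>\<^sup>2) / ((2 * real n + \<mu> + \<nu>) * (2 * real n + \<mu> + \<nu> + 2)))"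

definition lower_term :: "real \<Rightarrow> real \<Rightarrow> nat \<Rightarrow> real" where
  "lower_term \<mu> \<nu> n =
     2 * (real n + \<mu>) * (real n + \<nu>) / ((2 * real n + \<mu> + \<nu>) * (2 * real n + \<mu> + \<nu> + 1))"

definition upper_term :: "real \<Rightarrow> real \<Rightarrow> nat \<Rightarrow> real" where
  "upper_term \<mu> \<nu> n =
     (if 2 * real n + \<mu> + \<nu> + 1 = 0 then 2 * (real n + 1) / (2 * real n + \<mu> + \<nu> + 2)
      else 2 * (real n + 1) * (real n + \<mu> + \<nu> + 1)
             / ((2 * real n + \<mu> + \<nu> + 1) * (2 * real n + \<mu> + \<nu> + 2)))"

text \<open>The three-term recurrence solved for its last term, as polynomials in \<open>z\<close>.\<close>

fun Hpoly :: "real \<Rightarrow> real \<Rightarrow> real \<Rightarrow> real \<Rightarrow> nat \<Rightarrow> real poly" where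
  "Hpoly \<mu> \<nu> \<alpha> \<theta> 0 = 1"
| "Hpoly \<mu> \<nu> \<alpha> \<theta> (Suc 0) =
     smult (1 / upper_term \<mu> \<nu> 0) [: cos \<theta> - diag_term \<mu> \<nu> 0, - (sin \<theta> * bracket \<mu> \<nu> \<alpha> 0) :]"
| "Hpoly \<mu> \<nu> \<alpha> \<theta> (Suc (Suc n)) =
     smult (1 / upper_term \<mu> \<nu> (Suc n))
       ([: cos \<theta> - diag_term \<mu> \<nu> (Suc n), - (sin \<theta> * bracket \<mu> \<nu> \<alpha> (Suc n)) :]
           * Hpoly \<mu> \<nu> \<alpha> \<theta> (Suc n)
         - smult (lower_term \<mu> \<nu> (Suc n)) (Hpoly \<mu> \<nu> \<alpha> \<theta> n))"

definition Ppoly :: "real \<Rightarrow> real \<Rightarrow> real \<Rightarrow> real \<Rightarrow> nat \<Rightarrow> real poly" where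
  "Ppoly \<mu> \<nu> \<alpha> \<theta> n = smult (1 / lead_coeff (Hpoly \<mu> \<nu> \<alpha> \<theta> n)) (Hpoly \<mu> \<nu> \<alpha> \<theta> n)"

text \<open>Meaningful for \<open>n \<ge> 1\<close>; the second bracket of the formula is that of index \<open>n - 1\<close>.\<close>

definition rec_a2 :: "real \<Rightarrow> real \<Rightarrow> real \<Rightarrow> real \<Rightarrow> nat \<Rightarrow> real" where
  "rec_a2 \<mu> \<nu> \<alpha> \<theta> n =
     (if 2 * real n + \<mu> + \<nu> - 1 = 0 then
        4 * real n * (real n + \<mu>) * (real n + \<nu>)
        / ((sin \<theta>)\<^sup>2 * ((real n + (\<mu> + \<nu> + 1) / 2)\<^sup>2 + \<alpha>) * ((real n + (\<mu> + \<nu> - 1) / 2)\<^sup>2 + \<alpha>)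
             * (2 * real n + \<mu> + \<nu> + 1) * (2 * real n + \<mu> + \<nu>)\<^sup>2)
      else
        4 * real n * (real n + \<mu>) * (real n + \<nu>) * (real n + \<mu> + \<nu>)
        / ((sin \<theta>)\<^sup>2 * ((real n + (\<mu> + \<nu> + 1) / 2)\<^sup>2 + \<alpha>) * ((real n + (\<mu> + \<nu> - 1) / 2)\<^sup>2 + \<alpha>)
             * (2 * real n + \<mu> + \<nu> + 1) * (2 * real n + \<mu> + \<nu>)\<^sup>2 * (2 * real n + \<mu> + \<nu> - 1)))"

definition rec_b :: "real \<Rightarrow> real \<Rightarrow> real \<Rightarrow> real \<Rightarrow> nat \<Rightarrow> real" where
  "rec_b \<mu> \<nu> \<alpha> \<theta> n =
     1 / (sin \<theta> * bracket \<mu> \<nu> \<alpha> n) * (cos \<theta> - diag_term \<mu> \<nu> n)"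

lemma upper_term_nonzero:
  assumes "\<mu> > -1" "\<nu> > -1"
  shows "upper_term \<mu> \<nu> n \<noteq> 0"
proof (cases n)
  case 0
  then show ?thesis using assms by (auto simp: upper_term_def)
next
  case (Suc m)
  have "real n \<ge> 1" using Suc by simp
  then have "2 * real n + \<mu> + \<nu> + 1 > 0" "2 * real n + \<mu> + \<nu> + 2 > 0"
    "real n + \<mu> + \<nu> + 1 > 0" "real n + 1 > 0"
    using assms by linarith+
  then show ?thesis by (auto simp: upper_term_def)
qed

lemma Hpoly_recurrence:
  assumes "\<mu> > -1" "\<nu> > -1"
  shows "smult (cos \<theta>) (Hpoly \<mu> \<nu> \<alpha> \<theta> n) =
     [: diag_term \<mu> \<nu> n, sin \<theta> * bracket \<mu> \<nu> \<alpha> n :] * Hpoly \<mu> \<nu> \<alpha> \<theta> n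
     + smult (lower_term \<mu> \<nu> n) (if n = 0 then 0 else Hpoly \<mu> \<nu> \<alpha> \<theta> (n - 1))
     + smult (upper_term \<mu> \<nu> n) (Hpoly \<mu> \<nu> \<alpha> \<theta> (Suc n))"
  using upper_term_nonzero[OF assms, of n]
  by (cases n) (simp_all add: algebra_simps smult_diff_left)

lemma degree_Hpoly:
  assumes "\<mu> > -1" "\<nu> > -1" "sin \<theta> \<noteq> 0" "\<And>n. bracket \<mu> \<nu> \<alpha> n \<noteq> 0"
  shows "degree (Hpoly \<mu> \<nu> \<alpha> \<theta> n) = n \<and> Hpoly \<mu> \<nu> \<alpha> \<theta> n \<noteq> 0 \<and>
    lead_coeff (Hpoly \<mu> \<nu> \<alpha> \<theta> (Suc n)) =
      - (sin \<theta> * bracket \<mu> \<nu> \<alpha> n) / upper_term \<mu> \<nu> n * lead_coeff (Hpoly \<mu> \<nu> \<alpha> \<theta> n)"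
proof -
  note u = upper_term_nonzero[OF assms(1,2)]
  let ?H = "Hpoly \<mu> \<nu> \<alpha> \<theta>"
  have step: "degree (?H (Suc n)) = Suc n \<and> ?H (Suc n) \<noteq> 0 \<and>
      lead_coeff (?H (Suc n)) =
        - (sin \<theta> * bracket \<mu> \<nu> \<alpha> n) / upper_term \<mu> \<nu> n * lead_coeff (?H n)"
    if dn: "degree (?H n) = n" and nz: "?H n \<noteq> 0"
      and pr: "\<And>m. n = Suc m \<Longrightarrow> degree (?H m) = m" for n
  proof -
    define L where "L = [: cos \<theta> - diag_term \<mu> \<nu> n, - (sin \<theta> * bracket \<mu> \<nu> \<alpha> n) :]"
    define R where "R = smult (lower_term \<mu> \<nu> n) (if n = 0 then 0 else ?H (n - 1))"
    have L: "degree L = 1" "L \<noteq> 0" "lead_coeff L = - (sin \<theta> * bracket \<mu> \<nu> \<alpha> n)"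
      using assms(3,4) by (auto simp: L_def)
    have eq: "?H (Suc n) = smult (1 / upper_term \<mu> \<nu> n) (L * ?H n - R)"
      by (cases n) (auto simp: L_def R_def)
    have dL: "degree (L * ?H n) = Suc n"
      using L nz dn by (simp add: degree_mult_eq)
    have dR: "degree R < Suc n"
      unfolding R_def using pr by (cases n) (auto intro: le_less_trans[OF degree_smult_le])
    have d: "degree (L * ?H n - R) = Suc n"
      using degree_add_eq_left[of "- R" "L * ?H n"] dL dR by simp
    have cR: "coeff R (Suc n) = 0" using dR by (rule coeff_eq_0)
    have lc: "coeff (L * ?H n) (Suc n) = lead_coeff L * lead_coeff (?H n)"
      using lead_coeff_mult[of L "?H n"] dL by simp
    have d': "degree (?H (Suc n)) = Suc n"
      using eq d u by simp
    moreover from d' have "?H (Suc n) \<noteq> 0" by auto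
    moreover have "coeff (?H (Suc n)) (Suc n) =
        - (sin \<theta> * bracket \<mu> \<nu> \<alpha> n) / upper_term \<mu> \<nu> n * lead_coeff (?H n)"
      unfolding eq by (simp add: cR lc L(3) del: mult_pCons_left)
    ultimately show ?thesis by simp
  qed
  have "degree (?H n) = n \<and> ?H n \<noteq> 0 \<and> (\<forall>m. n = Suc m \<longrightarrow> degree (?H m) = m)" for n
  proof (induction n)
    case 0
    then show ?case by simp
  next
    case (Suc n)
    then show ?case using step[of n] by simp
  qed
  then show ?thesis using step[of n] by blast
qed

lemma lower_upper_rec_a2:
  assumes "\<mu> > -1" "\<nu> > -1"
  shows "lower_term \<mu> \<nu> (Suc n) * upper_term \<mu> \<nu> n
     / ((sin \<theta>)\<^sup>2 * bracket \<mu> \<nu> \<alpha> (Suc n) * bracket \<mu> \<nu> \<alpha> n) = rec_a2 \<mu> \<nu> \<alpha> \<theta> (Suc n)"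
proof -
  have br: "bracket \<mu> \<nu> \<alpha> n = (real (Suc n) + (\<mu> + \<nu> - 1) / 2)\<^sup>2 + \<alpha>"
    by (simp add: bracket_def field_simps)
  have e: "2 * real (Suc n) + \<mu> + \<nu> - 1 = 2 * real n + \<mu> + \<nu> + 1"
    "2 * real (Suc n) + \<mu> + \<nu> = 2 * real n + \<mu> + \<nu> + 2"
    "real (Suc n) + \<mu> + \<nu> = real n + \<mu> + \<nu> + 1" "real (Suc n) = real n + 1"
    by simp_all
  show ?thesis
    unfolding rec_a2_def br[symmetric] bracket_def[of \<mu> \<nu> \<alpha> "Suc n", symmetric]
      lower_term_def upper_term_def e(1)
    unfolding e(2,3)
    by (simp add: power2_eq_square mult_ac) (simp add: algebra_simps)
qed

lemma Ppoly_recurrence: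
  assumes "\<mu> > -1" "\<nu> > -1" "sin \<theta> \<noteq> 0" "\<And>n. bracket \<mu> \<nu> \<alpha> n \<noteq> 0"
  shows "pCons 0 (Ppoly \<mu> \<nu> \<alpha> \<theta> n) =
     Ppoly \<mu> \<nu> \<alpha> \<theta> (Suc n) + smult (rec_b \<mu> \<nu> \<alpha> \<theta> n) (Ppoly \<mu> \<nu> \<alpha> \<theta> n)
     + smult (rec_a2 \<mu> \<nu> \<alpha> \<theta> n) (if n = 0 then 0 else Ppoly \<mu> \<nu> \<alpha> \<theta> (n - 1))"
proof (rule poly_ext)
  fix z
  define K where "K m = lead_coeff (Hpoly \<mu> \<nu> \<alpha> \<theta> m)" for m
  define h where "h m = poly (Hpoly \<mu> \<nu> \<alpha> \<theta> m) z" for m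
  define s where "s m = sin \<theta> * bracket \<mu> \<nu> \<alpha> m" for m
  define U where "U = upper_term \<mu> \<nu>"
  define c where "c = cos \<theta> - diag_term \<mu> \<nu> n"
  have K0: "K m \<noteq> 0" for m
    using degree_Hpoly[OF assms, of m] unfolding K_def by (metis leading_coeff_0_iff)
  have s0: "s m \<noteq> 0" for m using assms(3,4) by (simp add: s_def)
  have U0: "U m \<noteq> 0" for m using upper_term_nonzero[OF assms(1,2)] by (simp add: U_def)
  have KS: "K (Suc m) = - s m / U m * K m" for m
    using degree_Hpoly[OF assms] unfolding K_def s_def U_def by blast
  define w where "w = lower_term \<mu> \<nu> n * (if n = 0 then 0 else h (n - 1))"
  have rec: "U n * h (Suc n) = (c - s n * z) * h n - w"
    using arg_cong[OF Hpoly_recurrence[OF assms(1,2), of \<theta> \<alpha> n], of "\<lambda>p. poly p z"]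
    by (simp add: h_def s_def U_def c_def w_def algebra_simps split: if_splits)
  have P: "poly (Ppoly \<mu> \<nu> \<alpha> \<theta> m) z = h m / K m" for m
    by (simp add: Ppoly_def h_def K_def)
  have b: "rec_b \<mu> \<nu> \<alpha> \<theta> n = c / s n"
    by (simp add: rec_b_def c_def s_def)
  have "h (Suc n) / K (Suc n) = - (U n * h (Suc n)) / (s n * K n)"
    using U0 s0 K0 by (simp add: KS field_simps)
  also have "\<dots> = z * (h n / K n) - c / s n * (h n / K n) + w / (s n * K n)"
    unfolding rec using s0[of n] K0[of n] by (simp add: field_simps)
  finally have main: "h (Suc n) / K (Suc n) =
      z * (h n / K n) - c / s n * (h n / K n) + w / (s n * K n)" .
  have "w / (s n * K n) =
      - (rec_a2 \<mu> \<nu> \<alpha> \<theta> n * (if n = 0 then 0 else h (n - 1) / K (n - 1)))"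
  proof (cases n)
    case 0
    then show ?thesis by (simp add: w_def)
  next
    case (Suc m)
    have "rec_a2 \<mu> \<nu> \<alpha> \<theta> (Suc m) = lower_term \<mu> \<nu> (Suc m) * U m / (s (Suc m) * s m)"
      using lower_upper_rec_a2[OF assms(1,2), of m \<theta> \<alpha>]
      by (simp add: U_def s_def power2_eq_square mult_ac)
    then show ?thesis
      using s0[of m] s0[of n] K0[of m] U0[of m] unfolding Suc w_def
      by (simp add: KS field_simps)
  qed
  with main show "poly (pCons 0 (Ppoly \<mu> \<nu> \<alpha> \<theta> n)) z =
     poly (Ppoly \<mu> \<nu> \<alpha> \<theta> (Suc n) + smult (rec_b \<mu> \<nu> \<alpha> \<theta> n) (Ppoly \<mu> \<nu> \<alpha> \<theta> n)
     + smult (rec_a2 \<mu> \<nu> \<alpha> \<theta> n) (if n = 0 then 0 else Ppoly \<mu> \<nu> \<alpha> \<theta> (n - 1))) z"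
    by (simp add: P b split: if_splits)
qed

section \<open>The Hilbert space of square-summable sequences\<close>

lemma summable_sq_add:
  fixes f g :: "nat \<Rightarrow> complex"
  assumes "summable (\<lambda>n. (cmod (f n))\<^sup>2)" "summable (\<lambda>n. (cmod (g n))\<^sup>2)"
  shows "summable (\<lambda>n. (cmod (f n + g n))\<^sup>2)"
proof (rule summable_comparison_test')
  show "summable (\<lambda>n. 2 * (cmod (f n))\<^sup>2 + 2 * (cmod (g n))\<^sup>2)"
    using assms by (intro summable_add summable_mult)
  fix n
  have "(cmod (f n + g n))\<^sup>2 \<le> (cmod (f n) + cmod (g n))\<^sup>2"
    by (intro power_mono norm_triangle_ineq) simp
  also have "\<dots> \<le> 2 * (cmod (f n))\<^sup>2 + 2 * (cmod (g n))\<^sup>2"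
    using sum_squares_bound[of "cmod (f n)" "cmod (g n)"] by (simp add: power2_sum)
  finally show "norm ((cmod (f n + g n))\<^sup>2) \<le> 2 * (cmod (f n))\<^sup>2 + 2 * (cmod (g n))\<^sup>2"
    by simp
qed

lemma summable_sq_mult:
  fixes f :: "nat \<Rightarrow> complex"
  assumes "summable (\<lambda>n. (cmod (f n))\<^sup>2)"
  shows "summable (\<lambda>n. (cmod (c * f n))\<^sup>2)"
  using summable_mult[OF assms, of "(cmod c)\<^sup>2"] by (simp add: norm_mult power_mult_distrib)

lemma summable_sq_prod:
  fixes f g :: "nat \<Rightarrow> complex"
  assumes "summable (\<lambda>n. (cmod (f n))\<^sup>2)" "summable (\<lambda>n. (cmod (g n))\<^sup>2)"
  shows "summable (\<lambda>n. f n * cnj (g n))"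
proof (rule summable_comparison_test')
  show "summable (\<lambda>n. (cmod (f n))\<^sup>2 + (cmod (g n))\<^sup>2)"
    using assms by (intro summable_add)
  fix n
  have "2 * (cmod (f n) * cmod (g n)) \<le> (cmod (f n))\<^sup>2 + (cmod (g n))\<^sup>2"
    using sum_squares_bound[of "cmod (f n)" "cmod (g n)"] by simp
  moreover have "0 \<le> cmod (f n) * cmod (g n)" by simp
  ultimately show "norm (f n * cnj (g n)) \<le> (cmod (f n))\<^sup>2 + (cmod (g n))\<^sup>2"
    unfolding norm_mult complex_mod_cnj by linarith
qed

typedef ell2 = "{f :: nat \<Rightarrow> complex. summable (\<lambda>n. (cmod (f n))\<^sup>2)}"
  morphisms coord Abs_ell2
  by (rule exI[of _ "\<lambda>_. 0"]) simp

lemma summable_coord: "summable (\<lambda>n. (cmod (coord x n))\<^sup>2)"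
  using coord[of x] by simp

lemma coord_Abs: "summable (\<lambda>n. (cmod (f n))\<^sup>2) \<Longrightarrow> coord (Abs_ell2 f) = f"
  by (simp add: Abs_ell2_inverse)

lemma ell2_eqI: "(\<And>n. coord x n = coord y n) \<Longrightarrow> x = y"
  by (metis coord_inject ext)

definition scaleC_ell2 :: "complex \<Rightarrow> ell2 \<Rightarrow> ell2" where
  "scaleC_ell2 c x = Abs_ell2 (\<lambda>n. c * coord x n)"

text \<open>Linear in the first argument, conjugate linear in the second.\<close>

definition cinner :: "ell2 \<Rightarrow> ell2 \<Rightarrow> complex" where
  "cinner x y = (\<Sum>n. coord x n * cnj (coord y n))"

lemma coord_scaleC [simp]: "coord (scaleC_ell2 c x) n = c * coord x n"
  unfolding scaleC_ell2_def by (subst coord_Abs) (auto intro: summable_sq_mult summable_coord)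

lemma summable_cinner: "summable (\<lambda>n. coord x n * cnj (coord y n))"
  by (intro summable_sq_prod summable_coord)

instantiation ell2 :: real_inner
begin

definition zero_ell2 :: ell2 where "0 = Abs_ell2 (\<lambda>_. 0)"
definition plus_ell2 :: "ell2 \<Rightarrow> ell2 \<Rightarrow> ell2" where
  "x + y = Abs_ell2 (\<lambda>n. coord x n + coord y n)"
definition uminus_ell2 :: "ell2 \<Rightarrow> ell2" where "- x = scaleC_ell2 (-1) x"
definition minus_ell2 :: "ell2 \<Rightarrow> ell2 \<Rightarrow> ell2" where "x - y = x + - (y :: ell2)"
definition scaleR_ell2 :: "real \<Rightarrow> ell2 \<Rightarrow> ell2" where
  "r *\<^sub>R x = scaleC_ell2 (complex_of_real r) x"
definition inner_ell2 :: "ell2 \<Rightarrow> ell2 \<Rightarrow> real" where "inner x y = Re (cinner x y)"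
definition norm_ell2 :: "ell2 \<Rightarrow> real" where "norm x = sqrt (inner x (x :: ell2))"
definition dist_ell2 :: "ell2 \<Rightarrow> ell2 \<Rightarrow> real" where "dist x y = norm (x - (y :: ell2))"
definition sgn_ell2 :: "ell2 \<Rightarrow> ell2" where "sgn x = inverse (norm x) *\<^sub>R (x :: ell2)"
definition uniformity_ell2 :: "(ell2 \<times> ell2) filter" where
  "uniformity = (INF e\<in>{0<..}. principal {(x, y :: ell2). dist x y < e})"
definition open_ell2 :: "ell2 set \<Rightarrow> bool" where
  "open S \<longleftrightarrow> (\<forall>x\<in>S. \<forall>\<^sub>F (x', y) in uniformity. x' = (x :: ell2) \<longrightarrow> y \<in> S)"

lemma coord_zero [simp]: "coord 0 n = 0"
  by (simp add: zero_ell2_def coord_Abs)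

lemma coord_add [simp]: "coord (x + y) n = coord x n + coord y n"
  by (simp add: plus_ell2_def coord_Abs summable_sq_add summable_coord)

lemma coord_uminus [simp]: "coord (- x) n = - coord x n"
  by (simp add: uminus_ell2_def)

lemma coord_diff [simp]: "coord (x - y) n = coord x n - coord y n"
  by (simp add: minus_ell2_def)

lemma coord_scaleR [simp]: "coord (r *\<^sub>R x) n = r *\<^sub>R coord x n"
  by (simp add: scaleR_ell2_def scaleR_conv_of_real)

lemma inner_ell2_sums: "(\<lambda>n. Re (coord x n * cnj (coord y n))) sums inner x y"
  unfolding inner_ell2_def cinner_def
  by (rule bounded_linear.sums[OF bounded_linear_Re summable_sums[OF summable_cinner]])

lemma inner_self_sums: "(\<lambda>n. (cmod (coord x n))\<^sup>2) sums inner x x"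
  using inner_ell2_sums[of x x] unfolding cmod_power2 by (simp add: power2_eq_square)

instance
proof
  fix x y z :: ell2 and r s :: real
  show "x + y + z = x + (y + z)" "x + y = y + x" "0 + x = x" "- x + x = 0" "x - y = x + - y"
    "r *\<^sub>R (x + y) = r *\<^sub>R x + r *\<^sub>R y" "(r + s) *\<^sub>R x = r *\<^sub>R x + s *\<^sub>R x"
    "r *\<^sub>R s *\<^sub>R x = (r * s) *\<^sub>R x" "1 *\<^sub>R x = x"
    by (rule ell2_eqI, simp add: algebra_simps scaleR_conv_of_real)+
  show "dist x y = norm (x - y)" "sgn x = inverse (norm x) *\<^sub>R x" "norm x = sqrt (inner x x)"
    by (rule dist_ell2_def sgn_ell2_def norm_ell2_def)+
  show "uniformity = (INF e\<in>{0<..}. principal {(x, y :: ell2). dist x y < e})"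
    by (rule uniformity_ell2_def)
  show "open U \<longleftrightarrow> (\<forall>x\<in>U. \<forall>\<^sub>F (x', y) in uniformity. x' = x \<longrightarrow> y \<in> U)" for U :: "ell2 set"
    by (rule open_ell2_def)
  show "inner x y = inner y x"
    using inner_ell2_sums[of x y] inner_ell2_sums[of y x]
    by (simp add: sums_iff mult.commute)
  have "(\<lambda>n. Re (coord (x + y) n * cnj (coord z n))) sums (inner x z + inner y z)"
    using sums_add[OF inner_ell2_sums[of x z] inner_ell2_sums[of y z]]
    by (simp add: algebra_simps)
  then show "inner (x + y) z = inner x z + inner y z"
    using inner_ell2_sums[of "x + y" z] sums_unique2 by blast
  have "(\<lambda>n. Re (coord (r *\<^sub>R x) n * cnj (coord y n))) sums (r * inner x y)"
    using sums_mult[OF inner_ell2_sums[of x y], of r] by (simp add: algebra_simps)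
  then show "inner (r *\<^sub>R x) y = r * inner x y"
    using inner_ell2_sums[of "r *\<^sub>R x" y] sums_unique2 by blast
  show "0 \<le> inner x x"
    using sums_le[OF _ sums_zero inner_self_sums[of x]] by simp
  show "inner x x = 0 \<longleftrightarrow> x = 0"
  proof
    assume "inner x x = 0"
    then have "\<forall>n. (cmod (coord x n))\<^sup>2 = 0"
      using inner_self_sums[of x] suminf_eq_zero_iff[OF summable_coord[of x]]
      by (simp add: sums_iff)
    then show "x = 0" by (intro ell2_eqI) simp
  next
    assume "x = 0"
    then show "inner x x = 0" using inner_self_sums[of x] by (simp add: sums_iff)
  qed
qed

end

definition unit_ell2 :: "nat \<Rightarrow> ell2" where
  "unit_ell2 k = Abs_ell2 (\<lambda>n. if n = k then 1 else 0)"

section \<open>Operators\<close>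

text \<open>\<open>bounded_linear\<close> is boundedness and linearity over the reals.\<close>

definition bounded_clinear :: "(ell2 \<Rightarrow> ell2) \<Rightarrow> bool" where
  "bounded_clinear T \<longleftrightarrow>
     bounded_linear T \<and> (\<forall>c x. T (scaleC_ell2 c x) = scaleC_ell2 c (T x))"

definition compact_operator :: "(ell2 \<Rightarrow> ell2) \<Rightarrow> bool" where
  "compact_operator T \<longleftrightarrow> bounded_clinear T \<and> compact (closure (T ` cball 0 1))"

text \<open>\<open>P\<close> is the positive square root \<open>|T|\<close> of \<open>T\<^sup>* T\<close>; the last conjunct is
  \<open>\<langle>P\<^sup>2 x, y\<rangle> = \<langle>T\<^sup>* T x, y\<rangle>\<close>.\<close>

definition is_abs_operator :: "(ell2 \<Rightarrow> ell2) \<Rightarrow> (ell2 \<Rightarrow> ell2) \<Rightarrow> bool" where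
  "is_abs_operator P T \<longleftrightarrow>
     bounded_clinear P \<and> (\<forall>x. cinner (P x) x \<in> \<real> \<and> 0 \<le> Re (cinner (P x) x)) \<and>
     (\<forall>x y. cinner (P (P x)) y = cinner (T x) (T y))"

text \<open>Trace class: \<open>tr |T| = \<Sum> \<langle>|T| e\<^sub>n, e\<^sub>n\<rangle> < \<infinity>\<close>; the sum of these nonnegative numbers does not
  depend on the choice of the orthonormal basis, here the standard one.\<close>

definition trace_class :: "(ell2 \<Rightarrow> ell2) \<Rightarrow> bool" where
  "trace_class T \<longleftrightarrow> bounded_clinear T \<and>
     (\<exists>P. is_abs_operator P T \<and> summable (\<lambda>n. Re (cinner (P (unit_ell2 n)) (unit_ell2 n))))"

definition op_spectrum :: "(ell2 \<Rightarrow> ell2) \<Rightarrow> complex set" where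
  "op_spectrum T = {z. \<not> (\<exists>S. bounded_clinear S \<and>
      (\<forall>x. S (T x - scaleC_ell2 z x) = x) \<and> (\<forall>x. T (S x) - scaleC_ell2 z (S x) = x))}"

section \<open>The Jacobi matrix as an operator\<close>

text \<open>The off-diagonal entry \<open>a\<^sub>n\<close> joins the positions \<open>n - 1\<close> and \<open>n\<close> (for \<open>n \<ge> 1\<close>).\<close>

definition jacobi_matrix :: "(nat \<Rightarrow> complex) \<Rightarrow> (nat \<Rightarrow> complex) \<Rightarrow> nat \<Rightarrow> nat \<Rightarrow> complex" where
  "jacobi_matrix a b i j =
     (if i = j then b i else if j = Suc i then a j else if i = Suc j then a i else 0)"

definition matrix_operator :: "(nat \<Rightarrow> nat \<Rightarrow> complex) \<Rightarrow> ell2 \<Rightarrow> ell2" where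
  "matrix_operator M x = Abs_ell2 (\<lambda>i. \<Sum>j. M i j * coord x j)"

lemma coord_jacobi_operator:
  assumes "Bseq a" "Bseq b"
  shows "coord (matrix_operator (jacobi_matrix a b) x) n =
     (if n = 0 then 0 else a n * coord x (n - 1)) + b n * coord x n + a (Suc n) * coord x (Suc n)"
proof -
  define f where "f n = (if n = 0 then 0 else a n * coord x (n - 1)) + b n * coord x n
    + a (Suc n) * coord x (Suc n)" for n
  have row: "(\<Sum>j. jacobi_matrix a b i j * coord x j) = f i" for i
  proof -
    have "(\<Sum>j. jacobi_matrix a b i j * coord x j) =
        (\<Sum>j\<in>{i - 1, i, Suc i}. jacobi_matrix a b i j * coord x j)"
      by (rule suminf_finite) (auto simp: jacobi_matrix_def)
    also have "\<dots> = f i"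
      by (cases i) (auto simp: jacobi_matrix_def f_def)
    finally show ?thesis .
  qed
  have bd: "summable (\<lambda>n. (cmod (c n * g n))\<^sup>2)"
    if "Bseq c" and g: "summable (\<lambda>n. (cmod (g n))\<^sup>2)" for c g :: "nat \<Rightarrow> complex"
  proof -
    obtain K where K: "K > 0" "\<And>n. cmod (c n) \<le> K"
      using BseqE[OF \<open>Bseq c\<close>] by auto
    show ?thesis
    proof (rule summable_comparison_test')
      show "summable (\<lambda>n. K\<^sup>2 * (cmod (g n))\<^sup>2)" by (intro summable_mult g)
      show "norm ((cmod (c n * g n))\<^sup>2) \<le> K\<^sup>2 * (cmod (g n))\<^sup>2" for n
        using K(2)[of n] K(1)
        by (simp add: norm_mult power_mult_distrib mult_right_mono power_mono)
    qed
  qed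
  have up: "summable (\<lambda>n. (cmod (a (Suc n) * coord x (Suc n)))\<^sup>2)"
    using bd[OF assms(1) summable_coord] by (subst summable_Suc_iff)
  have low: "summable (\<lambda>n. (cmod (if n = 0 then 0 else a n * coord x (n - 1)))\<^sup>2)"
    by (subst summable_Suc_iff[symmetric])
      (use bd[OF _ summable_coord, of "\<lambda>n. a (Suc n)" x] assms(1) in \<open>simp add: Bseq_Suc_iff\<close>)
  have "summable (\<lambda>n. (cmod (f n))\<^sup>2)"
    unfolding f_def by (intro summable_sq_add low up bd[OF assms(2) summable_coord])
  then have "coord (matrix_operator (jacobi_matrix a b) x) = f"
    unfolding matrix_operator_def row by (rule coord_Abs)
  then show ?thesis by (simp add: f_def)
qed

text \<open>The entries \<open>a\<^sub>n\<close> are the square roots of \<open>a\<^sub>n\<^sup>2\<close>. If \<open>\<alpha>\<close> is so negative that some \<open>a\<^sub>n\<^sup>2\<close>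
  (necessarily finitely many) is negative, the principal complex root is taken and the matrix is
  complex symmetric; otherwise \<open>csqrt\<close> is the ordinary nonnegative root.\<close>

definition J_operator :: "real \<Rightarrow> real \<Rightarrow> real \<Rightarrow> real \<Rightarrow> ell2 \<Rightarrow> ell2" where
  "J_operator \<mu> \<nu> \<alpha> \<theta> =
     matrix_operator (jacobi_matrix
       (\<lambda>n. csqrt (complex_of_real (rec_a2 \<mu> \<nu> \<alpha> \<theta> n)))
       (\<lambda>n. complex_of_real (rec_b \<mu> \<nu> \<alpha> \<theta> n)))"

section \<open>Orthogonality measures\<close>

definition orthogonality_measure :: "real measure \<Rightarrow> (nat \<Rightarrow> real poly) \<Rightarrow> bool" where
  "orthogonality_measure M p \<longleftrightarrow>
     sets M = sets borel \<and> (\<forall>k. integrable M (\<lambda>t. t ^ k)) \<and>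
     (\<forall>m n. m \<noteq> n \<longrightarrow> (\<integral>t. poly (p m) t * poly (p n) t \<partial>M) = 0) \<and>
     (\<forall>n. (\<integral>t. (poly (p n) t)\<^sup>2 \<partial>M) > 0)"

definition discrete_measure_on :: "real measure \<Rightarrow> real set \<Rightarrow> bool" where
  "discrete_measure_on M S \<longleftrightarrow> countable S \<and> S \<in> sets M \<and> emeasure M (space M - S) = 0"

end

theory Submission
  imports Defs "HOL-Real_Asymp.Real_Asymp"
begin

text \<open>
  The entries of the Jacobi matrix \<open>J\<close> satisfy \<open>a\<^sub>n, b\<^sub>n = O(n\<^sup>-\<^sup>2)\<close>, so the row bounds
  \<open>h\<^sub>n = |a\<^sub>n| + |b\<^sub>n| + |a\<^sub>n\<^sub>+\<^sub>1|\<close> are summable. Since \<open>|(Jx)\<^sub>n| \<le> h\<^sub>n \<parallel>x\<parallel>\<close>, the image of the unit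
  ball lies in a Hilbert cube and \<open>J\<close> is compact (\<open>compact_operator_jac\<close>). The trace of \<open>|J|\<close> is
  finite because \<open>\<langle>|J| e\<^sub>n, e\<^sub>n\<rangle> \<le> \<parallel>|J| e\<^sub>n\<parallel> = \<parallel>J e\<^sub>n\<parallel> \<le> h\<^sub>n\<close> (\<open>trace_class_jac\<close>); the operator \<open>|J|\<close> itself is
  a norm limit of polynomials in \<open>J\<^sup>* J\<close> (\<open>positive_square_root\<close>).

  If \<open>\<alpha>\<close> is very negative, some \<open>a\<^sub>n\<^sup>2\<close> is negative and \<open>J\<close> is complex symmetric but not self-adjoint.
  Three facts about the spectrum therefore avoid self-adjointness.
  A nonzero spectral value is an eigenvalue: otherwise \<open>J - z\<close> is bounded below by compactness, and
  symmetry turns this into surjectivity (\<open>spectrum_iff\<close>).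
  The eigenvalues are summable: Gram-Schmidt applied to eigenvectors of distinct eigenvalues
  \<open>\<lambda>\<^sub>i\<close> gives orthonormal \<open>u\<^sub>i\<close> with \<open>\<langle>J u\<^sub>i, u\<^sub>i\<rangle> = \<lambda>\<^sub>i\<close>, and Bessel's inequality in each coordinate yields
  \<open>\<Sum> |\<lambda>\<^sub>i| \<le> \<Sum> h\<^sub>n\<close> (\<open>sum_cmod_spectrum_le\<close>). So the spectrum is countable with \<open>0\<close> as its only possible
  limit point, and \<open>0\<close> belongs to it since \<open>J e\<^sub>n \<rightarrow> 0\<close>.
  The spectrum is infinite: as \<open>a\<^sub>n\<^sup>2 > 0\<close> for \<open>n > N\<close>, deleting the first \<open>N + 1\<close> rows and columns leaves a
  self-adjoint compact operator. Its eigenvectors are complete and its eigenvalues simple, so it has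
  infinitely many of them, and they are the poles of its function \<open>m(t) = \<Sum> w\<^sub>k\<^sup>2 / (\<lambda>\<^sub>k - t)\<close>. A real \<open>t\<close> with
  \<open>P\<^sub>N\<^sub>+\<^sub>1(t) + a\<^sub>N\<^sub>+\<^sub>1\<^sup>2 P\<^sub>N(t) m(t) = 0\<close> is an eigenvalue of \<open>J\<close>. Between two adjacent poles near \<open>0\<close>
  the polynomial \<open>P\<^sub>N\<close> has no zero while \<open>m\<close> passes from \<open>-\<infinity>\<close> to \<open>+\<infinity>\<close>, and the intermediate value
  theorem supplies such a \<open>t\<close> (\<open>infinite_spectrum\<close>).

  An orthogonality measure \<open>M\<close> can exist only if every \<open>a\<^sub>n\<^sup>2\<close> is positive, and then \<open>J\<close> is self-adjoint.
  For real \<open>s\<close> outside the spectrum, truncating \<open>(J - s)\<^sup>-\<^sup>1 e\<^sub>0\<close> produces polynomials \<open>q\<close> with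
  \<open>(t - s) q(t) \<rightarrow> 1\<close> in \<open>L\<^sup>2(M)\<close> and bounded norm. Hence an interval of radius \<open>d\<close> about \<open>s\<close> has
  mass \<open>O(d\<^sup>2)\<close>, uniformly for \<open>s\<close> in a small interval, and cutting that interval into \<open>n\<close> pieces shows
  that its mass vanishes (\<open>resolvent_set_null\<close>). Conversely, for positive \<open>a\<^sub>n\<^sup>2\<close> the spectral measure of \<open>J\<close>
  at \<open>e\<^sub>0\<close> is an orthogonality measure (\<open>spectral_measure\<close>).
\<close>

section \<open>The sequence space as a complex Hilbert space\<close>

lemma cinner_sums: "(\<lambda>n. coord x n * cnj (coord y n)) sums cinner x y"
  unfolding cinner_def by (rule summable_sums[OF summable_cinner])

lemma cinner_commute: "cinner y x = cnj (cinner x y)"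
proof -
  have "(\<lambda>n. cnj (coord x n * cnj (coord y n))) sums cnj (cinner x y)"
    by (rule bounded_linear.sums[OF bounded_linear_cnj cinner_sums])
  then have "(\<lambda>n. coord y n * cnj (coord x n)) sums cnj (cinner x y)"
    by (simp add: mult.commute)
  then show ?thesis by (rule sums_unique2[OF cinner_sums])
qed

lemma cinner_add_left: "cinner (x + y) z = cinner x z + cinner y z"
  using sums_add[OF cinner_sums[of x z] cinner_sums[of y z]] cinner_sums[of "x + y" z]
  by (simp add: algebra_simps sums_unique2)

lemma cinner_scaleC_left: "cinner (scaleC_ell2 c x) y = c * cinner x y"
  using sums_mult[OF cinner_sums[of x y], of c] cinner_sums[of "scaleC_ell2 c x" y]
  by (simp add: algebra_simps sums_unique2)

lemma cinner_add_right: "cinner z (x + y) = cinner z x + cinner z y"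
  using cinner_add_left[of x y z] by (simp add: cinner_commute[of z])

lemma cinner_scaleC_right: "cinner x (scaleC_ell2 c y) = cnj c * cinner x y"
  using cinner_scaleC_left[of c y x] by (simp add: cinner_commute[of x])

lemma scaleR_eq_scaleC: "r *\<^sub>R x = scaleC_ell2 (complex_of_real r) x"
  by (rule ell2_eqI) (simp add: scaleR_conv_of_real)

lemma scaleC_scaleC: "scaleC_ell2 c (scaleC_ell2 d x) = scaleC_ell2 (c * d) x"
  by (rule ell2_eqI) (simp add: mult_ac)

lemma scaleC_one [simp]: "scaleC_ell2 1 x = x"
  and scaleC_zero_left [simp]: "scaleC_ell2 0 x = 0"
  and scaleC_zero_right [simp]: "scaleC_ell2 c 0 = 0"
  by (rule ell2_eqI, simp)+

lemma scaleC_add_right: "scaleC_ell2 c (x + y) = scaleC_ell2 c x + scaleC_ell2 c y"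
  and scaleC_diff_right: "scaleC_ell2 c (x - y) = scaleC_ell2 c x - scaleC_ell2 c y"
  and scaleC_add_left: "scaleC_ell2 (c + d) x = scaleC_ell2 c x + scaleC_ell2 d x"
  by (rule ell2_eqI, simp add: algebra_simps)+

lemma cinner_zero [simp]: "cinner 0 x = 0" "cinner x 0 = 0"
  by (simp_all add: cinner_def)

lemma cinner_diff_left: "cinner (x - y) z = cinner x z - cinner y z"
  using cinner_add_left[of "x - y" y z] by simp

lemma cinner_sum_left: "cinner (\<Sum>i\<in>A. f i) y = (\<Sum>i\<in>A. cinner (f i) y)"
  by (induction A rule: infinite_finite_induct) (simp_all add: cinner_add_left)

lemma coord_sum [simp]: "coord (\<Sum>i\<in>A. f i) n = (\<Sum>i\<in>A. coord (f i) n)"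
  by (induction A rule: infinite_finite_induct) simp_all

lemma norm_sq_sums: "(\<lambda>n. (cmod (coord x n))\<^sup>2) sums (norm x)\<^sup>2"
  using inner_self_sums[of x] by (simp add: power2_norm_eq_inner)

lemma cinner_self: "cinner x x = complex_of_real ((norm x)\<^sup>2)"
proof -
  have "(\<lambda>n. complex_of_real ((cmod (coord x n))\<^sup>2)) sums complex_of_real ((norm x)\<^sup>2)"
    using norm_sq_sums by (rule sums_of_real)
  then have "(\<lambda>n. coord x n * cnj (coord x n)) sums complex_of_real ((norm x)\<^sup>2)"
    by (simp only: complex_norm_square)
  then show ?thesis by (rule sums_unique2[OF cinner_sums])
qed

lemma norm_scaleC [simp]: "norm (scaleC_ell2 c x) = cmod c * norm x"
proof -
  have "(\<lambda>n. (cmod (coord (scaleC_ell2 c x) n))\<^sup>2) sums ((cmod c)\<^sup>2 * (norm x)\<^sup>2)"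
    using sums_mult[OF norm_sq_sums[of x], of "(cmod c)\<^sup>2"]
    by (simp add: norm_mult power_mult_distrib)
  then have "(norm (scaleC_ell2 c x))\<^sup>2 = (cmod c * norm x)\<^sup>2"
    unfolding power_mult_distrib by (rule sums_unique2[OF norm_sq_sums])
  then show ?thesis by (subst (asm) power2_eq_iff_nonneg) auto
qed

lemma cmod_coord_le: "cmod (coord x n) \<le> norm x"
proof -
  have "(\<Sum>k\<in>{n}. (cmod (coord x k))\<^sup>2) \<le> (\<Sum>k. (cmod (coord x k))\<^sup>2)"
    by (rule sum_le_suminf[OF summable_coord]) auto
  then have "(cmod (coord x n))\<^sup>2 \<le> (norm x)\<^sup>2"
    using norm_sq_sums[of x] by (simp add: sums_iff)
  then show ?thesis by (rule power2_le_imp_le) simp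
qed

lemma Re_cinner: "Re (cinner x y) = inner x y"
  by (simp add: inner_ell2_def)

lemma Im_cinner: "Im (cinner x y) = inner x (scaleC_ell2 \<i> y)"
  by (simp add: inner_ell2_def cinner_scaleC_right)

lemma inner_scaleC_i: "inner (scaleC_ell2 \<i> x) y = - inner x (scaleC_ell2 \<i> y)"
  by (simp add: inner_ell2_def cinner_scaleC_right cinner_scaleC_left)

lemma coord_unit [simp]: "coord (unit_ell2 k) n = (if n = k then 1 else 0)"
proof -
  have "summable (\<lambda>n. (cmod (if n = k then 1 else 0))\<^sup>2)"
    by (rule summable_finite[of "{k}"]) auto
  then show ?thesis by (simp add: unit_ell2_def coord_Abs)
qed

lemma cinner_unit: "cinner x (unit_ell2 n) = coord x n"
proof -
  have "cinner x (unit_ell2 n) = (\<Sum>k\<in>{n}. coord x k * cnj (coord (unit_ell2 n) k))"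
    unfolding cinner_def by (rule suminf_finite) auto
  then show ?thesis by simp
qed

lemma norm_unit [simp]: "norm (unit_ell2 n) = 1"
proof -
  have "complex_of_real ((norm (unit_ell2 n))\<^sup>2) = complex_of_real 1"
    using cinner_self[of "unit_ell2 n"] unfolding cinner_unit by simp
  then have "(norm (unit_ell2 n))\<^sup>2 = 1\<^sup>2" unfolding of_real_eq_iff by simp
  then show ?thesis by (subst (asm) power2_eq_iff_nonneg) auto
qed

lemma bounded_linear_coord: "bounded_linear (\<lambda>x. coord x n)"
  by (rule bounded_linear_intro[where K = 1]) (auto simp: cmod_coord_le)

lemma bounded_linear_scaleC: "bounded_linear (scaleC_ell2 c)"
  by (rule bounded_linear_intro[where K = "cmod c"]) (auto intro!: ell2_eqI simp: algebra_simps)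

instance ell2 :: banach
proof
  fix X :: "nat \<Rightarrow> ell2" assume X: "Cauchy X"
  have "Cauchy (\<lambda>k. coord (X k) n)" for n
    by (rule bounded_linear.Cauchy[OF bounded_linear_coord X])
  then have "\<exists>l. (\<lambda>k. coord (X k) n) \<longlonglongrightarrow> l" for n
    by (simp add: Cauchy_convergent_iff convergent_def)
  then obtain l where l: "\<And>n. (\<lambda>k. coord (X k) n) \<longlonglongrightarrow> l n" by metis
  \<comment> \<open>The coordinatewise limit is the norm limit: the bound \<open>e\<close> holds for every finite partial
    sum after \<open>j \<rightarrow> \<infinity>\<close>, and only then does the summation range grow.\<close>
  have tail: "summable (\<lambda>n. (cmod (coord (X k) n - l n))\<^sup>2) \<and>
      (\<Sum>n. (cmod (coord (X k) n - l n))\<^sup>2) \<le> e\<^sup>2"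
    if e: "\<And>j. j \<ge> k \<Longrightarrow> norm (X k - X j) \<le> e" for k e
  proof -
    have e0: "0 \<le> e" using e[of k] by simp
    have part: "(\<Sum>n<N. (cmod (coord (X k) n - l n))\<^sup>2) \<le> e\<^sup>2" for N
    proof (rule LIMSEQ_le_const2)
      show "(\<lambda>j. \<Sum>n<N. (cmod (coord (X k) n - coord (X j) n))\<^sup>2)
        \<longlonglongrightarrow> (\<Sum>n<N. (cmod (coord (X k) n - l n))\<^sup>2)"
        by (intro tendsto_intros l)
      have "(\<Sum>n<N. (cmod (coord (X k) n - coord (X j) n))\<^sup>2) \<le> e\<^sup>2" if "j \<ge> k" for j
      proof -
        have "(\<Sum>n<N. (cmod (coord (X k - X j) n))\<^sup>2) \<le> (norm (X k - X j))\<^sup>2"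
          using sum_le_suminf[OF summable_coord[of "X k - X j"], of "{..<N}"]
            norm_sq_sums[of "X k - X j"] by (simp add: sums_iff)
        also have "\<dots> \<le> e\<^sup>2" using e[OF that] by (intro power_mono) auto
        finally show ?thesis by simp
      qed
      then show "\<exists>M. \<forall>j\<ge>M. (\<Sum>n<N. (cmod (coord (X k) n - coord (X j) n))\<^sup>2) \<le> e\<^sup>2" by blast
    qed
    have "summable (\<lambda>n. (cmod (coord (X k) n - l n))\<^sup>2)"
      by (rule bounded_imp_summable[where B = "e\<^sup>2"])
        (use part[of "Suc _"] in \<open>auto simp: lessThan_Suc_atMost\<close>)
    then show ?thesis using part suminf_le_const[OF _ part] by blast
  qed
  have C: "\<exists>M. \<forall>k\<ge>M. \<forall>j\<ge>k. norm (X k - X j) \<le> e" if epos: "e > 0" for e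
  proof -
    have "\<forall>e>0. \<exists>M. \<forall>k\<ge>M. \<forall>j\<ge>M. norm (X k - X j) < e"
      using X unfolding Cauchy_iff .
    then obtain M where "\<forall>k\<ge>M. \<forall>j\<ge>M. norm (X k - X j) < e" using epos by blast
    then show ?thesis by (meson le_trans less_imp_le)
  qed
  obtain M where "\<forall>k\<ge>M. \<forall>j\<ge>k. norm (X k - X j) \<le> 1" using C[of 1] by auto
  then have "summable (\<lambda>n. (cmod (coord (X M) n - l n))\<^sup>2)" using tail[of M 1] by blast
  from summable_sq_add[OF summable_sq_mult[OF this, of "-1"] summable_coord[of "X M"]]
  have sl: "summable (\<lambda>n. (cmod (l n))\<^sup>2)" by simp
  have "X \<longlonglongrightarrow> Abs_ell2 l"
  proof (rule LIMSEQ_I)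
    fix r :: real assume r: "0 < r"
    obtain M where M: "\<forall>k\<ge>M. \<forall>j\<ge>k. norm (X k - X j) \<le> r/2" using C[of "r/2"] r by auto
    have "norm (X k - Abs_ell2 l) < r" if "k \<ge> M" for k
    proof -
      have "(norm (X k - Abs_ell2 l))\<^sup>2 \<le> (r/2)\<^sup>2"
        using norm_sq_sums[of "X k - Abs_ell2 l"] tail[of k "r/2"] M that
        by (simp add: sums_iff coord_Abs[OF sl])
      then have "norm (X k - Abs_ell2 l) \<le> r/2"
        by (rule power2_le_imp_le) (use r in simp)
      then show ?thesis using r by simp
    qed
    then show "\<exists>M. \<forall>k\<ge>M. norm (X k - Abs_ell2 l) < r" by blast
  qed
  then show "convergent X" by (auto simp: convergent_def)
qed

definition cnj_ell2 :: "ell2 \<Rightarrow> ell2" where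
  "cnj_ell2 x = Abs_ell2 (\<lambda>n. cnj (coord x n))"

lemma coord_cnj [simp]: "coord (cnj_ell2 x) n = cnj (coord x n)"
  unfolding cnj_ell2_def by (subst coord_Abs) (auto intro: summable_coord)

lemma cnj_cnj_ell2 [simp]: "cnj_ell2 (cnj_ell2 x) = x"
  and cnj_ell2_zero [simp]: "cnj_ell2 0 = 0"
  and cnj_ell2_diff: "cnj_ell2 (x - y) = cnj_ell2 x - cnj_ell2 y"
  and cnj_ell2_scaleC: "cnj_ell2 (scaleC_ell2 c x) = scaleC_ell2 (cnj c) (cnj_ell2 x)"
  by (rule ell2_eqI, simp)+

section \<open>Jacobi operators with summable entries\<close>

abbreviation jac :: "(nat \<Rightarrow> complex) \<Rightarrow> (nat \<Rightarrow> complex) \<Rightarrow> ell2 \<Rightarrow> ell2" where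
  "jac a b \<equiv> matrix_operator (jacobi_matrix a b)"

definition jac_bound :: "(nat \<Rightarrow> complex) \<Rightarrow> (nat \<Rightarrow> complex) \<Rightarrow> nat \<Rightarrow> real" where
  "jac_bound a b n = cmod (a n) + cmod (b n) + cmod (a (Suc n))"

text \<open>The sum of the squares \<open>h\<^sub>n\<^sup>2\<close> is at most the square of the sum \<open>\<Sum> h\<^sub>n\<close>; this replaces the usual
  two-norm estimate and keeps all bounds in terms of one summable sequence.\<close>

lemma norm_le_of_coord_le:
  assumes "\<And>n. cmod (coord x n) \<le> h n * c" and h: "\<And>n. 0 \<le> h n" "summable h" and c: "0 \<le> c"
  shows "norm x \<le> suminf h * c"
proof (rule power2_le_imp_le)
  show "0 \<le> suminf h * c" using h c by (simp add: suminf_nonneg)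
  have "(\<Sum>n<N. (cmod (coord x n))\<^sup>2) \<le> (suminf h * c)\<^sup>2" for N
  proof -
    have "(\<Sum>n<N. (cmod (coord x n))\<^sup>2) \<le> (\<Sum>n<N. h n * c * (suminf h * c))"
    proof (rule sum_mono)
      fix n
      have "h n \<le> suminf h" using sum_le_suminf[OF h(2), of "{n}"] h(1) by simp
      then have "h n * c \<le> suminf h * c" using c by (rule mult_right_mono)
      then have "cmod (coord x n) \<le> suminf h * c" using assms(1)[of n] by linarith
      with assms(1)[of n] show "(cmod (coord x n))\<^sup>2 \<le> h n * c * (suminf h * c)"
        unfolding power2_eq_square by (rule mult_mono) (simp_all add: h c)
    qed
    also have "\<dots> = (\<Sum>n<N. h n) * (c * (suminf h * c))"
      by (simp only: sum_distrib_right mult.assoc)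
    also have "\<dots> \<le> suminf h * (c * (suminf h * c))"
      using h c by (intro mult_right_mono sum_le_suminf) (auto simp: suminf_nonneg)
    finally show ?thesis by (simp add: power2_eq_square mult_ac)
  qed
  then have "(\<Sum>n. (cmod (coord x n))\<^sup>2) \<le> (suminf h * c)\<^sup>2"
    by (rule suminf_le_const[OF summable_coord])
  then show "(norm x)\<^sup>2 \<le> (suminf h * c)\<^sup>2"
    using norm_sq_sums[of x] by (simp add: sums_iff)
qed

locale summable_jacobi =
  fixes a b :: "nat \<Rightarrow> complex"
  assumes summable_a: "summable (\<lambda>n. cmod (a n))" and summable_b: "summable (\<lambda>n. cmod (b n))"
begin

lemma Bseq_a: "Bseq a" and Bseq_b: "Bseq b"
  using summable_LIMSEQ_zero[OF summable_a] summable_LIMSEQ_zero[OF summable_b]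
  by (auto intro!: convergent_imp_Bseq convergentI dest!: tendsto_norm_zero_cancel)

lemma coord_jac:
  "coord (jac a b x) n = (if n = 0 then 0 else a n * coord x (n - 1)) + b n * coord x n
     + a (Suc n) * coord x (Suc n)"
  by (rule coord_jacobi_operator[OF Bseq_a Bseq_b])

lemma jac_bound_nonneg: "0 \<le> jac_bound a b n"
  by (simp add: jac_bound_def)

lemma summable_jac_bound: "summable (jac_bound a b)"
  unfolding jac_bound_def using summable_a summable_b summable_Suc_iff[of "\<lambda>n. cmod (a n)"]
  by (intro summable_add) simp_all

lemma cmod_coord_jac_le: "cmod (coord (jac a b x) n) \<le> jac_bound a b n * norm x"
proof -
  have "cmod (coord (jac a b x) n) \<le> cmod (if n = 0 then 0 else a n * coord x (n - 1))
     + cmod (b n * coord x n) + cmod (a (Suc n) * coord x (Suc n))"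
    unfolding coord_jac by (intro norm_triangle_le add_mono norm_triangle_ineq order_refl)
  also have "\<dots> \<le> cmod (a n) * norm x + cmod (b n) * norm x + cmod (a (Suc n)) * norm x"
    by (intro add_mono) (auto simp: norm_mult intro!: mult_left_mono cmod_coord_le)
  finally show ?thesis by (simp add: jac_bound_def distrib_right)
qed

lemma norm_jac_le: "norm (jac a b x) \<le> suminf (jac_bound a b) * norm x"
  by (rule norm_le_of_coord_le[OF cmod_coord_jac_le jac_bound_nonneg summable_jac_bound]) simp

lemma bounded_clinear_jac: "bounded_clinear (jac a b)"
  unfolding bounded_clinear_def
proof (intro conjI allI)
  show "bounded_linear (jac a b)"
    by (rule bounded_linear_intro[where K = "suminf (jac_bound a b)"])
      (use norm_jac_le in \<open>auto intro!: ell2_eqI simp: coord_jac algebra_simps\<close>)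
  show "jac a b (scaleC_ell2 c x) = scaleC_ell2 c (jac a b x)" for c x
    by (rule ell2_eqI) (simp add: coord_jac algebra_simps)
qed

lemma bounded_linear_jac: "bounded_linear (jac a b)"
  and jac_scaleC: "jac a b (scaleC_ell2 c x) = scaleC_ell2 c (jac a b x)"
  using bounded_clinear_jac by (auto simp: bounded_clinear_def)

lemma summable_jacobi_cnj: "summable_jacobi (\<lambda>n. cnj (a n)) (\<lambda>n. cnj (b n))"
  by unfold_locales (simp_all add: summable_a summable_b)

lemma jac_cnj: "jac (\<lambda>n. cnj (a n)) (\<lambda>n. cnj (b n)) (cnj_ell2 x) = cnj_ell2 (jac a b x)"
proof -
  interpret c: summable_jacobi "\<lambda>n. cnj (a n)" "\<lambda>n. cnj (b n)" by (rule summable_jacobi_cnj)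
  show ?thesis by (rule ell2_eqI) (simp add: coord_jac c.coord_jac)
qed

text \<open>Row by row the two sides differ by a telescoping sum whose boundary term
  \<open>a\<^sub>n (x\<^sub>n\<^sub>-\<^sub>1 y\<^sub>n - x\<^sub>n y\<^sub>n\<^sub>-\<^sub>1)\<close>, with the entries of \<open>y\<close> conjugated, is a discrete Wronskian and
  tends to \<open>0\<close> with \<open>a\<^sub>n\<close>.\<close>

lemma cinner_jac:
  "cinner (jac a b x) y = cinner x (jac (\<lambda>n. cnj (a n)) (\<lambda>n. cnj (b n)) y)"
proof -
  interpret c: summable_jacobi "\<lambda>n. cnj (a n)" "\<lambda>n. cnj (b n)" by (rule summable_jacobi_cnj)
  define s where "s n = (if n = 0 then 0 else a n * coord x (n - 1) * cnj (coord y n)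
    - a n * coord x n * cnj (coord y (n - 1)))" for n
  have B: "s \<longlonglongrightarrow> 0"
  proof (rule Lim_null_comparison)
    show "\<forall>\<^sub>F n in sequentially. norm (s n) \<le> cmod (a n) * (2 * norm x * norm y)"
    proof (intro always_eventually allI)
      fix n
      have *: "cmod (a n * coord x i * cnj (coord y j)) \<le> cmod (a n) * (norm x * norm y)" for i j
        by (simp add: norm_mult mult.assoc mult_left_mono mult_mono cmod_coord_le)
      have "norm (s n) \<le> cmod (a n) * (norm x * norm y) + cmod (a n) * (norm x * norm y)"
        using norm_triangle_le_diff[OF add_mono[OF *[of "n - 1" n] *[of n "n - 1"]]]
        by (cases n) (simp_all add: s_def)
      then show "norm (s n) \<le> cmod (a n) * (2 * norm x * norm y)" by (simp add: algebra_simps)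
    qed
    show "(\<lambda>n. cmod (a n) * (2 * norm x * norm y)) \<longlonglongrightarrow> 0"
      by (intro tendsto_mult_left_zero summable_LIMSEQ_zero summable_a)
  qed
  let ?J = "jac (\<lambda>n. cnj (a n)) (\<lambda>n. cnj (b n))"
  have "(\<lambda>n. coord (jac a b x) n * cnj (coord y n) - coord x n * cnj (coord (?J y) n))
      = (\<lambda>n. s n - s (Suc n))"
    by (rule ext) (simp add: coord_jac c.coord_jac s_def algebra_simps)
  moreover have "(\<lambda>n. s n - s (Suc n)) sums (s 0 - 0)"
    by (rule telescope_sums'[OF B])
  ultimately have "(\<lambda>n. coord (jac a b x) n * cnj (coord y n) - coord x n * cnj (coord (?J y) n))
      sums s 0" by simp
  then have "cinner (jac a b x) y - cinner x (?J y) = s 0"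
    by (rule sums_unique2[OF sums_diff[OF cinner_sums[of "jac a b x" y] cinner_sums[of x "?J y"]]])
  then show ?thesis by (simp add: s_def)
qed

end

text \<open>Dominated convergence for square-summable sequences.\<close>

lemma tendsto_Abs_ell2:
  assumes f: "\<And>n. (\<lambda>k. f k n) \<longlonglongrightarrow> g n" and h: "summable (\<lambda>n. (h n)\<^sup>2)"
    and bound: "\<And>k n. cmod (f k n) \<le> h n" "\<And>n. cmod (g n) \<le> h n"
  shows "(\<lambda>k. Abs_ell2 (f k)) \<longlonglongrightarrow> Abs_ell2 g"
proof -
  have h0: "0 \<le> h n" for n using bound(2)[of n] norm_ge_zero order_trans by blast
  have sq: "summable (\<lambda>n. (cmod (u n))\<^sup>2)" if "\<And>n. cmod (u n) \<le> h n" for u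
    by (rule summable_comparison_test'[OF h]) (use that in \<open>simp add: power_mono\<close>)
  have D: "(\<lambda>k. \<Sum>n. (cmod (f k n - g n))\<^sup>2) \<longlonglongrightarrow> (\<Sum>n. (0::real))"
  proof (rule tannerys_theorem[THEN conjunct2, THEN conjunct2])
    show "((\<lambda>k. (cmod (f k n - g n))\<^sup>2) \<longlonglongrightarrow> 0)" for n
      using tendsto_power[OF tendsto_norm[OF tendsto_diff[OF f[of n] tendsto_const[of "g n"]]], of 2]
      by simp
    show "\<forall>\<^sub>F (n, k) in at_top \<times>\<^sub>F sequentially. norm ((cmod (f k n - g n))\<^sup>2) \<le> (2 * h n)\<^sup>2"
    proof (intro always_eventually allI, clarify)
      fix n k
      have "cmod (f k n - g n) \<le> 2 * h n"
        using norm_triangle_ineq4[of "f k n" "g n"] bound(1)[of k n] bound(2)[of n] by linarith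
      then show "norm ((cmod (f k n - g n))\<^sup>2) \<le> (2 * h n)\<^sup>2" using power_mono[of _ "2 * h n" 2] by simp
    qed
    show "summable (\<lambda>n. (2 * h n)\<^sup>2)" using summable_mult[OF h, of 4] by (simp add: power_mult_distrib)
  qed auto
  have eq: "(\<Sum>n. (cmod (f k n - g n))\<^sup>2) = (norm (Abs_ell2 (f k) - Abs_ell2 g))\<^sup>2" for k
    using norm_sq_sums[of "Abs_ell2 (f k) - Abs_ell2 g"]
    by (simp add: sums_iff coord_Abs[OF sq] bound)
  have "(\<lambda>k. sqrt ((norm (Abs_ell2 (f k) - Abs_ell2 g))\<^sup>2)) \<longlonglongrightarrow> sqrt 0"
    using D unfolding eq by (intro tendsto_real_sqrt) simp
  then have "(\<lambda>k. norm (Abs_ell2 (f k) - Abs_ell2 g)) \<longlonglongrightarrow> 0" by simp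
  then show ?thesis by (rule Lim_null[THEN iffD2, OF tendsto_norm_zero_cancel])
qed

text \<open>On the cube the product topology, in which compactness is Tychonoff's theorem, and the norm
  topology agree by dominated convergence.\<close>

lemma compact_Hilbert_cube:
  assumes h: "summable (\<lambda>n. (h n)\<^sup>2)" and h0: "\<And>n. 0 \<le> h n"
  shows "compact {x. \<forall>n. cmod (coord x n) \<le> h n}"
proof -
  define Q where "Q = PiE UNIV (\<lambda>n. cball (0::complex) (h n))"
  have Q: "compact Q"
    unfolding Q_def
    using compactin_PiE[of "\<lambda>_. euclidean" "UNIV :: nat set" "\<lambda>n. cball (0::complex) (h n)"]
    by (simp add: euclidean_product_topology)
  have inQ: "f \<in> Q \<longleftrightarrow> (\<forall>n. cmod (f n) \<le> h n)" for f by (auto simp: Q_def)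
  have "continuous_on Q Abs_ell2"
    unfolding continuous_on_sequentially
  proof (intro allI ballI impI)
    fix u f assume "f \<in> Q" and *: "(\<forall>k. u k \<in> Q) \<and> u \<longlonglongrightarrow> f"
    have "(\<lambda>k. u k n) \<longlonglongrightarrow> f n" for n
      using * continuous_on_tendsto_compose[OF continuous_on_product_coordinates[of n], of u f] by simp
    with * \<open>f \<in> Q\<close> show "(Abs_ell2 \<circ> u) \<longlonglongrightarrow> Abs_ell2 f"
      unfolding o_def by (intro tendsto_Abs_ell2[OF _ h]) (auto simp: inQ)
  qed
  then have "compact (Abs_ell2 ` Q)" using Q by (rule compact_continuous_image)
  also have "Abs_ell2 ` Q = {x. \<forall>n. cmod (coord x n) \<le> h n}"
  proof (intro set_eqI iffI)
    fix x assume "x \<in> Abs_ell2 ` Q"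
    then obtain f where f: "x = Abs_ell2 f" "\<And>n. cmod (f n) \<le> h n" by (auto simp: inQ)
    have "summable (\<lambda>n. (cmod (f n))\<^sup>2)"
      by (rule summable_comparison_test'[OF h]) (use f in \<open>simp add: power_mono\<close>)
    then show "x \<in> {x. \<forall>n. cmod (coord x n) \<le> h n}" using f by (simp add: coord_Abs)
  next
    fix x assume "x \<in> {x. \<forall>n. cmod (coord x n) \<le> h n}"
    then have "coord x \<in> Q" "x = Abs_ell2 (coord x)" by (auto simp: inQ coord_inverse)
    then show "x \<in> Abs_ell2 ` Q" by blast
  qed
  finally show ?thesis .
qed

context summable_jacobi
begin

lemma compact_operator_jac: "compact_operator (jac a b)"
  unfolding compact_operator_def
proof (intro conjI bounded_clinear_jac)
  let ?Q = "{x. \<forall>n. cmod (coord x n) \<le> jac_bound a b n}"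
  have "summable (\<lambda>n. (jac_bound a b n)\<^sup>2)"
  proof (rule summable_comparison_test_ev[OF _ summable_jac_bound])
    have "\<forall>\<^sub>F n in sequentially. jac_bound a b n < 1"
      using order_tendstoD(2)[OF summable_LIMSEQ_zero[OF summable_jac_bound]] by simp
    then show "\<forall>\<^sub>F n in sequentially. norm ((jac_bound a b n)\<^sup>2) \<le> jac_bound a b n"
      by eventually_elim (simp add: power2_eq_square mult_left_le jac_bound_nonneg)
  qed
  then have Q: "compact ?Q" using jac_bound_nonneg by (rule compact_Hilbert_cube)
  have "jac a b ` cball 0 1 \<subseteq> ?Q"
  proof clarify
    fix x :: ell2 and n assume "x \<in> cball 0 1"
    then have "jac_bound a b n * norm x \<le> jac_bound a b n"
      by (intro mult_left_le) (auto simp: jac_bound_nonneg)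
    then show "cmod (coord (jac a b x) n) \<le> jac_bound a b n"
      using cmod_coord_jac_le order_trans by blast
  qed
  then have "closure (jac a b ` cball 0 1) \<subseteq> ?Q" by (rule closure_minimal[OF _ compact_imp_closed[OF Q]])
  then show "compact (closure (jac a b ` cball 0 1))"
    using compact_Int_closed[OF Q closed_closure[of "jac a b ` cball 0 1"]]
    by (simp only: Int_absorb1)
qed

lemma jac_convergent_subsequence:
  assumes "\<And>k. norm (x k) \<le> 1"
  obtains r y where "strict_mono (r :: nat \<Rightarrow> nat)" "(\<lambda>k. jac a b (x (r k))) \<longlonglongrightarrow> y"
proof -
  have "seq_compact (closure (jac a b ` cball 0 1))"
    using compact_operator_jac by (simp add: compact_operator_def compact_eq_seq_compact_metric)
  moreover have "jac a b (x k) \<in> closure (jac a b ` cball 0 1)" for k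
    using assms closure_subset by fastforce
  ultimately have "\<exists>l. \<exists>r::nat \<Rightarrow> nat. strict_mono r \<and> (\<lambda>k. jac a b (x (r k))) \<longlonglongrightarrow> l"
    unfolding seq_compact_def o_def by (drule_tac spec[of _ "\<lambda>k. jac a b (x k)"]) auto
  then show ?thesis using that by blast
qed

end

section \<open>Nonzero spectrum consists of eigenvalues\<close>

text \<open>The positive operator \<open>A = T' T\<close> satisfies \<open>\<langle>A x, x\<rangle> \<ge> c\<^sup>2 \<parallel>x\<parallel>\<^sup>2\<close>. Therefore \<open>x \<mapsto> x - t (A x - y)\<close> is a
  contraction for a suitable step \<open>t\<close>, and its fixed point solves \<open>T' (T x) = y\<close>.\<close>

lemma adjoint_surj_if_bounded_below:
  fixes T T' :: "'a :: {real_inner, banach} \<Rightarrow> 'a"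
  assumes T: "bounded_linear T" and T': "bounded_linear T'"
    and adj: "\<And>x y. inner (T x) y = inner x (T' y)"
    and c: "0 < c" "\<And>x. c * norm x \<le> norm (T x)"
  shows "\<exists>w. T' w = y"
proof -
  interpret T: bounded_linear T by (rule T)
  interpret T': bounded_linear T' by (rule T')
  define A where "A x = T' (T x)" for x
  have "bounded_linear A" unfolding A_def by (rule bounded_linear_compose[OF T' T])
  then interpret A: bounded_linear A .
  obtain K0 where K0: "\<And>x. norm (A x) \<le> norm x * K0" using A.bounded by blast
  define K where "K = max K0 (c\<^sup>2)"
  have K: "norm (A x) \<le> K * norm x" for x
    using K0[of x] mult_left_mono[of K0 K "norm x"] by (simp add: K_def mult.commute)
  have Kc: "c\<^sup>2 \<le> K" "0 < K" using c(1) by (auto simp: K_def less_max_iff_disj)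
  have lower: "c\<^sup>2 * (norm x)\<^sup>2 \<le> inner (A x) x" for x
  proof -
    have "(c * norm x)\<^sup>2 \<le> (norm (T x))\<^sup>2" using c by (intro power_mono) auto
    also have "\<dots> = inner (A x) x"
      unfolding A_def by (metis adj inner_commute power2_norm_eq_inner)
    finally show ?thesis by (simp add: power_mult_distrib)
  qed
  \<comment> \<open>The step \<open>t\<close> minimises \<open>1 - 2 t c\<^sup>2 + t\<^sup>2 K\<^sup>2\<close>, the squared contraction factor; the minimum is \<open>q\<close>.\<close>
  define t where "t = c\<^sup>2 / K\<^sup>2"
  define q where "q = 1 - (c\<^sup>2 / K)\<^sup>2"
  have q: "0 \<le> q" "q < 1"
    using Kc c(1) by (auto simp: q_def power_le_one)
  define g where "g x = x - t *\<^sub>R (A x - y)" for x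
  have contr: "dist (g u) (g v) \<le> sqrt q * dist u v" for u v
  proof (rule power2_le_imp_le)
    define d where "d = u - v"
    have gd: "g u - g v = d - t *\<^sub>R A d"
      by (simp add: g_def d_def A.diff algebra_simps)
    have "(norm (d - t *\<^sub>R A d))\<^sup>2 = (norm d)\<^sup>2 - 2 * t * inner (A d) d + t\<^sup>2 * (norm (A d))\<^sup>2"
      unfolding power2_norm_eq_inner
      by (simp add: inner_diff_left inner_diff_right inner_commute power2_eq_square algebra_simps)
    also have "\<dots> \<le> (norm d)\<^sup>2 - 2 * t * (c\<^sup>2 * (norm d)\<^sup>2) + t\<^sup>2 * (K\<^sup>2 * (norm d)\<^sup>2)"
    proof (intro add_mono diff_mono order_refl mult_left_mono lower)
      show "(norm (A d))\<^sup>2 \<le> K\<^sup>2 * (norm d)\<^sup>2"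
        using power_mono[OF K[of d], of 2] by (simp add: power_mult_distrib)
    qed (simp_all add: t_def)
    also have "\<dots> = q * (norm d)\<^sup>2"
      using Kc(2) by (simp add: t_def q_def field_simps power2_eq_square)
    finally show "(dist (g u) (g v))\<^sup>2 \<le> (sqrt q * dist u v)\<^sup>2"
      using q by (simp add: dist_norm gd d_def power_mult_distrib)
  qed (use q in simp)
  have "\<exists>!x. g x = x"
    by (rule banach_fix_type[where c = "sqrt q"]) (use q contr in auto)
  then obtain x where "g x = x" by blast
  then have "A x = y" using Kc c(1) by (simp add: g_def t_def)
  then show ?thesis unfolding A_def by blast
qed

context summable_jacobi
begin

text \<open>If unit vectors satisfied \<open>J x\<^sub>k - z x\<^sub>k \<rightarrow> 0\<close>, compactness would give a convergent subsequence of \<open>J x\<^sub>k\<close>,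
  hence of \<open>x\<^sub>k\<close> because \<open>z \<noteq> 0\<close>, and its limit would be an eigenvector.\<close>

lemma jac_diff_bounded_below:
  assumes z: "z \<noteq> 0" and no: "\<And>x. jac a b x = scaleC_ell2 z x \<Longrightarrow> x = 0"
  shows "\<exists>c>0. \<forall>x. c * norm x \<le> norm (jac a b x - scaleC_ell2 z x)"
proof (rule ccontr)
  interpret J: bounded_linear "jac a b" by (rule bounded_linear_jac)
  assume neg: "\<not> ?thesis"
  have "\<exists>x. norm x = 1 \<and> norm (jac a b x - scaleC_ell2 z x) < inverse (real (Suc k))" for k
  proof -
    obtain x where x: "norm (jac a b x - scaleC_ell2 z x) < inverse (real (Suc k)) * norm x"
      using neg by (auto simp: not_le dest!: spec[of _ "inverse (real (Suc k))"])
    then have nx: "norm x > 0" by (cases "x = 0") (simp_all add: J.zero)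
    define y where "y = (1 / norm x) *\<^sub>R x"
    have "jac a b y - scaleC_ell2 z y = (1 / norm x) *\<^sub>R (jac a b x - scaleC_ell2 z x)"
      unfolding y_def by (rule ell2_eqI) (simp add: J.scaleR algebra_simps)
    then have "norm (jac a b y - scaleC_ell2 z y) = (1 / norm x) * norm (jac a b x - scaleC_ell2 z x)"
      by simp
    also have "\<dots> < (1 / norm x) * (inverse (real (Suc k)) * norm x)"
      using x nx by (intro mult_strict_left_mono) auto
    finally have "norm (jac a b y - scaleC_ell2 z y) < inverse (real (Suc k))"
      using nx by simp
    moreover have "norm y = 1" using nx by (simp add: y_def)
    ultimately show ?thesis by blast
  qed
  then obtain x where x1: "\<And>k. norm (x k) = 1"
    and x2: "\<And>k. norm (jac a b (x k) - scaleC_ell2 z (x k)) < inverse (real (Suc k))" by metis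
  obtain r y where r: "strict_mono r" and y: "(\<lambda>k. jac a b (x (r k))) \<longlonglongrightarrow> y"
    using jac_convergent_subsequence[of x] x1 by auto
  have "(\<lambda>k. jac a b (x k) - scaleC_ell2 z (x k)) \<longlonglongrightarrow> 0"
    by (rule tendsto_norm_zero_cancel, rule tendsto_0_le[OF LIMSEQ_inverse_real_of_nat, of _ 1])
      (use x2 in \<open>auto intro!: always_eventually less_imp_le\<close>)
  from LIMSEQ_subseq_LIMSEQ[OF this r]
  have "(\<lambda>k. jac a b (x (r k)) - (jac a b (x (r k)) - scaleC_ell2 z (x (r k)))) \<longlonglongrightarrow> y - 0"
    by (intro tendsto_diff y) (simp add: o_def)
  then have zx: "(\<lambda>k. scaleC_ell2 z (x (r k))) \<longlonglongrightarrow> y" by simp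
  have "(\<lambda>k. scaleC_ell2 (inverse z) (scaleC_ell2 z (x (r k)))) \<longlonglongrightarrow> scaleC_ell2 (inverse z) y"
    by (rule bounded_linear.tendsto[OF bounded_linear_scaleC zx])
  then have xr: "(\<lambda>k. x (r k)) \<longlonglongrightarrow> scaleC_ell2 (inverse z) y"
    using z by (simp add: scaleC_scaleC)
  define w where "w = scaleC_ell2 (inverse z) y"
  have "jac a b w = y"
    using J.tendsto[OF xr] y LIMSEQ_unique unfolding w_def by blast
  then have "jac a b w = scaleC_ell2 z w" using z by (simp add: w_def scaleC_scaleC)
  then have "w = 0" by (rule no)
  moreover have "(\<lambda>k. norm (x (r k))) \<longlonglongrightarrow> norm w" using tendsto_norm[OF xr] by (simp add: w_def)
  ultimately show False using x1 by (simp add: LIMSEQ_const_iff)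
qed

text \<open>The adjoint of \<open>J - z\<close> is its entrywise conjugate, so surjectivity of the adjoint carries over to
  \<open>J - z\<close> by conjugating vectors.\<close>

lemma not_in_spectrum_if_not_eigenvalue:
  assumes z: "z \<noteq> 0" and no: "\<And>x. jac a b x = scaleC_ell2 z x \<Longrightarrow> x = 0"
  shows "z \<notin> op_spectrum (jac a b)"
proof -
  interpret J: bounded_linear "jac a b" by (rule bounded_linear_jac)
  interpret c: summable_jacobi "\<lambda>n. cnj (a n)" "\<lambda>n. cnj (b n)" by (rule summable_jacobi_cnj)
  obtain c where c: "0 < c" and low: "\<And>x. c * norm x \<le> norm (jac a b x - scaleC_ell2 z x)"
    using jac_diff_bounded_below[OF assms] by blast
  let ?T = "\<lambda>x. jac a b x - scaleC_ell2 z x"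
  let ?T' = "\<lambda>x. jac (\<lambda>n. cnj (a n)) (\<lambda>n. cnj (b n)) x - scaleC_ell2 (cnj z) x"
  have T: "bounded_linear ?T" by (intro bounded_linear_sub bounded_linear_jac bounded_linear_scaleC)
  have T': "bounded_linear ?T'" by (intro bounded_linear_sub c.bounded_linear_jac bounded_linear_scaleC)
  interpret T: bounded_linear ?T by (rule T)
  have adj: "inner (?T x) y = inner x (?T' y)" for x y
    by (simp add: inner_diff_left inner_diff_right)
      (simp add: inner_ell2_def cinner_jac cinner_scaleC_left cinner_scaleC_right)
  have surj: "\<exists>x. ?T x = y" for y
  proof -
    obtain w where "?T' w = cnj_ell2 y"
      using adjoint_surj_if_bounded_below[OF T T' adj c low] by blast
    then have "cnj_ell2 (?T' w) = y" by simp
    moreover have "cnj_ell2 (?T' w) = ?T (cnj_ell2 w)"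
      using c.jac_cnj[of w] by (simp add: cnj_ell2_diff cnj_ell2_scaleC)
    ultimately show ?thesis by metis
  qed
  have inj: "x = y" if "?T x = ?T y" for x y
    using low[of "x - y"] that c T.diff[of x y] by (simp add: mult_le_0_iff)
  define S where "S y = (THE x. ?T x = y)" for y
  have S: "?T (S y) = y" for y
    unfolding S_def by (rule theI') (use surj inj in metis)
  have S': "S (?T x) = x" for x by (rule inj) (rule S)
  have "bounded_clinear S"
    unfolding bounded_clinear_def
  proof (intro conjI allI)
    show "bounded_linear S"
    proof (rule bounded_linear_intro[where K = "1 / c"])
      show "S (x + y) = S x + S y" for x y by (rule inj) (metis S T.add)
      show "S (r *\<^sub>R x) = r *\<^sub>R S x" for r x by (rule inj) (metis S T.scaleR)
      show "norm (S x) \<le> norm x * (1 / c)" for x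
        using low[of "S x"] c unfolding S by (simp add: field_simps)
    qed
    show "S (scaleC_ell2 d x) = scaleC_ell2 d (S x)" for d x
    proof (rule inj)
      have "?T (scaleC_ell2 d (S x)) = scaleC_ell2 d (?T (S x))"
        by (simp add: jac_scaleC scaleC_diff_right scaleC_scaleC mult.commute)
      then show "?T (S (scaleC_ell2 d x)) = ?T (scaleC_ell2 d (S x))" by (simp only: S)
    qed
  qed
  then show ?thesis unfolding op_spectrum_def using S S' by blast
qed

lemma norm_jac_unit_le: "norm (jac a b (unit_ell2 n)) \<le> jac_bound a b n"
proof -
  have "jac a b (unit_ell2 n) = (if n = 0 then 0 else scaleC_ell2 (a n) (unit_ell2 (n - 1)))
      + scaleC_ell2 (b n) (unit_ell2 n) + scaleC_ell2 (a (Suc n)) (unit_ell2 (Suc n))"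
    by (rule ell2_eqI) (auto simp: coord_jac)
  also have "norm \<dots> \<le> cmod (a n) + cmod (b n) + cmod (a (Suc n))"
    by (intro norm_triangle_mono) auto
  finally show ?thesis by (simp add: jac_bound_def)
qed

lemma zero_in_spectrum: "0 \<in> op_spectrum (jac a b)"
proof (rule ccontr)
  assume "0 \<notin> op_spectrum (jac a b)"
  then obtain S where S: "bounded_linear S" "\<And>x. S (jac a b x) = x"
    by (auto simp: op_spectrum_def bounded_clinear_def)
  obtain K where K: "0 < K" "\<And>x. norm (S x) \<le> norm x * K"
    using bounded_linear.pos_bounded[OF S(1)] by blast
  have "1 \<le> jac_bound a b n * K" for n
  proof -
    have "1 \<le> norm (jac a b (unit_ell2 n)) * K"
      using K(2)[of "jac a b (unit_ell2 n)"] by (simp add: S(2))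
    also have "\<dots> \<le> jac_bound a b n * K"
      using K(1) norm_jac_unit_le[of n] by (intro mult_right_mono) auto
    finally show ?thesis .
  qed
  moreover have "(\<lambda>n. jac_bound a b n * K) \<longlonglongrightarrow> 0"
    by (intro tendsto_mult_left_zero summable_LIMSEQ_zero summable_jac_bound)
  ultimately have "1 \<le> (0::real)" by (intro LIMSEQ_le_const[where X = "\<lambda>n. jac_bound a b n * K"]) auto
  then show False by simp
qed

lemma spectrum_iff:
  "z \<in> op_spectrum (jac a b) \<longleftrightarrow> z = 0 \<or> (\<exists>x. x \<noteq> 0 \<and> jac a b x = scaleC_ell2 z x)"
proof (cases "z = 0")
  case False
  have "x = 0" if "z \<notin> op_spectrum (jac a b)" and x: "jac a b x = scaleC_ell2 z x" for x
  proof -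
    obtain S where "bounded_clinear S" "\<And>x. S (jac a b x - scaleC_ell2 z x) = x"
      using \<open>z \<notin> op_spectrum (jac a b)\<close> by (auto simp: op_spectrum_def)
    then have "S 0 = 0" "S (jac a b x - scaleC_ell2 z x) = x"
      using linear_simps(3)[of S] by (auto simp: bounded_clinear_def)
    then have "x = 0" using x by simp
    then show ?thesis by simp
  qed
  then have *: "z \<notin> op_spectrum (jac a b) \<Longrightarrow> x \<noteq> 0 \<Longrightarrow> jac a b x \<noteq> scaleC_ell2 z x" for x
    by metis
  have "z \<in> op_spectrum (jac a b) \<longleftrightarrow> (\<exists>x. x \<noteq> 0 \<and> jac a b x = scaleC_ell2 z x)"
  proof
    assume "z \<in> op_spectrum (jac a b)"
    then show "\<exists>x. x \<noteq> 0 \<and> jac a b x = scaleC_ell2 z x"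
      by (rule contrapos_pp) (rule not_in_spectrum_if_not_eigenvalue[OF False], metis)
  next
    assume "\<exists>x. x \<noteq> 0 \<and> jac a b x = scaleC_ell2 z x"
    then obtain x where "x \<noteq> 0" "jac a b x = scaleC_ell2 z x" by (elim exE conjE)
    then show "z \<in> op_spectrum (jac a b)" using *[of x] by argo
  qed
  with False show ?thesis by simp
qed (simp add: zero_in_spectrum)

end

section \<open>The eigenvalues are absolutely summable\<close>

lemma cinner_sum_right: "cinner x (\<Sum>i\<in>A. f i) = (\<Sum>i\<in>A. cinner x (f i))"
  by (induction A rule: infinite_finite_induct) (simp_all add: cinner_add_right)

lemma Bessel_finite:
  fixes N :: nat
  assumes on: "\<And>i j. i < N \<Longrightarrow> j < N \<Longrightarrow> cinner (u i) (u j) = (if i = j then 1 else 0)"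
  shows "(\<Sum>i<N. (cmod (cinner x (u i)))\<^sup>2) \<le> (norm x)\<^sup>2"
proof -
  define p where "p = (\<Sum>i<N. scaleC_ell2 (cinner x (u i)) (u i))"
  let ?s = "\<Sum>i<N. (cmod (cinner x (u i)))\<^sup>2"
  have pu: "cinner p (u j) = cinner x (u j)" if "j < N" for j
  proof -
    have "cinner p (u j) = (\<Sum>i<N. if i = j then cinner x (u i) else 0)"
      unfolding p_def cinner_sum_left cinner_scaleC_left using on that by (intro sum.cong) auto
    then show ?thesis using that by simp
  qed
  have "cinner y p = (\<Sum>i<N. cnj (cinner x (u i)) * cinner y (u i))" for y
    unfolding p_def cinner_sum_right cinner_scaleC_right ..
  then have "cinner x p = complex_of_real ?s" "cinner p p = complex_of_real ?s"
    using pu by (auto simp: complex_norm_square mult.commute simp del: of_real_power intro!: sum.cong)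
  then have "inner x p = ?s" "inner p p = ?s" unfolding inner_ell2_def by simp_all
  then have "(norm (x - p))\<^sup>2 = (norm x)\<^sup>2 - ?s"
    unfolding power2_norm_eq_inner by (simp add: inner_diff_left inner_diff_right inner_commute)
  then show ?thesis using zero_le_power2[of "norm (x - p)"] by linarith
qed

fun gram_schmidt :: "(nat \<Rightarrow> ell2) \<Rightarrow> nat \<Rightarrow> ell2" where
  "gram_schmidt v n =
     (let w = v n - (\<Sum>j<n. scaleC_ell2 (cinner (v n) (gram_schmidt v j)) (gram_schmidt v j))
      in (1 / norm w) *\<^sub>R w)"

declare gram_schmidt.simps [simp del]

definition combinations :: "(nat \<Rightarrow> ell2) \<Rightarrow> nat \<Rightarrow> ell2 set" where
  "combinations u n = range (\<lambda>c. \<Sum>j<n. scaleC_ell2 (c j) (u j))"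

lemma combinations_add:
  assumes "x \<in> combinations u n" "y \<in> combinations u n"
  shows "x + y \<in> combinations u n"
proof -
  obtain c d where "x = (\<Sum>j<n. scaleC_ell2 (c j) (u j))" "y = (\<Sum>j<n. scaleC_ell2 (d j) (u j))"
    using assms by (auto simp: combinations_def)
  then have "x + y = (\<Sum>j<n. scaleC_ell2 (c j + d j) (u j))"
    by (simp add: scaleC_add_left sum.distrib)
  then show ?thesis unfolding combinations_def by (intro range_eqI)
qed

lemma scaleC_sum: "scaleC_ell2 c (\<Sum>i\<in>A. f i) = (\<Sum>i\<in>A. scaleC_ell2 c (f i))"
  by (induction A rule: infinite_finite_induct) (simp_all add: scaleC_add_right)

lemma combinations_scaleC:
  assumes "x \<in> combinations u n"
  shows "scaleC_ell2 c x \<in> combinations u n"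
proof -
  obtain d where "x = (\<Sum>j<n. scaleC_ell2 (d j) (u j))"
    using assms by (auto simp: combinations_def)
  then have "scaleC_ell2 c x = (\<Sum>j<n. scaleC_ell2 (c * d j) (u j))"
    by (simp add: scaleC_sum scaleC_scaleC)
  then show ?thesis unfolding combinations_def by (intro range_eqI)
qed

lemma combinations_zero: "0 \<in> combinations u n"
  unfolding combinations_def by (rule range_eqI[where x = "\<lambda>_. 0"]) simp

lemma combinations_sum:
  "(\<And>i. i \<in> A \<Longrightarrow> f i \<in> combinations u n) \<Longrightarrow> (\<Sum>i\<in>A. f i) \<in> combinations u n"
  by (induction A rule: infinite_finite_induct) (simp_all add: combinations_zero combinations_add)

lemma combinations_mono:
  assumes "m \<le> n" shows "combinations u m \<subseteq> combinations u n"
proof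
  fix x assume "x \<in> combinations u m"
  then obtain c where "x = (\<Sum>j<m. scaleC_ell2 (c j) (u j))" by (auto simp: combinations_def)
  also have "\<dots> = (\<Sum>j<n. scaleC_ell2 (if j < m then c j else 0) (u j))"
    using assms by (intro sum.mono_neutral_cong_left) auto
  finally show "x \<in> combinations u n"
    unfolding combinations_def by (rule range_eqI[where x = "\<lambda>j. if j < m then c j else 0"])
qed

lemma combinations_member:
  assumes "i < n" shows "u i \<in> combinations u n"
proof -
  have "u i = (\<Sum>j<n. scaleC_ell2 (if j = i then 1 else 0) (u j))"
    using assms by (subst sum.mono_neutral_right[of _ "{i}"]) auto
  then show ?thesis
    unfolding combinations_def by (rule range_eqI[where x = "\<lambda>j. if j = i then 1 else 0"])
qed

lemma cinner_combinations:
  assumes "x \<in> combinations u n" "\<And>j. j < n \<Longrightarrow> cinner (u j) y = 0"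
  shows "cinner x y = 0"
  using assms by (auto simp: combinations_def cinner_sum_left cinner_scaleC_left)

text \<open>Gram-Schmidt makes the operator upper triangular on the span of the eigenvectors, with the
  eigenvalues on the diagonal. The process does not break down: if \<open>v\<^sub>n\<close> were a combination of the
  earlier \<open>u\<^sub>j\<close>, comparing the coefficient of the last \<open>u\<^sub>k\<close> that occurs would give \<open>\<lambda>\<^sub>n = \<lambda>\<^sub>k\<close>.\<close>

lemma Schur_triangular:
  fixes T :: "ell2 \<Rightarrow> ell2" and lam :: "nat \<Rightarrow> complex"
  assumes T: "bounded_clinear T"
    and eig: "\<And>i. i < N \<Longrightarrow> T (v i) = scaleC_ell2 (lam i) (v i)" "\<And>i. i < N \<Longrightarrow> v i \<noteq> 0"
    and inj: "inj_on lam {..<N}"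
  defines "u \<equiv> gram_schmidt v"
  assumes n: "n < N"
  shows "(\<forall>j<n. cinner (u n) (u j) = 0) \<and> cinner (u n) (u n) = 1
    \<and> T (u n) - scaleC_ell2 (lam n) (u n) \<in> combinations u n"
  using n
proof (induction n rule: less_induct)
  case (less n)
  interpret T: bounded_linear T using T by (simp add: bounded_clinear_def)
  have TC: "T (scaleC_ell2 c x) = scaleC_ell2 c (T x)" for c x
    using T by (simp add: bounded_clinear_def)
  have IH: "j < i \<Longrightarrow> cinner (u i) (u j) = 0" "cinner (u i) (u i) = 1"
    "T (u i) - scaleC_ell2 (lam i) (u i) \<in> combinations u i" if "i < n" for i j
    using less.IH[of i] less.prems that by auto
  have on: "cinner (u i) (u j) = (if i = j then 1 else 0)" if "i < n" "j < n" for i j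
  proof (cases i j rule: linorder_cases)
    case less
    then show ?thesis using IH(1)[of j i] that cinner_commute[of "u j" "u i"] by simp
  qed (use IH that in auto)
  define c where "c j = cinner (v n) (u j)" for j
  define p where "p = (\<Sum>j<n. scaleC_ell2 (c j) (u j))"
  define w where "w = v n - p"
  have un: "u n = (1 / norm w) *\<^sub>R w"
    unfolding u_def by (subst gram_schmidt.simps) (simp add: Let_def w_def p_def c_def u_def)
  have Tp: "T p = (\<Sum>j<n. scaleC_ell2 (c j) (T (u j)))"
    unfolding p_def by (simp add: T.sum TC)
  have pu: "cinner p (u j) = c j" if "j < n" for j
  proof -
    have "cinner p (u j) = (\<Sum>i<n. if i = j then c i else 0)"
      unfolding p_def cinner_sum_left cinner_scaleC_left using on that by (intro sum.cong) auto
    then show ?thesis using that by simp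
  qed
  have w0: "w \<noteq> 0"
  proof
    assume "w = 0"
    then have vp: "v n = p" by (simp add: w_def)
    define K where "K = {j. j < n \<and> c j \<noteq> 0}"
    have "finite K" by (simp add: K_def)
    have "K \<noteq> {}"
    proof
      assume "K = {}"
      then have "p = 0" unfolding p_def K_def by (intro sum.neutral) auto
      then show False using vp eig(2)[OF less.prems] by simp
    qed
    define k where "k = Max K"
    have k: "k < n" "c k \<noteq> 0" using Max_in[OF \<open>finite K\<close> \<open>K \<noteq> {}\<close>] by (auto simp: k_def K_def)
    have above: "c j = 0" if "k < j" "j < n" for j
    proof (rule ccontr)
      assume "c j \<noteq> 0"
      then have "j \<in> K" using that by (simp add: K_def)
      then have "j \<le> k" unfolding k_def by (rule Max_ge[OF \<open>finite K\<close>])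
      then show False using that by simp
    qed
    have "lam n * c k = cinner (T (v n)) (u k)"
      using eig(1)[OF less.prems] by (simp add: cinner_scaleC_left c_def)
    also have "\<dots> = (\<Sum>j<n. c j * cinner (T (u j)) (u k))"
      unfolding vp Tp by (simp add: cinner_sum_left cinner_scaleC_left)
    also have "\<dots> = (\<Sum>j<n. if j = k then lam k * c k else 0)"
    proof (rule sum.cong[OF refl])
      fix j assume "j \<in> {..<n}"
      then have j: "j < n" by simp
      have "c j * cinner (T (u j)) (u k) = (if j = k then lam k * c k else 0)" if "j \<le> k"
      proof -
        have "cinner (T (u j) - scaleC_ell2 (lam j) (u j)) (u k) = 0"
          using IH(3)[OF j] by (rule cinner_combinations) (use on that k in auto)
        then show ?thesis
          using on[OF j k(1)] by (auto simp: cinner_diff_left cinner_scaleC_left)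
      qed
      then show "c j * cinner (T (u j)) (u k) = (if j = k then lam k * c k else 0)"
        using above[OF _ j] by (cases "j \<le> k") auto
    qed
    finally have "lam n = lam k" using k by simp
    then show False using inj_onD[OF inj] k(1) less.prems by force
  qed
  have orth: "cinner (u n) (u j) = 0" if "j < n" for j
    unfolding un using pu[OF that]
    by (simp add: scaleR_eq_scaleC cinner_scaleC_left w_def cinner_diff_left c_def)
  have "norm (u n) = 1" using w0 by (simp add: un)
  then have unit: "cinner (u n) (u n) = 1" by (simp add: cinner_self)
  have "T w - scaleC_ell2 (lam n) w = scaleC_ell2 (lam n) p - T p"
    unfolding w_def using eig(1)[OF less.prems] by (simp add: T.diff scaleC_diff_right)
  also have "\<dots> = (\<Sum>j<n. scaleC_ell2 (lam n * c j) (u j) + scaleC_ell2 (- c j) (T (u j)))"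
    unfolding Tp unfolding p_def scaleC_sum sum_subtractf[symmetric]
    by (intro sum.cong refl ell2_eqI) simp
  also have "\<dots> \<in> combinations u n"
  proof (intro combinations_sum combinations_add combinations_scaleC)
    fix j assume "j \<in> {..<n}"
    then have j: "j < n" by simp
    show "u j \<in> combinations u n" using j by (rule combinations_member)
    have "T (u j) - scaleC_ell2 (lam j) (u j) \<in> combinations u n"
      using IH(3)[OF j] combinations_mono[of j n] j by auto
    from combinations_add[OF this combinations_scaleC[OF combinations_member[OF j], of "lam j"]]
    show "T (u j) \<in> combinations u n" by simp
  qed
  finally have "scaleC_ell2 (complex_of_real (1 / norm w)) (T w - scaleC_ell2 (lam n) w)
      \<in> combinations u n" by (rule combinations_scaleC)
  also have "scaleC_ell2 (complex_of_real (1 / norm w)) (T w - scaleC_ell2 (lam n) w)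
      = T (u n) - scaleC_ell2 (lam n) (u n)"
    unfolding un scaleR_eq_scaleC TC by (rule ell2_eqI) (simp add: algebra_simps)
  finally show ?case using orth unit by simp
qed

context summable_jacobi
begin

text \<open>For each pair of coordinates, \<open>\<Sum>\<^sub>i |u\<^sub>i(m)| |u\<^sub>i(n)| \<le> 1\<close> by Bessel's inequality for the unit vectors
  \<open>e\<^sub>m\<close> and \<open>e\<^sub>n\<close>. Interchanging the sums over \<open>i\<close> and over the coordinates leaves only the sum of the matrix entries.\<close>

lemma sum_abs_diagonal_le:
  fixes N :: nat
  assumes on: "\<And>i j. i < N \<Longrightarrow> j < N \<Longrightarrow> cinner (u i) (u j) = (if i = j then 1 else 0)"
  shows "(\<Sum>i<N. cmod (cinner (jac a b (u i)) (u i))) \<le> suminf (jac_bound a b)"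
proof -
  define U where "U i n = cmod (coord (u i) n)" for i n
  define g where "g i n = cmod (a n) * (U i (n - 1) * U i n) + cmod (b n) * (U i n * U i n)
      + cmod (a (Suc n)) * (U i (Suc n) * U i n)" for i n
  have U0: "0 \<le> U i n" for i n by (simp add: U_def)
  have g0: "0 \<le> g i n" for i n by (simp add: g_def U0)
  have col: "(\<Sum>i<N. (U i n)\<^sup>2) \<le> 1" for n
  proof -
    have "U i n = cmod (cinner (unit_ell2 n) (u i))" for i
      using cinner_unit[of "u i" n] cinner_commute[of "unit_ell2 n" "u i"]
      by (simp add: U_def)
    then show ?thesis using Bessel_finite[OF on, of N "unit_ell2 n"] by simp
  qed
  have col2: "(\<Sum>i<N. U i m * U i n) \<le> 1" for m n
  proof -
    have "(\<Sum>i<N. U i m * U i n) \<le> (\<Sum>i<N. ((U i m)\<^sup>2 + (U i n)\<^sup>2) / 2)"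
    proof (rule sum_mono)
      show "U i m * U i n \<le> ((U i m)\<^sup>2 + (U i n)\<^sup>2) / 2" for i
        using sum_squares_bound[of "U i m" "U i n"] by simp
    qed
    also have "\<dots> = ((\<Sum>i<N. (U i m)\<^sup>2) + (\<Sum>i<N. (U i n)\<^sup>2)) / 2"
      by (simp add: sum.distrib sum_divide_distrib add_divide_distrib)
    also have "\<dots> \<le> (1 + 1) / 2" by (intro divide_right_mono add_mono col) simp
    finally show ?thesis by simp
  qed
  have G: "(\<Sum>i<N. g i n) \<le> jac_bound a b n" for n
  proof -
    have "(\<Sum>i<N. g i n) = cmod (a n) * (\<Sum>i<N. U i (n - 1) * U i n)
        + cmod (b n) * (\<Sum>i<N. U i n * U i n) + cmod (a (Suc n)) * (\<Sum>i<N. U i (Suc n) * U i n)"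
      unfolding g_def by (simp only: sum.distrib sum_distrib_left)
    also have "\<dots> \<le> cmod (a n) + cmod (b n) + cmod (a (Suc n))"
      by (intro add_mono mult_left_le col2) auto
    finally show ?thesis by (simp add: jac_bound_def)
  qed
  have sg: "summable (g i)" if "i < N" for i
  proof (rule summable_comparison_test'[OF summable_jac_bound])
    fix n
    have "g i n \<le> (\<Sum>i<N. g i n)" using that g0 by (intro member_le_sum) auto
    then show "norm (g i n) \<le> jac_bound a b n" using G[of n] g0[of i n] by simp
  qed
  have "cmod (cinner (jac a b (u i)) (u i)) \<le> suminf (g i)" if "i < N" for i
    unfolding cinner_def
  proof (rule norm_suminf_le[OF _ sg[OF that]])
    fix n
    have "cmod (coord (jac a b (u i)) n) \<le> cmod (if n = 0 then 0 else a n * coord (u i) (n - 1))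
       + cmod (b n * coord (u i) n) + cmod (a (Suc n) * coord (u i) (Suc n))"
      unfolding coord_jac by (intro norm_triangle_le add_mono norm_triangle_ineq order_refl)
    also have "\<dots> \<le> cmod (a n) * U i (n - 1) + cmod (b n) * U i n + cmod (a (Suc n)) * U i (Suc n)"
      by (simp add: norm_mult U_def)
    finally have "cmod (coord (jac a b (u i)) n) * U i n \<le>
       (cmod (a n) * U i (n - 1) + cmod (b n) * U i n + cmod (a (Suc n)) * U i (Suc n)) * U i n"
      using U0 by (rule mult_right_mono)
    then show "cmod (coord (jac a b (u i)) n * cnj (coord (u i) n)) \<le> g i n"
      by (simp add: norm_mult U_def g_def algebra_simps)
  qed
  then have "(\<Sum>i<N. cmod (cinner (jac a b (u i)) (u i))) \<le> (\<Sum>i<N. suminf (g i))"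
    by (intro sum_mono) auto
  also have "\<dots> = (\<Sum>n. \<Sum>i<N. g i n)"
    by (rule suminf_sum[symmetric]) (use sg in auto)
  also have "\<dots> \<le> suminf (jac_bound a b)"
    by (intro suminf_le G summable_sum summable_jac_bound) (use sg in auto)
  finally show ?thesis .
qed

text \<open>A form of Weyl's inequality; it holds for non-normal matrices because only diagonal values in the
  Schur basis are estimated.\<close>

lemma sum_cmod_spectrum_le:
  assumes F: "finite F" "F \<subseteq> op_spectrum (jac a b)"
  shows "(\<Sum>z\<in>F. cmod z) \<le> suminf (jac_bound a b)"
proof -
  let ?F = "F - {0}"
  obtain lam where lam: "bij_betw lam {..<card ?F} ?F"
    using ex_bij_betw_nat_finite[of ?F] F by (auto simp: atLeast0LessThan)
  let ?N = "card ?F"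
  have "\<exists>x. x \<noteq> 0 \<and> jac a b x = scaleC_ell2 (lam i) x" if "i < ?N" for i
  proof -
    have "lam i \<in> ?F" using bij_betwE[OF lam] that by simp
    then show ?thesis using F(2) spectrum_iff by auto
  qed
  then obtain v where v: "\<And>i. i < ?N \<Longrightarrow> jac a b (v i) = scaleC_ell2 (lam i) (v i)"
    "\<And>i. i < ?N \<Longrightarrow> v i \<noteq> 0" by metis
  define u where "u = gram_schmidt v"
  have inj: "inj_on lam {..<?N}" using lam by (simp add: bij_betw_def)
  have S: "\<And>n j. n < ?N \<Longrightarrow> j < n \<Longrightarrow> cinner (u n) (u j) = 0"
    "\<And>n. n < ?N \<Longrightarrow> cinner (u n) (u n) = 1"
    "\<And>n. n < ?N \<Longrightarrow> jac a b (u n) - scaleC_ell2 (lam n) (u n) \<in> combinations u n"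
    using Schur_triangular[where T = "jac a b" and N = ?N and v = v and lam = lam,
        OF bounded_clinear_jac v inj] unfolding u_def by blast+
  have on: "cinner (u i) (u j) = (if i = j then 1 else 0)" if "i < ?N" "j < ?N" for i j
  proof (cases i j rule: linorder_cases)
    case less
    then show ?thesis using S(1)[of j i] that cinner_commute[of "u j" "u i"] by simp
  qed (use S that in auto)
  have diag: "cinner (jac a b (u i)) (u i) = lam i" if "i < ?N" for i
  proof -
    have "cinner (jac a b (u i) - scaleC_ell2 (lam i) (u i)) (u i) = 0"
      using S(3)[OF that] by (rule cinner_combinations) (use on that in auto)
    then show ?thesis using S(2)[OF that] by (simp add: cinner_diff_left cinner_scaleC_left)
  qed
  have "(\<Sum>z\<in>F. cmod z) = (\<Sum>z\<in>?F. cmod z)"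
    using F(1) by (intro sum.mono_neutral_right) auto
  also have "\<dots> = (\<Sum>i<?N. cmod (lam i))"
    by (rule sum.reindex_bij_betw[OF lam, symmetric])
  also have "\<dots> = (\<Sum>i<?N. cmod (cinner (jac a b (u i)) (u i)))"
    by (intro sum.cong) (simp_all add: diag)
  also have "\<dots> \<le> suminf (jac_bound a b)" by (rule sum_abs_diagonal_le[OF on])
  finally show ?thesis .
qed

lemma finite_spectrum_outside:
  assumes e: "0 < e" shows "finite {z \<in> op_spectrum (jac a b). e \<le> cmod z}"
proof (rule ccontr)
  assume inf: "infinite {z \<in> op_spectrum (jac a b). e \<le> cmod z}"
  obtain n :: nat where n: "suminf (jac_bound a b) < real n * e"
    using reals_Archimedean3[OF e] by blast
  obtain F where F: "finite F" "card F = n" "F \<subseteq> {z \<in> op_spectrum (jac a b). e \<le> cmod z}"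
    using infinite_arbitrarily_large[OF inf] by blast
  have "real n * e = (\<Sum>z\<in>F. e)" using F by simp
  also have "\<dots> \<le> (\<Sum>z\<in>F. cmod z)" using F(3) by (intro sum_mono) auto
  also have "\<dots> \<le> suminf (jac_bound a b)" using F by (intro sum_cmod_spectrum_le) auto
  finally show False using n by simp
qed

lemma countable_spectrum: "countable (op_spectrum (jac a b))"
proof -
  let ?S = "op_spectrum (jac a b)"
  have "?S \<subseteq> insert 0 (\<Union>n. {z \<in> ?S. inverse (real (Suc n)) \<le> cmod z})"
  proof
    fix z assume z: "z \<in> ?S"
    show "z \<in> insert 0 (\<Union>n. {z \<in> ?S. inverse (real (Suc n)) \<le> cmod z})"
    proof (cases "z = 0")
      case False
      then obtain n where "inverse (real (Suc n)) < cmod z"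
        using reals_Archimedean[of "cmod z"] by auto
      with z show ?thesis by (intro insertI2 UN_I[of n]) auto
    qed simp
  qed
  moreover have "countable (\<Union>n. {z \<in> ?S. inverse (real (Suc n)) \<le> cmod z})"
    by (intro countable_UN countable_finite finite_spectrum_outside countableI_type) simp
  ultimately show ?thesis by (rule countable_subset[OF _ countable_insert])
qed

end

section \<open>Spectral theorem for real Jacobi operators\<close>

text \<open>Let \<open>s\<close> be the norm of \<open>T\<close> on \<open>W\<close>. For unit vectors with \<open>\<parallel>T x\<^sub>k\<parallel> \<rightarrow> s\<close>, symmetry gives
  \<open>T\<^sup>2 x\<^sub>k - s\<^sup>2 x\<^sub>k \<rightarrow> 0\<close>, so a limit point \<open>y\<close> satisfies \<open>(T - s) (T + s) y = 0\<close>: either \<open>(T + s) y\<close> or \<open>y\<close> itself is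
  an eigenvector.\<close>

lemma compact_symmetric_eigenvector:
  fixes T :: "'a :: {real_inner, banach} \<Rightarrow> 'a"
  assumes T: "bounded_linear T" and sym: "\<And>x y. inner (T x) y = inner x (T y)"
    and W: "subspace W" "closed W" "T ` W \<subseteq> W" and x0: "x0 \<in> W" "x0 \<noteq> 0"
    and compact: "\<And>x :: nat \<Rightarrow> 'a. (\<And>k. norm (x k) \<le> 1) \<Longrightarrow>
      \<exists>r l. strict_mono (r :: nat \<Rightarrow> nat) \<and> (\<lambda>k. T (x (r k))) \<longlonglongrightarrow> l"
  shows "\<exists>x\<in>W. x \<noteq> 0 \<and> (\<exists>t. T x = t *\<^sub>R x)"
proof -
  interpret T: bounded_linear T by (rule T)
  define B where "B = (\<lambda>x. norm (T x)) ` {x \<in> W. norm x = 1}"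
  define s where "s = Sup B"
  have unit: "(1 / norm x) *\<^sub>R x \<in> W \<and> norm ((1 / norm x) *\<^sub>R x) = 1" if "x \<in> W" "x \<noteq> 0" for x
    using that W(1) by (simp add: subspace_scale)
  have ne: "B \<noteq> {}" using unit[OF x0] by (auto simp: B_def)
  obtain K where K: "\<And>x. norm (T x) \<le> norm x * K" using T.bounded by blast
  have bdd: "bdd_above B"
    unfolding B_def by (rule bdd_aboveI2[of _ _ K]) (use K in \<open>metis (mono_tags) mem_Collect_eq mult_1\<close>)
  have le: "norm (T x) \<le> s * norm x" if "x \<in> W" for x
  proof (cases "x = 0")
    case False
    have "norm (T ((1 / norm x) *\<^sub>R x)) \<in> B" using unit[OF that False] unfolding B_def by blast
    then have "norm (T ((1 / norm x) *\<^sub>R x)) \<le> s" unfolding s_def by (rule cSup_upper[OF _ bdd])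
    then show ?thesis using False by (simp add: T.scaleR field_simps)
  qed (simp add: T.zero)
  show ?thesis
  proof (cases "s = 0")
    case True
    then have "T x0 = 0 *\<^sub>R x0" using le[OF x0(1)] by simp
    then show ?thesis using x0 by blast
  next
    case False
    have "0 \<le> s"
    proof -
      have "0 \<le> norm (T ((1 / norm x0) *\<^sub>R x0))" by (rule norm_ge_zero)
      also have "\<dots> \<le> s * norm ((1 / norm x0) *\<^sub>R x0)" using unit[OF x0] by (intro le) simp
      finally show ?thesis using unit[OF x0] by simp
    qed
    with False have s: "0 < s" by simp
    have "\<exists>x. x \<in> W \<and> norm x = 1 \<and> s - inverse (real (Suc k)) < norm (T x)" for k
    proof -
      have "s - inverse (real (Suc k)) < Sup B" by (simp add: s_def)
      then obtain y where "y \<in> B" "s - inverse (real (Suc k)) < y"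
        using less_cSup_iff[OF ne bdd] by blast
      then show ?thesis by (auto simp: B_def)
    qed
    then obtain x where x: "\<And>k. x k \<in> W" "\<And>k. norm (x k) = 1"
      "\<And>k. s - inverse (real (Suc k)) < norm (T (x k))" by metis
    have nT: "(\<lambda>k. norm (T (x k))) \<longlonglongrightarrow> s"
    proof (rule tendsto_sandwich[of "\<lambda>k. s - inverse (real (Suc k))" _ _ "\<lambda>_. s"])
      show "(\<lambda>k. s - inverse (real (Suc k))) \<longlonglongrightarrow> s"
        using tendsto_diff[OF tendsto_const[of s] LIMSEQ_inverse_real_of_nat] by simp
      show "\<forall>\<^sub>F k in sequentially. norm (T (x k)) \<le> s"
        using le[OF x(1)] x(2) by (intro always_eventually allI) (metis mult.right_neutral)
    qed (use x(3) in \<open>auto intro!: always_eventually less_imp_le\<close>)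
    have est: "(norm (T (T y) - s\<^sup>2 *\<^sub>R y))\<^sup>2 \<le> s\<^sup>2 * (s\<^sup>2 - (norm (T y))\<^sup>2)"
      if "y \<in> W" "norm y = 1" for y
    proof -
      have 1: "inner (T (T y)) y = (norm (T y))\<^sup>2" unfolding sym[of "T y"] power2_norm_eq_inner ..
      have "T y \<in> W" using W(3) that by blast
      from power_mono[OF le[OF this], of 2]
      have 2: "(norm (T (T y)))\<^sup>2 \<le> s\<^sup>2 * (norm (T y))\<^sup>2" by (simp add: power_mult_distrib)
      have 3: "inner y y = 1" using that(2) by (simp add: power2_norm_eq_inner[symmetric])
      have "(norm (T (T y) - s\<^sup>2 *\<^sub>R y))\<^sup>2
          = inner (T (T y)) (T (T y)) - 2 * s\<^sup>2 * inner (T (T y)) y + s\<^sup>2 * s\<^sup>2 * inner y y"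
        unfolding power2_norm_eq_inner
        by (simp add: inner_diff_left inner_diff_right inner_commute[of y "T (T y)"] algebra_simps)
      also have "\<dots> = (norm (T (T y)))\<^sup>2 - 2 * s\<^sup>2 * (norm (T y))\<^sup>2 + s\<^sup>2 * s\<^sup>2"
        by (simp only: 1 3 power2_norm_eq_inner mult_1_right)
      also have "\<dots> \<le> s\<^sup>2 * (s\<^sup>2 - (norm (T y))\<^sup>2)"
        using 2 by (simp add: algebra_simps)
      finally show ?thesis .
    qed
    have D: "(\<lambda>k. T (T (x k)) - s\<^sup>2 *\<^sub>R x k) \<longlonglongrightarrow> 0"
    proof -
      have "(\<lambda>k. s\<^sup>2 * (s\<^sup>2 - (norm (T (x k)))\<^sup>2)) \<longlonglongrightarrow> s\<^sup>2 * (s\<^sup>2 - s\<^sup>2)"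
        by (intro tendsto_intros nT)
      then have lim: "(\<lambda>k. s\<^sup>2 * (s\<^sup>2 - (norm (T (x k)))\<^sup>2)) \<longlonglongrightarrow> 0" by simp
      have "(\<lambda>k. (norm (T (T (x k)) - s\<^sup>2 *\<^sub>R x k))\<^sup>2) \<longlonglongrightarrow> 0"
      proof (rule Lim_null_comparison[OF always_eventually lim], rule allI)
        show "norm ((norm (T (T (x k)) - s\<^sup>2 *\<^sub>R x k))\<^sup>2) \<le> s\<^sup>2 * (s\<^sup>2 - (norm (T (x k)))\<^sup>2)" for k
          using est[OF x(1) x(2), of k] by (simp only: real_norm_def abs_power2)
      qed
      then have "(\<lambda>k. sqrt ((norm (T (T (x k)) - s\<^sup>2 *\<^sub>R x k))\<^sup>2)) \<longlonglongrightarrow> sqrt 0"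
        by (rule tendsto_real_sqrt)
      then show ?thesis by (simp only: real_sqrt_abs abs_norm_cancel real_sqrt_zero tendsto_norm_zero_iff)
    qed
    obtain r l where r: "strict_mono (r :: nat \<Rightarrow> nat)" and l: "(\<lambda>k. T (x (r k))) \<longlonglongrightarrow> l"
      using compact[of x] x(2) by auto
    have Dr: "(\<lambda>k. T (T (x (r k))) - s\<^sup>2 *\<^sub>R x (r k)) \<longlonglongrightarrow> 0"
      using LIMSEQ_subseq_LIMSEQ[OF D r] by (simp add: o_def)
    have "(\<lambda>k. T (T (x (r k))) - (T (T (x (r k))) - s\<^sup>2 *\<^sub>R x (r k))) \<longlonglongrightarrow> T l - 0"
      by (intro tendsto_diff T.tendsto l Dr)
    then have "(\<lambda>k. s\<^sup>2 *\<^sub>R x (r k)) \<longlonglongrightarrow> T l" by simp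
    from tendsto_scaleR[OF tendsto_const[of "inverse (s\<^sup>2)"] this]
    have y: "(\<lambda>k. x (r k)) \<longlonglongrightarrow> inverse (s\<^sup>2) *\<^sub>R T l" using s by simp
    define y where "y = inverse (s\<^sup>2) *\<^sub>R T l"
    note y = y[folded y_def]
    have yW: "y \<in> W" using closed_sequentially[OF W(2) _ y] x(1) by blast
    have "(\<lambda>k. norm (x (r k))) \<longlonglongrightarrow> norm y" by (intro tendsto_norm y)
    then have ny: "norm y = 1" using x(2) by (simp add: LIMSEQ_const_iff)
    have "(\<lambda>k. T (T (x (r k))) - s\<^sup>2 *\<^sub>R x (r k)) \<longlonglongrightarrow> T (T y) - s\<^sup>2 *\<^sub>R y"
      by (intro tendsto_intros T.tendsto y)
    from LIMSEQ_unique[OF this Dr] have TT: "T (T y) = s\<^sup>2 *\<^sub>R y" by simp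
    define z where "z = T y + s *\<^sub>R y"
    have "T z = s *\<^sub>R z"
      unfolding z_def T.add T.scaleR TT by (simp add: algebra_simps power2_eq_square)
    moreover have "z \<in> W"
      unfolding z_def using W yW by (intro subspace_add subspace_scale) auto
    ultimately have z: "T z = s *\<^sub>R z" "z \<in> W" by simp_all
    show ?thesis
    proof (cases "z = 0")
      case True
      then have "T y = (- s) *\<^sub>R y" by (simp add: z_def eq_neg_iff_add_eq_0)
      moreover have "y \<noteq> 0" using ny by auto
      ultimately show ?thesis using yW by (intro bexI[of _ y] conjI exI[of _ "- s"])
    next
      case False
      with z show ?thesis by (intro bexI[of _ z] conjI exI[of _ s])
    qed
  qed
qed

lemma complete_orthonormal_expansion:
  fixes e :: "nat \<Rightarrow> 'a :: {real_inner, banach}"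
  assumes on: "\<And>i j. inner (e i) (e j) = (if i = j then 1 else 0)"
    and V: "subspace V" "closed V" "\<And>k. e k \<in> V"
    and total: "\<And>x. x \<in> V \<Longrightarrow> (\<And>k. inner x (e k) = 0) \<Longrightarrow> x = 0"
    and x: "x \<in> V"
  shows "(\<lambda>k. inner x (e k) * inner (e k) z) sums inner x z"
proof -
  define c where "c k = inner x (e k)" for k
  have pyth: "(norm (\<Sum>k\<in>A. c k *\<^sub>R e k))\<^sup>2 = (\<Sum>k\<in>A. (c k)\<^sup>2)" if "finite A" for A
  proof -
    have "(norm (\<Sum>k\<in>A. c k *\<^sub>R e k))\<^sup>2 = (\<Sum>k\<in>A. (norm (c k *\<^sub>R e k))\<^sup>2)"
      by (rule norm_sum_Pythagorean[OF that]) (auto simp: pairwise_def orthogonal_def on)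
    also have "\<dots> = (\<Sum>k\<in>A. (c k)\<^sup>2)"
      by (simp add: norm_eq_sqrt_inner on)
    finally show ?thesis .
  qed
  have "(\<Sum>k<n. (c k)\<^sup>2) \<le> (norm x)\<^sup>2" for n
  proof -
    let ?p = "\<Sum>k<n. c k *\<^sub>R e k"
    have 1: "inner x ?p = (\<Sum>k<n. (c k)\<^sup>2)"
      by (simp add: inner_sum_right c_def power2_eq_square)
    have "(norm (x - ?p))\<^sup>2 = (norm x)\<^sup>2 - 2 * inner x ?p + (norm ?p)\<^sup>2"
      unfolding power2_norm_eq_inner by (simp add: inner_diff_left inner_diff_right inner_commute)
    also have "\<dots> = (norm x)\<^sup>2 - (\<Sum>k<n. (c k)\<^sup>2)" unfolding 1 by (simp add: pyth)
    finally show ?thesis using zero_le_power2[of "norm (x - ?p)"] by linarith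
  qed
  then have "summable (\<lambda>k. (c k)\<^sup>2)"
    by (intro bounded_imp_summable[where B = "(norm x)\<^sup>2"]) (simp_all only: lessThan_Suc_atMost[symmetric] zero_le_power2)
  then have C: "\<And>d. 0 < d \<Longrightarrow> \<exists>N. \<forall>m\<ge>N. \<forall>n. norm (\<Sum>k=m..<n. (c k)\<^sup>2) < d"
    unfolding summable_Cauchy by blast
  have "summable (\<lambda>k. c k *\<^sub>R e k)"
    unfolding summable_Cauchy
  proof (intro allI impI)
    fix d :: real assume "0 < d"
    then obtain N where N: "\<forall>m\<ge>N. \<forall>n. norm (\<Sum>k=m..<n. (c k)\<^sup>2) < d\<^sup>2"
      using C[of "d\<^sup>2"] by auto
    have "norm (\<Sum>k=m..<n. c k *\<^sub>R e k) < d" if "m \<ge> N" for m n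
    proof (rule power2_less_imp_less)
      show "(norm (\<Sum>k=m..<n. c k *\<^sub>R e k))\<^sup>2 < d\<^sup>2"
        using N that by (subst pyth) (auto simp: sum_nonneg)
    qed (use \<open>0 < d\<close> in simp)
    then show "\<exists>N. \<forall>m\<ge>N. \<forall>n. norm (\<Sum>k=m..<n. c k *\<^sub>R e k) < d" by blast
  qed
  then obtain y where y: "(\<lambda>k. c k *\<^sub>R e k) sums y" by (auto simp: summable_def)
  have inner_y: "(\<lambda>k. c k * inner (e k) u) sums inner y u" for u
    using bounded_linear.sums[OF bounded_linear_inner_left y, of u] by simp
  have "y \<in> V"
  proof (rule closed_sequentially[OF V(2)])
    show "(\<lambda>n. \<Sum>k<n. c k *\<^sub>R e k) \<longlonglongrightarrow> y" using y by (simp add: sums_def)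
    show "(\<Sum>k<n. c k *\<^sub>R e k) \<in> V" for n
      by (intro subspace_sum subspace_scale V)
  qed
  have "x - y = 0"
  proof (rule total)
    show "x - y \<in> V" using V(1) x \<open>y \<in> V\<close> by (rule subspace_diff)
    fix j
    have "(\<lambda>k. c k * inner (e k) (e j)) sums (\<Sum>k\<in>{j}. c k * inner (e k) (e j))"
      by (rule sums_finite) (auto simp: on)
    then have "inner y (e j) = c j" using inner_y[of "e j"] sums_unique2 by (force simp: on)
    then show "inner (x - y) (e j) = 0" by (simp add: inner_diff_left c_def)
  qed
  then show ?thesis using inner_y[of z] by (simp add: c_def)
qed

text \<open>The formal eigenvector of the Jacobi matrix at \<open>t\<close> with first entry \<open>1\<close>.\<close>

fun orthonormal_poly :: "(nat \<Rightarrow> real) \<Rightarrow> (nat \<Rightarrow> real) \<Rightarrow> nat \<Rightarrow> real \<Rightarrow> real" where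
  "orthonormal_poly a b 0 t = 1"
| "orthonormal_poly a b (Suc 0) t = (t - b 0) / a 1"
| "orthonormal_poly a b (Suc (Suc n)) t =
     ((t - b (Suc n)) * orthonormal_poly a b (Suc n) t - a (Suc n) * orthonormal_poly a b n t)
       / a (Suc (Suc n))"

text \<open>A real subspace rather than a complex one: on it a real Jacobi operator has one-dimensional real
  eigenspaces, and the real inner product suffices.\<close>

definition real_ell2 :: "ell2 set" where
  "real_ell2 = {x. \<forall>n. Im (coord x n) = 0}"

lemma subspace_real_ell2: "subspace real_ell2"
  by (auto simp: real_ell2_def subspace_def)

lemma closed_real_ell2: "closed real_ell2"
proof -
  have "closed ((\<lambda>x. Im (coord x n)) -` {0})" for n
    by (intro closed_vimage continuous_intros bounded_linear.continuous_on[OF bounded_linear_coord])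
  then have "closed (\<Inter>n. (\<lambda>x. Im (coord x n)) -` {0})" by blast
  also have "(\<Inter>n. (\<lambda>x. Im (coord x n)) -` {0}) = real_ell2" by (auto simp: real_ell2_def)
  finally show ?thesis .
qed

lemma unit_in_real_ell2: "unit_ell2 n \<in> real_ell2"
  by (simp add: real_ell2_def)

locale real_jacobi =
  fixes a b :: "nat \<Rightarrow> real"
  assumes abs_summable_a: "summable (\<lambda>n. \<bar>a n\<bar>)" and abs_summable_b: "summable (\<lambda>n. \<bar>b n\<bar>)"
    and a_nonzero: "\<And>n. a (Suc n) \<noteq> 0"
begin

sublocale summable_jacobi "\<lambda>n. complex_of_real (a n)" "\<lambda>n. complex_of_real (b n)"
  by unfold_locales (simp_all add: abs_summable_a abs_summable_b)

abbreviation J :: "ell2 \<Rightarrow> ell2" where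
  "J \<equiv> jac (\<lambda>n. complex_of_real (a n)) (\<lambda>n. complex_of_real (b n))"

lemma inner_J: "inner (J x) y = inner x (J y)"
  unfolding inner_ell2_def cinner_jac by simp

lemma J_real_ell2: "J ` real_ell2 \<subseteq> real_ell2"
  by (auto simp: real_ell2_def coord_jac)

lemma eigenvector_coord:
  assumes "J x = scaleC_ell2 (complex_of_real t) x"
  shows "coord x n = coord x 0 * complex_of_real (orthonormal_poly a b n t)"
proof -
  have row: "complex_of_real t * coord x n = (if n = 0 then 0 else a n * coord x (n - 1))
      + b n * coord x n + a (Suc n) * coord x (Suc n)" for n
    using arg_cong[OF assms, of "\<lambda>x. coord x n"] by (simp add: coord_jac)
  show ?thesis
  proof (induction n rule: induct_nat_012)
    case 1
    show ?case using row[of 0] a_nonzero[of 0] by (simp add: field_simps)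
  next
    case (ge2 n)
    have "a (Suc (Suc n)) * coord x (Suc (Suc n))
        = (t - b (Suc n)) * coord x (Suc n) - a (Suc n) * coord x n"
      using row[of "Suc n"] by (simp add: algebra_simps)
    then show ?case
      using a_nonzero[of "Suc n"] unfolding ge2 by (simp add: field_simps)
  qed simp
qed

definition eigenvalues :: "real set" where
  "eigenvalues = {t. \<exists>x. x \<noteq> 0 \<and> J x = scaleC_ell2 (complex_of_real t) x}"

definition eigenvector :: "real \<Rightarrow> ell2" where
  "eigenvector t = Abs_ell2 (\<lambda>n. complex_of_real (orthonormal_poly a b n t))"

definition weight :: "real \<Rightarrow> real" where
  "weight t = 1 / norm (eigenvector t)"

definition unit_eigenvector :: "real \<Rightarrow> ell2" where
  "unit_eigenvector t = weight t *\<^sub>R eigenvector t"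

lemma
  assumes t: "t \<in> eigenvalues"
  shows coord_eigenvector: "coord (eigenvector t) n = complex_of_real (orthonormal_poly a b n t)"
    and J_eigenvector: "J (eigenvector t) = scaleC_ell2 (complex_of_real t) (eigenvector t)"
    and eigenvector_nonzero: "eigenvector t \<noteq> 0"
proof -
  obtain x where x: "x \<noteq> 0" "J x = scaleC_ell2 (complex_of_real t) x"
    using t by (auto simp: eigenvalues_def)
  note c = eigenvector_coord[OF x(2)]
  have x0: "coord x 0 \<noteq> 0"
  proof
    assume "coord x 0 = 0"
    then have "coord x n = coord 0 n" for n using c[of n] by simp
    then have "x = 0" by (rule ell2_eqI)
    with x show False by simp
  qed
  have cn: "complex_of_real (orthonormal_poly a b n t) = coord (scaleC_ell2 (inverse (coord x 0)) x) n" for n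
    using x0 unfolding coord_scaleC c[of n] by simp
  have eq: "eigenvector t = scaleC_ell2 (inverse (coord x 0)) x"
    unfolding eigenvector_def cn by (rule coord_inverse)
  show "coord (eigenvector t) n = complex_of_real (orthonormal_poly a b n t)"
    unfolding eq cn ..
  show "J (eigenvector t) = scaleC_ell2 (complex_of_real t) (eigenvector t)"
    unfolding eq jac_scaleC x(2) by (simp add: scaleC_scaleC mult.commute)
  have "coord (eigenvector t) 0 = 1" using x0 by (simp add: eq)
  then show "eigenvector t \<noteq> 0" by auto
qed

lemma
  assumes t: "t \<in> eigenvalues"
  shows weight_pos: "0 < weight t"
    and coord_unit_eigenvector:
      "coord (unit_eigenvector t) n = complex_of_real (weight t * orthonormal_poly a b n t)"
    and unit_eigenvector_real: "unit_eigenvector t \<in> real_ell2"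
    and J_unit_eigenvector: "J (unit_eigenvector t) = t *\<^sub>R unit_eigenvector t"
    and inner_unit_eigenvector:
      "t' \<in> eigenvalues \<Longrightarrow> inner (unit_eigenvector t) (unit_eigenvector t') = (if t = t' then 1 else 0)"
proof -
  interpret J: bounded_linear J by (rule bounded_linear_jac)
  have Ju: "J (unit_eigenvector t) = t *\<^sub>R unit_eigenvector t" if "t \<in> eigenvalues" for t
    using J_eigenvector[OF that]
    by (simp add: unit_eigenvector_def J.scaleR scaleR_eq_scaleC[symmetric] mult.commute)
  show "0 < weight t" using eigenvector_nonzero[OF t] by (simp add: weight_def)
  show "coord (unit_eigenvector t) n = complex_of_real (weight t * orthonormal_poly a b n t)" for n
    by (simp add: unit_eigenvector_def coord_eigenvector[OF t] scaleR_conv_of_real)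
  then show "unit_eigenvector t \<in> real_ell2" by (simp add: real_ell2_def)
  show "J (unit_eigenvector t) = t *\<^sub>R unit_eigenvector t" by (rule Ju[OF t])
  assume t': "t' \<in> eigenvalues"
  have n1: "norm (unit_eigenvector t) = 1"
    using eigenvector_nonzero[OF t] by (simp add: unit_eigenvector_def weight_def)
  show "inner (unit_eigenvector t) (unit_eigenvector t') = (if t = t' then 1 else 0)"
  proof (cases "t = t'")
    case True
    then show ?thesis using n1 by (simp add: power2_norm_eq_inner[symmetric])
  next
    case False
    have "t * inner (unit_eigenvector t) (unit_eigenvector t')
        = t' * inner (unit_eigenvector t) (unit_eigenvector t')"
      using inner_J[of "unit_eigenvector t" "unit_eigenvector t'"]
      by (simp add: Ju[OF t] Ju[OF t'])
    then show ?thesis using False by simp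
  qed
qed

lemma inner_unit_unit_eigenvector:
  assumes "t \<in> eigenvalues"
  shows "inner (unit_ell2 n) (unit_eigenvector t) = weight t * orthonormal_poly a b n t"
  unfolding inner_commute[of "unit_ell2 n"]
  by (simp add: inner_ell2_def cinner_unit coord_unit_eigenvector[OF assms] del: of_real_mult)

text \<open>The vectors orthogonal to all eigenvectors form a closed invariant subspace. A nonzero one would
  contain a further eigenvector, which is a multiple of a listed one and hence orthogonal to itself.\<close>

lemma eigenvectors_total:
  assumes x: "x \<in> real_ell2" and orth: "\<And>t. t \<in> eigenvalues \<Longrightarrow> inner x (unit_eigenvector t) = 0"
  shows "x = 0"
proof (rule ccontr)
  assume x0: "x \<noteq> 0"
  let ?W = "{x \<in> real_ell2. \<forall>t\<in>eigenvalues. inner x (unit_eigenvector t) = 0}"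
  have W: "subspace ?W"
    using subspace_real_ell2 by (auto simp: subspace_def inner_add_left)
  have "?W = real_ell2 \<inter> (\<Inter>t\<in>eigenvalues. (\<lambda>x. inner x (unit_eigenvector t)) -` {0})" by auto
  also have "closed \<dots>"
    by (intro closed_Int closed_real_ell2 closed_INT ballI closed_vimage closed_singleton)
      (auto intro!: continuous_intros)
  finally have clW: "closed ?W" .
  have JW: "J ` ?W \<subseteq> ?W"
    using J_real_ell2 by (auto simp: inner_J J_unit_eigenvector)
  have cpt: "\<exists>r l. strict_mono (r :: nat \<Rightarrow> nat) \<and> (\<lambda>k. J (x (r k))) \<longlonglongrightarrow> l"
    if "\<And>k. norm (x k) \<le> 1" for x :: "nat \<Rightarrow> ell2"
    by (rule jac_convergent_subsequence[OF that]) (intro exI conjI)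
  have xW: "x \<in> ?W" using x orth by simp
  have "\<exists>y\<in>?W. y \<noteq> 0 \<and> (\<exists>s. J y = s *\<^sub>R y)"
    by (rule compact_symmetric_eigenvector[OF bounded_linear_jac inner_J W clW JW xW x0]) (rule cpt)
  then obtain y s where y: "y \<in> ?W" "y \<noteq> 0" "J y = s *\<^sub>R y" by (elim bexE conjE exE)
  have Jy: "J y = scaleC_ell2 (complex_of_real s) y" using y(3) by (simp add: scaleR_eq_scaleC)
  then have s: "s \<in> eigenvalues" using y(2) unfolding eigenvalues_def by (intro CollectI exI conjI)
  have "y = (Re (coord y 0) / weight s) *\<^sub>R unit_eigenvector s"
  proof (rule ell2_eqI)
    fix n
    have "coord y 0 = complex_of_real (Re (coord y 0))"
      using y(1) by (simp add: real_ell2_def complex_eq_iff)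
    then show "coord y n = coord ((Re (coord y 0) / weight s) *\<^sub>R unit_eigenvector s) n"
      using eigenvector_coord[OF Jy, of n] weight_pos[OF s]
      by (simp add: coord_unit_eigenvector[OF s] scaleR_conv_of_real)
  qed
  then obtain r where r: "y = r *\<^sub>R unit_eigenvector s" by blast
  have "inner y (unit_eigenvector s) = 0" using y(1) s by blast
  then have "r = 0" using inner_unit_eigenvector[OF s s] unfolding r by simp
  then show False using r y(2) by simp
qed

text \<open>With finitely many eigenvalues, each of them simple, all unit vectors would lie in a
  finite-dimensional space.\<close>

lemma infinite_eigenvalues: "infinite eigenvalues"
proof
  assume fin: "finite eigenvalues"
  have "unit_ell2 n \<in> span (unit_eigenvector ` eigenvalues)" for n
  proof -
    let ?p = "\<Sum>t\<in>eigenvalues. inner (unit_ell2 n) (unit_eigenvector t) *\<^sub>R unit_eigenvector t"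
    have "unit_ell2 n - ?p = 0"
    proof (rule eigenvectors_total)
      show "unit_ell2 n - ?p \<in> real_ell2"
        by (intro subspace_diff subspace_sum subspace_scale subspace_real_ell2 unit_in_real_ell2
            unit_eigenvector_real)
      fix s assume s: "s \<in> eigenvalues"
      have "inner ?p (unit_eigenvector s)
          = (\<Sum>t\<in>eigenvalues. if t = s then inner (unit_ell2 n) (unit_eigenvector t) else 0)"
        unfolding inner_sum_left by (intro sum.cong) (auto simp: inner_unit_eigenvector s)
      then show "inner (unit_ell2 n - ?p) (unit_eigenvector s) = 0"
        using fin s by (simp add: inner_diff_left)
    qed
    moreover have "?p \<in> span (unit_eigenvector ` eigenvalues)"
      by (intro span_sum span_scale span_base) auto
    ultimately show ?thesis by simp
  qed
  then have sub: "range unit_ell2 \<subseteq> span (unit_eigenvector ` eigenvalues)" by blast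
  have inner_unit: "inner (unit_ell2 i) (unit_ell2 j) = (if i = j then 1 else 0)" for i j
    by (simp add: inner_ell2_def cinner_unit)
  have inj: "inj unit_ell2"
  proof
    fix i j assume "unit_ell2 i = unit_ell2 j"
    then show "i = j" using inner_unit[of i j] inner_unit[of j j] by (auto split: if_splits)
  qed
  have "independent (range unit_ell2)"
  proof (rule pairwise_orthogonal_independent)
    show "pairwise orthogonal (range unit_ell2)"
      by (auto simp: pairwise_def orthogonal_def inner_unit)
    show "0 \<notin> range unit_ell2"
      using norm_unit by (metis imageE norm_zero zero_neq_one)
  qed
  then have "finite (range unit_ell2)"
    using independent_span_bound[OF _ _ sub] fin by simp
  then show False using finite_imageD[OF _ inj] by simp
qed

lemma eigenvalue_in_spectrum: "t \<in> eigenvalues \<Longrightarrow> complex_of_real t \<in> op_spectrum J"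
  by (auto simp: eigenvalues_def spectrum_iff)

lemma countable_eigenvalues: "countable eigenvalues"
proof -
  have "countable (complex_of_real ` eigenvalues)"
    by (rule countable_subset[OF _ countable_spectrum]) (auto simp: eigenvalue_in_spectrum)
  then show ?thesis by (rule countable_image_inj_on) (simp add: inj_on_def)
qed

lemma eigenvalue_bound: "t \<in> eigenvalues \<Longrightarrow>
    \<bar>t\<bar> \<le> suminf (jac_bound (\<lambda>n. complex_of_real (a n)) (\<lambda>n. complex_of_real (b n)))"
  using sum_cmod_spectrum_le[of "{complex_of_real t}"] eigenvalue_in_spectrum by simp

lemma finite_eigenvalues_outside: 
  assumes "0 < e" shows "finite {t \<in> eigenvalues. e \<le> \<bar>t\<bar>}"
proof (rule finite_imageD)
  show "finite (complex_of_real ` {t \<in> eigenvalues. e \<le> \<bar>t\<bar>})"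
    by (rule finite_subset[OF _ finite_spectrum_outside[OF assms]]) (auto simp: eigenvalue_in_spectrum)
qed (simp add: inj_on_def)

lemma spectral_expansion:
  obtains lam :: "nat \<Rightarrow> real" where "bij_betw lam UNIV eigenvalues"
    and "\<And>x z. x \<in> real_ell2 \<Longrightarrow> (\<lambda>k. inner x (unit_eigenvector (lam k))
        * inner (unit_eigenvector (lam k)) z) sums inner x z"
proof
  let ?lam = "from_nat_into eigenvalues"
  show bij: "bij_betw ?lam UNIV eigenvalues"
    by (rule bij_betw_from_nat_into[OF countable_eigenvalues infinite_eigenvalues])
  then have mem: "?lam k \<in> eigenvalues" for k by (auto simp: bij_betw_def)
  have inj: "?lam i = ?lam j \<longleftrightarrow> i = j" for i j
    using bij by (auto simp: bij_betw_def inj_def)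
  fix x z assume x: "x \<in> real_ell2"
  show "(\<lambda>k. inner x (unit_eigenvector (?lam k)) * inner (unit_eigenvector (?lam k)) z) sums inner x z"
  proof (rule complete_orthonormal_expansion[OF _ subspace_real_ell2 closed_real_ell2 _ _ x])
    show "inner (unit_eigenvector (?lam i)) (unit_eigenvector (?lam j)) = (if i = j then 1 else 0)" for i j
      by (simp add: inner_unit_eigenvector mem inj)
    show "unit_eigenvector (?lam k) \<in> real_ell2" for k by (rule unit_eigenvector_real[OF mem])
    fix y assume y: "y \<in> real_ell2" "\<And>k. inner y (unit_eigenvector (?lam k)) = 0"
    show "y = 0"
    proof (rule eigenvectors_total[OF y(1)])
      fix t assume "t \<in> eigenvalues"
      then obtain k where "t = ?lam k" using bij by (auto simp: bij_betw_def)
      then show "inner y (unit_eigenvector t) = 0" using y(2) by simp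
    qed
  qed
qed

end

section \<open>The spectrum is infinite\<close>

context real_jacobi
begin

lemma summable_weight_sq:
  assumes "\<And>k. lam k \<in> eigenvalues"
    and "(\<lambda>k. inner (unit_ell2 0) (unit_eigenvector (lam k))
        * inner (unit_eigenvector (lam k)) (unit_ell2 0)) sums inner (unit_ell2 0) (unit_ell2 0)"
  shows "summable (\<lambda>k. (weight (lam k))\<^sup>2)"
proof -
  have "inner (unit_ell2 0) (unit_eigenvector (lam k)) * inner (unit_eigenvector (lam k)) (unit_ell2 0)
      = (weight (lam k))\<^sup>2" for k
    using inner_unit_unit_eigenvector[OF assms(1), of 0 k]
    by (simp add: inner_commute[of _ "unit_ell2 0"] power2_eq_square)
  then show ?thesis using assms(2) by (simp add: sums_iff)
qed

lemma resolvent_vector: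
  assumes t: "t \<notin> eigenvalues" "t \<noteq> 0"
  obtains u where "u \<in> real_ell2" "J u = t *\<^sub>R u + unit_ell2 0"
proof -
  interpret J: bounded_linear J by (rule bounded_linear_jac)
  have no: "x = 0" if "J x = scaleC_ell2 (complex_of_real t) x" for x
    using t(1) that unfolding eigenvalues_def by (metis (mono_tags, lifting) mem_Collect_eq)
  have "complex_of_real t \<notin> op_spectrum J"
    by (rule not_in_spectrum_if_not_eigenvalue[OF _ no]) (use t in auto)
  then obtain S where "\<And>x. J (S x) - scaleC_ell2 (complex_of_real t) (S x) = x"
    unfolding op_spectrum_def by (simp only: mem_Collect_eq not_not) (elim exE conjE, metis)
  then have u: "J (S (unit_ell2 0)) - scaleC_ell2 (complex_of_real t) (S (unit_ell2 0)) = unit_ell2 0"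
    by simp
  define u where "u = S (unit_ell2 0)"
  have Ju: "J u = t *\<^sub>R u + unit_ell2 0"
    using u unfolding u_def scaleR_eq_scaleC by (simp add: algebra_simps)
  have "J (cnj_ell2 u) = cnj_ell2 (J u)" using jac_cnj[of u] by simp
  also have "\<dots> = t *\<^sub>R cnj_ell2 u + unit_ell2 0"
    unfolding Ju by (rule ell2_eqI) (simp add: scaleR_conv_of_real)
  finally have "J (u - cnj_ell2 u) = t *\<^sub>R (u - cnj_ell2 u)"
    by (simp add: J.diff Ju scaleR_diff_right)
  then have "u - cnj_ell2 u = 0" by (intro no) (simp add: scaleR_eq_scaleC)
  then have "u = cnj_ell2 u" by simp
  then have "coord u n = cnj (coord u n)" for n by (subst (asm) coord_inject[symmetric]) (metis coord_cnj)
  then have "Im (coord u n) = - Im (coord u n)" for n by (metis complex_cnj complex.sel(2) complex_surj)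
  then have "Im (coord u n) = 0" for n by (metis neg_equal_zero)
  then have "u \<in> real_ell2" by (simp add: real_ell2_def)
  then show ?thesis using Ju by (rule that)
qed

text \<open>The partial fraction expansion of \<open>m(t) = \<langle>(J - t)\<^sup>-\<^sup>1 e\<^sub>0, e\<^sub>0\<rangle>\<close> over the eigenvalues.\<close>

lemma resolvent_entry:
  assumes lam: "\<And>k. lam k \<in> eigenvalues"
    and expansion: "\<And>x z. x \<in> real_ell2 \<Longrightarrow> (\<lambda>k. inner x (unit_eigenvector (lam k))
        * inner (unit_eigenvector (lam k)) z) sums inner x z"
    and u: "u \<in> real_ell2" "J u = t *\<^sub>R u + unit_ell2 0" and t: "t \<notin> eigenvalues"
  shows "(\<lambda>k. (weight (lam k))\<^sup>2 / (lam k - t)) sums Re (coord u 0)"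
proof -
  have "inner u (unit_eigenvector (lam k)) * inner (unit_eigenvector (lam k)) (unit_ell2 0)
      = (weight (lam k))\<^sup>2 / (lam k - t)" for k
  proof -
    have e: "inner (unit_ell2 0) (unit_eigenvector (lam k)) = weight (lam k)"
      using inner_unit_unit_eigenvector[OF lam, of 0 k] by simp
    have "lam k * inner u (unit_eigenvector (lam k)) = inner (J u) (unit_eigenvector (lam k))"
      by (simp add: inner_J J_unit_eigenvector[OF lam])
    also have "\<dots> = t * inner u (unit_eigenvector (lam k)) + weight (lam k)"
      by (simp add: u(2) inner_add_left e)
    finally have "(lam k - t) * inner u (unit_eigenvector (lam k)) = weight (lam k)"
      by (simp add: algebra_simps)
    moreover have "lam k \<noteq> t" using lam t by metis
    ultimately have "inner u (unit_eigenvector (lam k)) = weight (lam k) / (lam k - t)"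
      by (simp add: field_simps)
    then show ?thesis using e by (simp add: inner_commute power2_eq_square)
  qed
  then have "(\<lambda>k. (weight (lam k))\<^sup>2 / (lam k - t)) sums inner u (unit_ell2 0)"
    using expansion[OF u(1), of "unit_ell2 0"] by simp
  also have "inner u (unit_ell2 0) = Re (coord u 0)" by (simp add: inner_ell2_def cinner_unit)
  finally show ?thesis .
qed

lemma eigenvalue_isolated:
  assumes "p \<noteq> 0"
  shows "\<exists>d>0. \<forall>s\<in>eigenvalues. s \<noteq> p \<longrightarrow> d \<le> \<bar>s - p\<bar>"
proof -
  have "finite {s \<in> eigenvalues. \<bar>p\<bar> / 2 \<le> \<bar>s\<bar>}"
    using assms by (intro finite_eigenvalues_outside) simp
  from finite_set_avoid[OF this, of p] obtain d where d: "d > 0"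
    "\<And>s. s \<in> eigenvalues \<Longrightarrow> \<bar>p\<bar> / 2 \<le> \<bar>s\<bar> \<Longrightarrow> s \<noteq> p \<Longrightarrow> d \<le> \<bar>s - p\<bar>"
    by (auto simp: dist_real_def abs_minus_commute)
  have "min d (\<bar>p\<bar> / 2) \<le> \<bar>s - p\<bar>" if s: "s \<in> eigenvalues" "s \<noteq> p" for s
  proof (cases "\<bar>p\<bar> / 2 \<le> \<bar>s\<bar>")
    case True
    then show ?thesis using d(2)[OF s(1) True s(2)] by linarith
  qed linarith
  then show ?thesis using d(1) assms by (intro exI[of _ "min d (\<bar>p\<bar> / 2)"]) auto
qed

text \<open>Multiplying \<open>A + B m\<close> by \<open>(t - p) (t - q)\<close> removes its two poles in the interval. The product \<open>g\<close> is
  continuous on the closed interval and has opposite signs at the ends, since the residues of \<open>m\<close> all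
  have one sign and \<open>B\<close> has equal signs at \<open>p\<close> and \<open>q\<close>.\<close>

lemma m_function_crossing:
  fixes A B :: "real \<Rightarrow> real"
  assumes pq: "p < q" "p \<in> eigenvalues" "q \<in> eigenvalues" "0 \<notin> {p..q}"
    and gap: "{p<..<q} \<inter> eigenvalues = {}"
    and cont: "continuous_on {p..q} A" "continuous_on {p..q} B"
    and sign: "0 < B p * B q"
  obtains t u where "p < t" "t < q" "u \<in> real_ell2" "J u = t *\<^sub>R u + unit_ell2 0"
    "A t + B t * Re (coord u 0) = 0"
proof -
  obtain lam where bij: "bij_betw lam UNIV eigenvalues"
    and expansion: "\<And>x z. x \<in> real_ell2 \<Longrightarrow> (\<lambda>k. inner x (unit_eigenvector (lam k))
        * inner (unit_eigenvector (lam k)) z) sums inner x z"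
    using spectral_expansion by metis
  have lam: "lam k \<in> eigenvalues" for k using bij by (auto simp: bij_betw_def)
  have inj: "lam i = lam j \<longleftrightarrow> i = j" for i j using bij by (auto simp: bij_betw_def inj_def)
  obtain i j where ij: "lam i = p" "lam j = q" using bij pq(2,3) by (metis bij_betw_iff_bijections)
  have "i \<noteq> j" using ij pq(1) by auto
  define c where "c k = (weight (lam k))\<^sup>2" for k
  have c: "0 < c k" for k using weight_pos[OF lam[of k]] by (simp add: c_def)
  have sum_c: "summable c"
    unfolding c_def using lam expansion[OF unit_in_real_ell2] by (rule summable_weight_sq)
  \<comment> \<open>The series without the two terms that are singular in \<open>[p, q]\<close> converges uniformly there.\<close>
  define r where "r k t = (if k = i \<or> k = j then 0 else c k / (lam k - t))" for k t
  define R where "R t = (\<Sum>k. r k t)" for t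
  obtain d1 where d1: "d1 > 0" "\<And>s. s \<in> eigenvalues \<Longrightarrow> s \<noteq> p \<Longrightarrow> d1 \<le> \<bar>s - p\<bar>"
    using eigenvalue_isolated[of p] pq by auto
  obtain d2 where d2: "d2 > 0" "\<And>s. s \<in> eigenvalues \<Longrightarrow> s \<noteq> q \<Longrightarrow> d2 \<le> \<bar>s - q\<bar>"
    using eigenvalue_isolated[of q] pq by auto
  define d where "d = min d1 d2"
  have d: "0 < d" using d1(1) d2(1) by (simp add: d_def)
  have far: "d \<le> \<bar>lam k - t\<bar>" if "k \<noteq> i" "k \<noteq> j" "t \<in> {p..q}" for k t
  proof -
    have ne: "lam k \<noteq> p" "lam k \<noteq> q" using that ij inj by metis+
    then have "lam k < p \<or> q < lam k" using gap lam[of k] by force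
    then show ?thesis
      using d1(2)[OF lam ne(1)] d2(2)[OF lam ne(2)] that(3) by (auto simp: d_def)
  qed
  have rbound: "norm (r k t) \<le> c k / d" if "t \<in> {p..q}" for k t
    using far[of k t] that d c[of k] by (auto simp: r_def abs_mult intro!: divide_left_mono mult_pos_pos)
  have sum_cd: "summable (\<lambda>k. c k / d)" using sum_c by (rule summable_divide)
  have unif: "uniform_limit {p..q} (\<lambda>n t. \<Sum>k<n. r k t) R sequentially"
    unfolding R_def by (rule Weierstrass_m_test[OF rbound sum_cd])
  have "continuous_on {p..q} (r k)" for k
  proof (cases "k = i \<or> k = j")
    case False
    then have "\<forall>t\<in>{p..q}. lam k - t \<noteq> 0" using far[of k] d by force
    then have "continuous_on {p..q} (\<lambda>t. c k / (lam k - t))" by (intro continuous_intros)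
    then show ?thesis using False by (simp add: r_def[abs_def])
  qed (auto simp: r_def[abs_def])
  then have contR: "continuous_on {p..q} R"
    by (intro uniform_limit_theorem[OF _ unif]) (auto intro!: always_eventually continuous_intros)
  define g where "g t = (t - p) * (t - q) * (A t + B t * R t)
    - B t * (c i * (t - q) + c j * (t - p))" for t
  have contg: "continuous_on {p..q} g"
    unfolding g_def by (intro continuous_intros contR cont)
  have gp: "g p = B p * c i * (q - p)" and gq: "g q = - (B q * c j * (q - p))"
    by (simp_all add: g_def algebra_simps)
  have "g p * g q = - (B p * B q * (c i * c j * ((q - p) * (q - p))))"
    by (simp add: gp gq)
  also have "\<dots> < 0" using sign c pq(1) by simp
  finally have neg: "g p * g q < 0" .
  have "\<exists>t\<ge>p. t \<le> q \<and> g t * g q = 0"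
  proof (rule IVT')
    show "g p * g q \<le> 0" using neg by simp
    show "continuous_on {p..q} (\<lambda>t. g t * g q)" by (intro continuous_intros contg)
  qed (use pq in auto)
  then obtain t where t: "p \<le> t" "t \<le> q" "g t = 0" using neg by auto
  then have "t \<noteq> p" "t \<noteq> q" using neg by auto
  with t have t: "p < t" "t < q" "g t = 0" by auto
  then have t_eig: "t \<notin> eigenvalues" using gap by auto
  have "t \<noteq> 0" using pq(4) t by auto
  then obtain u where u: "u \<in> real_ell2" "J u = t *\<^sub>R u + unit_ell2 0"
    using resolvent_vector[OF t_eig] by blast
  have full: "(\<lambda>k. c k / (lam k - t)) sums Re (coord u 0)"
    unfolding c_def using lam expansion u t_eig by (rule resolvent_entry)
  have "summable (\<lambda>k. r k t)"
    by (rule summable_comparison_test'[OF sum_cd]) (use rbound t in simp)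
  then have Rt: "(\<lambda>k. r k t) sums R t" unfolding R_def by (rule summable_sums)
  have "(\<lambda>k. c k / (lam k - t) - r k t) sums (\<Sum>k\<in>{i, j}. c k / (lam k - t) - r k t)"
    by (rule sums_finite) (auto simp: r_def)
  then have "Re (coord u 0) - R t = (\<Sum>k\<in>{i, j}. c k / (lam k - t) - r k t)"
    by (rule sums_unique2[OF sums_diff[OF full Rt]])
  also have "\<dots> = c i / (p - t) + c j / (q - t)" using \<open>i \<noteq> j\<close> ij by (simp add: r_def)
  finally have m: "Re (coord u 0) = R t + c i / (p - t) + c j / (q - t)" by simp
  have e: "(t - p) * (t - q) * (c i / (p - t)) = - (c i * (t - q))"
    "(t - p) * (t - q) * (c j / (q - t)) = - (c j * (t - p))"
    using t(1,2) by (simp_all add: divide_simps) (simp_all add: algebra_simps)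
  have "(t - p) * (t - q) * (A t + B t * Re (coord u 0))
      = (t - p) * (t - q) * (A t + B t * R t)
        + B t * ((t - p) * (t - q) * (c i / (p - t)) + (t - p) * (t - q) * (c j / (q - t)))"
    unfolding m by (simp only: distrib_left distrib_right mult.assoc mult.left_commute[of _ "B t"] add.assoc)
  also have "\<dots> = g t" unfolding e g_def by (simp add: algebra_simps)
  finally have "(t - p) * (t - q) * (A t + B t * Re (coord u 0)) = g t" .
  then have "A t + B t * Re (coord u 0) = 0" using t by simp
  with t(1,2) u show ?thesis by (rule that)
qed

text \<open>Both points are taken on the same side of \<open>0\<close>, the only place where eigenvalues accumulate, so that
  between them there are finitely many eigenvalues and a nearest one exists.\<close>

lemma adjacent_eigenvalues:
  assumes "0 < e"
  obtains p q where "p < q" "p \<in> eigenvalues" "q \<in> eigenvalues" "0 \<notin> {p..q}"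
    "\<bar>p\<bar> < e" "\<bar>q\<bar> < e" "{p<..<q} \<inter> eigenvalues = {}"
proof -
  let ?S = "{t \<in> eigenvalues. \<bar>t\<bar> < e \<and> t \<noteq> 0}"
  have "eigenvalues \<subseteq> {t \<in> eigenvalues. e \<le> \<bar>t\<bar>} \<union> insert 0 ({t \<in> ?S. 0 < t} \<union> {t \<in> ?S. t < 0})"
    by auto
  then have "infinite {t \<in> ?S. 0 < t} \<or> infinite {t \<in> ?S. t < 0}"
    using infinite_eigenvalues finite_eigenvalues_outside[OF assms]
      finite_subset by (metis (no_types, lifting) finite_UnI finite_insert)
  then obtain U where U: "infinite U" "U \<subseteq> ?S" "(\<forall>t\<in>U. 0 < t) \<or> (\<forall>t\<in>U. t < 0)"
  proof
    assume "infinite {t \<in> ?S. 0 < t}"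
    then show ?thesis by (rule that) auto
  next
    assume "infinite {t \<in> ?S. t < 0}"
    then show ?thesis by (rule that) auto
  qed
  obtain x' where x': "x' \<in> U" using U(1) by (metis finite.emptyI ex_in_conv)
  have "infinite (U - {x'})" using U(1) by simp
  then obtain y' where y': "y' \<in> U" "y' \<noteq> x'" by (metis finite.emptyI ex_in_conv DiffE insertI1)
  define x where "x = min x' y'"
  define y where "y = max x' y'"
  have xy: "x \<in> U" "y \<in> U" "x < y" using x' y' by (auto simp: x_def y_def min_def max_def)
  let ?T = "{t \<in> eigenvalues. x < t \<and> t \<le> y}"
  have "?T \<subseteq> {t \<in> eigenvalues. min \<bar>x\<bar> \<bar>y\<bar> \<le> \<bar>t\<bar>}" using U(3) xy by auto
  moreover have "0 < min \<bar>x\<bar> \<bar>y\<bar>" using xy U(2) by auto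
  ultimately have finT: "finite ?T" using finite_eigenvalues_outside finite_subset by blast
  have yT: "y \<in> ?T" using xy U(2) by auto
  define q where "q = Min ?T"
  have qT: "q \<in> ?T" unfolding q_def using finT yT by (intro Min_in) auto
  have min: "q \<le> t" if "t \<in> ?T" for t unfolding q_def using finT that by (rule Min_le)
  have xe: "x \<in> eigenvalues" "\<bar>x\<bar> < e" and ye: "\<bar>y\<bar> < e" using xy U(2) by auto
  show ?thesis
  proof (rule that[of x q])
    show "0 \<notin> {x..q}" using U(3) xy qT by auto
    show "\<bar>q\<bar> < e" using qT xe ye by auto
    show "{x<..<q} \<inter> eigenvalues = {}"
    proof (rule ccontr)
      assume "{x<..<q} \<inter> eigenvalues \<noteq> {}"
      then obtain s where s: "x < s" "s < q" "s \<in> eigenvalues" by auto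
      then have "s \<in> ?T" using qT by auto
      from min[OF this] show False using s by simp
    qed
  qed (use qT xe in auto)
qed

end

text \<open>The squares \<open>a\<^sub>n\<^sup>2\<close> are real throughout and positive from index \<open>N + 1\<close> on, so the coefficients of the
  monic polynomials \<open>P\<close> are real although finitely many \<open>a\<^sub>n\<close> may be imaginary.\<close>

locale eventually_real_jacobi =
  fixes a :: "nat \<Rightarrow> complex" and b :: "nat \<Rightarrow> real" and P :: "nat \<Rightarrow> real poly" and N :: nat
  assumes cmod_summable_a: "summable (\<lambda>n. cmod (a n))" and abs_summable_b: "summable (\<lambda>n. \<bar>b n\<bar>)"
    and a_nonzero: "\<And>n. a (Suc n) \<noteq> 0" and a_sq_real: "\<And>n. Im ((a n)\<^sup>2) = 0"
    and P_0: "P 0 = 1" and P_nonzero: "\<And>n. P n \<noteq> 0"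
    and P_rec: "\<And>n. pCons 0 (P n) = P (Suc n) + smult (b n) (P n)
      + smult (Re ((a n)\<^sup>2)) (if n = 0 then 0 else P (n - 1))"
    and a_tail: "\<And>n. N < n \<Longrightarrow> Im (a n) = 0" 
begin

sublocale summable_jacobi a "\<lambda>n. complex_of_real (b n)"
  by unfold_locales (simp_all add: cmod_summable_a abs_summable_b)

sublocale tail: real_jacobi "\<lambda>n. Re (a (n + Suc N))" "\<lambda>n. b (n + Suc N)"
proof
  show "summable (\<lambda>n. \<bar>Re (a (n + Suc N))\<bar>)"
    by (rule summable_comparison_test'[OF summable_ignore_initial_segment[OF cmod_summable_a, of "Suc N"]])
      (simp add: abs_Re_le_cmod)
  show "summable (\<lambda>n. \<bar>b (n + Suc N)\<bar>)"
    by (rule summable_ignore_initial_segment[OF abs_summable_b])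
  show "Re (a (Suc n + Suc N)) \<noteq> 0" for n
    using a_nonzero[of "n + Suc N"] a_tail[of "Suc n + Suc N"] by (auto simp: complex_eq_iff)
qed

definition formal_solution :: "real \<Rightarrow> nat \<Rightarrow> complex" where
  "formal_solution t n = complex_of_real (poly (P n) t) / (\<Prod>i<n. a (Suc i))"

lemma prod_a_nonzero: "(\<Prod>i<n. a (Suc i)) \<noteq> 0"
  using a_nonzero by simp

lemma formal_solution_row:
  "(if n = 0 then 0 else a n * formal_solution t (n - 1)) + b n * formal_solution t n
     + a (Suc n) * formal_solution t (Suc n) = t * formal_solution t n"
proof -
  have "t * poly (P n) t = poly (P (Suc n)) t + b n * poly (P n) t
      + Re ((a n)\<^sup>2) * (if n = 0 then 0 else poly (P (n - 1)) t)"
    using arg_cong[OF P_rec[of n], of "\<lambda>p. poly p t"] by (simp split: if_splits)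
  from arg_cong[OF this, of complex_of_real]
  have rec: "t * complex_of_real (poly (P n) t) = poly (P (Suc n)) t + b n * complex_of_real (poly (P n) t)
      + (a n)\<^sup>2 * (if n = 0 then 0 else poly (P (n - 1)) t)"
    using a_sq_real[of n] by (simp add: complex_eq_iff split: if_splits)
  have "a (Suc n) * formal_solution t (Suc n) = poly (P (Suc n)) t / (\<Prod>i<n. a (Suc i))"
    using a_nonzero[of n] by (simp add: formal_solution_def)
  moreover have "(if n = 0 then 0 else a n * formal_solution t (n - 1))
      = (a n)\<^sup>2 * (if n = 0 then 0 else poly (P (n - 1)) t) / (\<Prod>i<n. a (Suc i))"
  proof (cases n)
    case (Suc m)
    then show ?thesis using a_nonzero[of m] by (simp add: formal_solution_def power2_eq_square)
  qed simp
  moreover have "poly (P (Suc n)) t / (\<Prod>i<n. a (Suc i)) + b n * formal_solution t n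
      + (a n)\<^sup>2 * (if n = 0 then 0 else poly (P (n - 1)) t) / (\<Prod>i<n. a (Suc i)) = t * formal_solution t n"
    unfolding formal_solution_def using prod_a_nonzero[of n] rec
    by (simp add: add_divide_distrib[symmetric])
  ultimately show ?thesis by (simp add: add_ac)
qed

text \<open>The formal solution on the first \<open>N + 1\<close> entries is continued by a multiple of the decaying solution
  \<open>u\<close> of the tail. The equation \<open>glue\<close> makes the two pieces agree in entry \<open>N + 1\<close>, so that every row
  of the eigenvalue equation holds.\<close>

lemma glued_eigenvalue:
  assumes u: "tail.J u = t *\<^sub>R u + unit_ell2 0" "u \<in> real_ell2"
    and glue: "poly (P (Suc N)) t + Re ((a (Suc N))\<^sup>2) * poly (P N) t * Re (coord u 0) = 0"
  shows "complex_of_real t \<in> op_spectrum (jac a (\<lambda>n. complex_of_real (b n)))"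
proof -
  \<comment> \<open>With this factor row \<open>N + 1\<close> holds: the source \<open>e\<^sub>0\<close> in the equation for \<open>u\<close> cancels the
    coupling to entry \<open>N\<close>.\<close>
  define \<kappa> where "\<kappa> = - a (Suc N) * formal_solution t N"
  define f where "f n = (if n \<le> N then formal_solution t n else \<kappa> * coord u (n - Suc N))" for n
  have sq: "summable (\<lambda>n. (cmod (f n))\<^sup>2)"
    by (subst summable_iff_shift[of _ "Suc N", symmetric])
      (simp add: f_def summable_sq_mult[OF summable_coord])
  have tail_a: "complex_of_real (Re (a n)) = a n" if "N < n" for n
    using a_tail[OF that] by (simp add: complex_eq_iff)
  have urow: "(if k = 0 then 0 else a (k + Suc N) * coord u (k - 1)) + b (k + Suc N) * coord u k
     + a (Suc k + Suc N) * coord u (Suc k) = t * coord u k + (if k = 0 then 1 else 0)" for k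
  proof -
    have "coord (tail.J u) k = t * coord u k + (if k = 0 then 1 else 0)"
      unfolding u(1) by (simp add: scaleR_conv_of_real)
    then show ?thesis unfolding tail.coord_jac by (cases k) (simp_all add: tail_a)
  qed
  have glue': "f (Suc N) = formal_solution t (Suc N)"
  proof -
    have u0: "coord u 0 = complex_of_real (Re (coord u 0))"
      using u(2) by (simp add: real_ell2_def complex_eq_iff)
    have a2: "a (Suc N) * a (Suc N) = complex_of_real (Re ((a (Suc N))\<^sup>2))"
      using a_sq_real[of "Suc N"] by (simp add: complex_eq_iff power2_eq_square)
    have "a (Suc N) * f (Suc N)
        = - (a (Suc N) * a (Suc N)) * formal_solution t N * complex_of_real (Re (coord u 0))"
      unfolding u0[symmetric] by (simp add: f_def \<kappa>_def mult_ac)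
    also have "\<dots> = complex_of_real (- (Re ((a (Suc N))\<^sup>2) * poly (P N) t * Re (coord u 0))) / (\<Prod>i<N. a (Suc i))"
      unfolding a2 by (simp add: formal_solution_def)
    also have "- (Re ((a (Suc N))\<^sup>2) * poly (P N) t * Re (coord u 0)) = poly (P (Suc N)) t"
      using glue by linarith
    also have "complex_of_real (poly (P (Suc N)) t) / (\<Prod>i<N. a (Suc i)) = a (Suc N) * formal_solution t (Suc N)"
      using a_nonzero[of N] by (simp add: formal_solution_def)
    finally show ?thesis using a_nonzero[of N] by simp
  qed
  have row: "(if n = 0 then 0 else a n * f (n - 1)) + b n * f n + a (Suc n) * f (Suc n) = t * f n" for n
  proof (cases "n \<le> N")
    case True
    have "f m = formal_solution t m" if "m \<le> Suc N" for m
      using glue' that by (cases "m = Suc N") (auto simp: f_def)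
    then show ?thesis using formal_solution_row[of n t] True by (cases n) simp_all
  next
    case False
    then obtain k where k: "n = k + Suc N" by (metis add.commute le_add_diff_inverse not_less_eq_eq)
    have f_k: "f (k + Suc N) = \<kappa> * coord u k" "f (Suc (k + Suc N)) = \<kappa> * coord u (Suc k)"
      by (simp_all add: f_def)
    have prev: "a n * f (n - 1) = \<kappa> * (if k = 0 then 0 else a (k + Suc N) * coord u (k - 1))
        - (if k = 0 then \<kappa> else 0)"
      by (cases k) (simp_all add: k f_def \<kappa>_def)
    have "a n * f (n - 1) + b n * f n + a (Suc n) * f (Suc n)
        = \<kappa> * ((if k = 0 then 0 else a (k + Suc N) * coord u (k - 1)) + b (k + Suc N) * coord u k
          + a (Suc k + Suc N) * coord u (Suc k)) - (if k = 0 then \<kappa> else 0)"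
      unfolding prev unfolding k f_k by (simp add: algebra_simps)
    also have "\<dots> = t * f n" unfolding urow k f_k by (simp add: algebra_simps)
    finally show ?thesis using k by simp
  qed
  define x where "x = Abs_ell2 f"
  have cx: "coord x n = f n" for n unfolding x_def by (simp add: coord_Abs[OF sq])
  have "jac a (\<lambda>n. complex_of_real (b n)) x = scaleC_ell2 (complex_of_real t) x"
    by (rule ell2_eqI) (simp only: coord_jac cx coord_scaleC row)
  moreover have "coord x 0 = 1" by (simp add: cx f_def formal_solution_def P_0)
  then have "x \<noteq> 0" by auto
  ultimately show ?thesis unfolding spectrum_iff by (intro disjI2 exI conjI)
qed

lemma small_eigenvalue:
  assumes e: "0 < e"
  shows "\<exists>z\<in>op_spectrum (jac a (\<lambda>n. complex_of_real (b n))). z \<noteq> 0 \<and> cmod z < e"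
proof -
  have "finite {t. poly (P N) t = 0}" by (rule poly_roots_finite[OF P_nonzero])
  from finite_set_avoid[OF this, of 0]
  obtain d where d: "d > 0" "\<And>t. poly (P N) t = 0 \<Longrightarrow> t \<noteq> 0 \<Longrightarrow> d \<le> \<bar>t\<bar>"
    by (auto simp: dist_real_def)
  obtain p q where pq: "p < q" "p \<in> tail.eigenvalues" "q \<in> tail.eigenvalues" "0 \<notin> {p..q}"
    "\<bar>p\<bar> < min e d" "\<bar>q\<bar> < min e d" "{p<..<q} \<inter> tail.eigenvalues = {}"
    using tail.adjacent_eigenvalues[of "min e d"] e d(1) by auto
  have noroot: "poly (P N) t \<noteq> 0" if "t \<in> {p..q}" for t
    using d(2)[of t] pq that by auto
  let ?B = "\<lambda>t. Re ((a (Suc N))\<^sup>2) * poly (P N) t"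
  have "(a (Suc N))\<^sup>2 \<noteq> 0" using a_nonzero[of N] by simp
  then have ane: "Re ((a (Suc N))\<^sup>2) \<noteq> 0"
    using complex_eqI[of "(a (Suc N))\<^sup>2" 0] a_sq_real[of "Suc N"] by auto
  have PP: "0 < poly (P N) p * poly (P N) q"
  proof (rule ccontr)
    assume "\<not> ?thesis"
    then have "poly (P N) p * poly (P N) q < 0"
      using noroot[of p] noroot[of q] pq(1) by (simp add: not_less le_less)
    from poly_IVT[OF pq(1) this] show False using noroot by force
  qed
  have "?B p * ?B q = (Re ((a (Suc N))\<^sup>2))\<^sup>2 * (poly (P N) p * poly (P N) q)"
    by (simp only: power2_eq_square[of "Re ((a (Suc N))\<^sup>2)"] mult_ac)
  moreover have "0 < (Re ((a (Suc N))\<^sup>2))\<^sup>2 * (poly (P N) p * poly (P N) q)"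
    by (rule mult_pos_pos[OF _ PP]) (use ane in simp)
  ultimately have sign: "0 < ?B p * ?B q" by (simp only:)
  have cont: "continuous_on {p..q} (poly (P (Suc N)))" "continuous_on {p..q} ?B"
    by (intro continuous_intros)+
  obtain t u where t: "p < t" "t < q" "u \<in> real_ell2" "tail.J u = t *\<^sub>R u + unit_ell2 0"
    "poly (P (Suc N)) t + ?B t * Re (coord u 0) = 0"
    by (rule tail.m_function_crossing[OF pq(1-4,7) cont sign])
  have "complex_of_real t \<in> op_spectrum (jac a (\<lambda>n. complex_of_real (b n)))"
    by (rule glued_eigenvalue[OF t(4,3,5)])
  moreover have "t \<noteq> 0" "\<bar>t\<bar> < e" using t pq by auto
  ultimately show ?thesis by (intro bexI[of _ "complex_of_real t"]) auto
qed

lemma infinite_spectrum: "infinite (op_spectrum (jac a (\<lambda>n. complex_of_real (b n))))"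
proof
  assume "finite (op_spectrum (jac a (\<lambda>n. complex_of_real (b n))))"
  from finite_set_avoid[OF this, of 0] obtain d where d: "d > 0"
    "\<And>z. z \<in> op_spectrum (jac a (\<lambda>n. complex_of_real (b n))) \<Longrightarrow> z \<noteq> 0 \<Longrightarrow> d \<le> cmod z"
    by (auto simp: dist_norm)
  then show False using small_eigenvalue[OF d(1)] by force
qed

end

section \<open>Square roots of positive operators and the trace class\<close>

text \<open>For \<open>B = 1 - A\<close> the limit \<open>L\<close> solves \<open>L = (B + L\<^sup>2) / 2\<close>, that is \<open>(1 - L)\<^sup>2 = A\<close>.\<close>

fun sqrt_iterate :: "('a::real_vector \<Rightarrow> 'a) \<Rightarrow> nat \<Rightarrow> 'a \<Rightarrow> 'a" where
  "sqrt_iterate B 0 x = 0"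
| "sqrt_iterate B (Suc n) x = (1/2) *\<^sub>R (B x + sqrt_iterate B n (sqrt_iterate B n x))"

text \<open>The same iteration for the number \<open>1\<close> in place of \<open>B\<close>; it dominates the operator iteration for
  every contraction \<open>B\<close>.\<close>

fun scalar_iterate :: "nat \<Rightarrow> real" where
  "scalar_iterate 0 = 0"
| "scalar_iterate (Suc n) = (1 + (scalar_iterate n)\<^sup>2) / 2"

lemma scalar_iterate_bounds: "0 \<le> scalar_iterate n" "scalar_iterate n \<le> 1"
  by (induction n) (auto simp: power_le_one)

lemma scalar_iterate_mono: "scalar_iterate n \<le> scalar_iterate (Suc n)"
  using zero_le_power2[of "scalar_iterate n - 1"] by (simp add: power2_diff)

lemma convergent_scalar_iterate: "convergent scalar_iterate"
proof (rule Bseq_mono_convergent)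
  show "Bseq scalar_iterate"
    by (rule BseqI'[of _ 1]) (use scalar_iterate_bounds in simp)
  show "\<forall>m. \<forall>n\<ge>m. scalar_iterate m \<le> scalar_iterate n"
    using lift_Suc_mono_le[of scalar_iterate, OF scalar_iterate_mono] by blast
qed

lemma sqrt_iterate_commute:
  assumes C: "linear C" and CB: "\<And>x. C (B x) = B (C x)"
  shows "C (sqrt_iterate B n x) = sqrt_iterate B n (C x)"
proof (induction n arbitrary: x)
  case 0
  show ?case by (simp add: linear_0[OF C])
next
  case (Suc n)
  then show ?case by (simp add: linear_add[OF C] linear_scale[OF C] CB)
qed

lemma bounded_linear_sqrt_iterate:
  assumes B: "bounded_linear B" shows "bounded_linear (sqrt_iterate B n)"
proof (induction n)
  case 0
  have "sqrt_iterate B 0 = (\<lambda>x. 0)" by (rule ext) simp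
  then show ?case by (simp only: bounded_linear_zero)
next
  case (Suc n)
  have "sqrt_iterate B (Suc n) = (\<lambda>x. (1/2) *\<^sub>R (B x + sqrt_iterate B n (sqrt_iterate B n x)))"
    by (rule ext) simp
  moreover have "bounded_linear (\<lambda>x. (1/2) *\<^sub>R (B x + sqrt_iterate B n (sqrt_iterate B n x)))"
    by (intro bounded_linear_const_scaleR bounded_linear_add B bounded_linear_compose[OF Suc Suc])
  ultimately show ?case by (simp only:)
qed

lemma norm_sqrt_iterate:
  assumes B: "\<And>x. norm (B x) \<le> norm x"
  shows "norm (sqrt_iterate B n x) \<le> scalar_iterate n * norm x"
proof (induction n arbitrary: x)
  case (Suc n)
  have "norm (sqrt_iterate B n (sqrt_iterate B n x)) \<le> scalar_iterate n * (scalar_iterate n * norm x)"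
    using Suc[of "sqrt_iterate B n x"] mult_left_mono[OF Suc[of x] scalar_iterate_bounds(1)[of n]]
    by (rule order_trans)
  then have "norm (B x + sqrt_iterate B n (sqrt_iterate B n x))
      \<le> norm x + scalar_iterate n * (scalar_iterate n * norm x)"
    by (rule norm_triangle_le[OF add_mono[OF B]])
  then show ?case
    unfolding sqrt_iterate.simps(2) norm_scaleR scalar_iterate.simps(2)
    by (simp add: power2_eq_square distrib_right)
qed simp

text \<open>All iterates commute, so \<open>Y\<^sub>n\<^sub>+\<^sub>1\<^sup>2 - Y\<^sub>n\<^sup>2\<close> factors as \<open>(Y\<^sub>n\<^sub>+\<^sub>1 + Y\<^sub>n) (Y\<^sub>n\<^sub>+\<^sub>1 - Y\<^sub>n)\<close> and the scalar
  increments bound the operator increments.\<close>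

lemma norm_sqrt_iterate_diff:
  fixes B :: "'a::real_normed_vector \<Rightarrow> 'a"
  assumes lin: "bounded_linear B" and B: "\<And>x. norm (B x) \<le> norm x"
  shows "norm (sqrt_iterate B (Suc n) x - sqrt_iterate B n x)
    \<le> (scalar_iterate (Suc n) - scalar_iterate n) * norm x"
proof (induction n arbitrary: x)
  case 0
  show ?case using B[of x] by simp
next
  case (Suc n)
  let ?Y = "sqrt_iterate B" and ?y = "scalar_iterate"
  have lY: "linear (?Y m)" for m
    using bounded_linear_sqrt_iterate[OF lin] by (rule bounded_linear.linear)
  have "B (?Y m x) = ?Y m (B x)" for m x
    by (rule sqrt_iterate_commute[OF bounded_linear.linear[OF lin]]) simp
  then have "?Y m (B x) = B (?Y m x)" for m x by simp
  then have comm: "?Y m (?Y k x) = ?Y k (?Y m x)" for m k x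
    by (rule sqrt_iterate_commute[OF lY])
  define d where "d = ?Y (Suc n) x - ?Y n x"
  have "?Y (Suc n) (?Y (Suc n) x) - ?Y n (?Y n x) = ?Y (Suc n) d + ?Y n d"
    unfolding d_def linear_diff[OF lY] comm[of n "Suc n"] by (simp del: sqrt_iterate.simps)
  then have "?Y (Suc (Suc n)) x - ?Y (Suc n) x = (1/2) *\<^sub>R (?Y (Suc n) d + ?Y n d)"
    unfolding sqrt_iterate.simps(2)[of B "Suc n"] sqrt_iterate.simps(2)[of B n x]
    by (simp add: scaleR_diff_right[symmetric] del: sqrt_iterate.simps)
  then have "norm (?Y (Suc (Suc n)) x - ?Y (Suc n) x) \<le> (1/2) * (?y (Suc n) * norm d + ?y n * norm d)"
    by (simp add: norm_triangle_le[OF add_mono[OF norm_sqrt_iterate[OF B] norm_sqrt_iterate[OF B]]]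
        del: sqrt_iterate.simps scalar_iterate.simps)
  also have "\<dots> = (1/2) * (?y (Suc n) + ?y n) * norm d" by (simp add: algebra_simps)
  also have "\<dots> \<le> (1/2) * (?y (Suc n) + ?y n) * ((?y (Suc n) - ?y n) * norm x)"
    using Suc[of x] scalar_iterate_bounds(1)[of n] scalar_iterate_bounds(1)[of "Suc n"]
    unfolding d_def by (intro mult_left_mono) auto
  also have "\<dots> = (1/2) * ((?y (Suc n))\<^sup>2 - (?y n)\<^sup>2) * norm x"
    by (simp add: power2_eq_square algebra_simps del: scalar_iterate.simps)
  also have "\<dots> = (?y (Suc (Suc n)) - ?y (Suc n)) * norm x"
  proof -
    have e: "(?y n)\<^sup>2 = 2 * ?y (Suc n) - 1" by (simp add: field_simps)
    show ?thesis
      unfolding scalar_iterate.simps(2)[of "Suc n"] e by (simp add: algebra_simps del: scalar_iterate.simps)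
  qed
  finally show ?case .
qed

text \<open>After scaling, \<open>0 \<le> E \<le> 1\<close> makes \<open>B = 1 - E\<close> a contraction and the iteration converges. Commutation with
  every operator commuting with \<open>A\<close> is what later yields complex linearity of a root built over the reals.\<close>

lemma positive_square_root:
  fixes A :: "'a :: {real_inner, banach} \<Rightarrow> 'a"
  assumes A: "bounded_linear A" and sym: "\<And>x y. inner (A x) y = inner x (A y)"
    and pos: "\<And>x. 0 \<le> inner (A x) x"
  obtains R where "bounded_linear R" "\<And>x y. inner (R x) y = inner x (R y)"
    "\<And>x. 0 \<le> inner (R x) x" "\<And>x. R (R x) = A x"
    "\<And>C x. bounded_linear C \<Longrightarrow> (\<And>x. C (A x) = A (C x)) \<Longrightarrow> C (R x) = R (C x)"
proof -
  interpret A: bounded_linear A by (rule A)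
  obtain K where K: "K > 0" "\<And>x. norm (A x) \<le> norm x * K" using A.pos_bounded by blast
  define E where "E x = (1 / K) *\<^sub>R A x" for x
  have E: "bounded_linear E" unfolding E_def by (intro bounded_linear_const_scaleR A)
  interpret E: bounded_linear E by (rule E)
  have Esym: "inner (E x) y = inner x (E y)" for x y by (simp add: E_def sym)
  have Epos: "0 \<le> inner (E x) x" for x using pos K by (simp add: E_def)
  have Enorm: "norm (E x) \<le> norm x" for x using K by (simp add: E_def field_simps)
  \<comment> \<open>Positivity of \<open>E\<close> at \<open>x - E x\<close> gives \<open>E\<^sup>2 \<le> E\<close>.\<close>
  have Ele: "(norm (E x))\<^sup>2 \<le> inner (E x) x" for x
  proof -
    have "0 \<le> inner (E (x - E x)) (x - E x)" by (rule Epos)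
    also have "\<dots> = inner (E x) x - 2 * inner (E x) (E x) + inner (E (E x)) (E x)"
      by (simp add: E.diff inner_diff_left inner_diff_right Esym[of "E x" x] Esym[of x "E x", symmetric])
    also have "inner (E (E x)) (E x) \<le> norm (E x) * norm (E x)"
      by (rule order_trans[OF norm_cauchy_schwarz]) (intro mult_right_mono Enorm norm_ge_zero)
    finally show ?thesis by (simp add: power2_norm_eq_inner[symmetric] power2_eq_square[symmetric])
  qed
  define B where "B x = x - E x" for x
  have B: "bounded_linear B" unfolding B_def by (intro bounded_linear_sub bounded_linear_ident E)
  have Bnorm: "norm (B x) \<le> norm x" for x
  proof (rule power2_le_imp_le)
    have "(norm (B x))\<^sup>2 = (norm x)\<^sup>2 - 2 * inner (E x) x + (norm (E x))\<^sup>2"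
      unfolding B_def power2_norm_eq_inner by (simp add: inner_diff_left inner_diff_right inner_commute)
    then show "(norm (B x))\<^sup>2 \<le> (norm x)\<^sup>2" using Ele[of x] Epos[of x] by linarith
  qed simp
  have Bsym: "inner (B x) y = inner x (B y)" for x y
    by (simp add: B_def inner_diff_left inner_diff_right Esym)
  let ?Y = "sqrt_iterate B"
  have Y: "bounded_linear (?Y n)" for n by (rule bounded_linear_sqrt_iterate[OF B])
  have Ynorm: "norm (?Y n x) \<le> norm x" for n x
    using norm_sqrt_iterate[where B = B, OF Bnorm, of n x]
      mult_right_mono[OF scalar_iterate_bounds(2)[of n] norm_ge_zero[of x]] by simp
  have Ysym: "inner (?Y n x) y = inner x (?Y n y)" for n x y
    by (induction n arbitrary: x y) (simp_all add: inner_add_left inner_add_right Bsym)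
  have "convergent (\<lambda>n. ?Y n x)" for x
  proof -
    obtain l where l: "scalar_iterate \<longlonglongrightarrow> l"
      using convergent_scalar_iterate by (auto simp: convergent_def)
    have "summable (\<lambda>n. scalar_iterate (Suc n) - scalar_iterate n)"
      using telescope_sums[OF l] by (rule sums_summable)
    then have "summable (\<lambda>n. (scalar_iterate (Suc n) - scalar_iterate n) * norm x)"
      by (rule summable_mult2)
    then have "summable (\<lambda>n. ?Y (Suc n) x - ?Y n x)"
      by (rule summable_comparison_test') (rule norm_sqrt_iterate_diff[OF B Bnorm])
    then have "convergent (\<lambda>n. \<Sum>k<n. ?Y (Suc k) x - ?Y k x)"
      by (simp only: summable_iff_convergent)
    moreover have "(\<Sum>k<n. ?Y (Suc k) x - ?Y k x) = ?Y n x" for n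
      using sum_lessThan_telescope[of "\<lambda>k. ?Y k x" n] by (simp only: sqrt_iterate.simps(1) diff_zero)
    ultimately show ?thesis by (simp only:)
  qed
  then have "\<exists>l. (\<lambda>n. ?Y n x) \<longlonglongrightarrow> l" for x by (simp add: convergent_def)
  then obtain L where L: "\<And>x. (\<lambda>n. ?Y n x) \<longlonglongrightarrow> L x" by metis
  have Lnorm: "norm (L x) \<le> norm x" for x
    by (rule LIMSEQ_le_const2[OF tendsto_norm[OF L]]) (use Ynorm in auto)
  have BL: "bounded_linear L"
  proof (rule bounded_linear_intro[where K = 1])
    fix x y
    have "(\<lambda>n. ?Y n (x + y)) \<longlonglongrightarrow> L x + L y"
      using tendsto_add[OF L[of x] L[of y]] by (simp only: linear_simps(1)[OF Y])
    then show "L (x + y) = L x + L y" by (rule LIMSEQ_unique[OF L])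
  next
    fix r x
    have "(\<lambda>n. ?Y n (r *\<^sub>R x)) \<longlonglongrightarrow> r *\<^sub>R L x"
      using tendsto_scaleR[OF tendsto_const[of r] L[of x]] by (simp only: linear_simps(5)[OF Y])
    then show "L (r *\<^sub>R x) = r *\<^sub>R L x" by (rule LIMSEQ_unique[OF L])
  next
    show "norm (L x) \<le> norm x * 1" for x using Lnorm by simp
  qed
  interpret L: bounded_linear L by (rule BL)
  have Lsym: "inner (L x) y = inner x (L y)" for x y
  proof (rule LIMSEQ_unique)
    show "(\<lambda>n. inner (?Y n x) y) \<longlonglongrightarrow> inner (L x) y" by (intro tendsto_intros L)
    show "(\<lambda>n. inner (?Y n x) y) \<longlonglongrightarrow> inner x (L y)" unfolding Ysym by (intro tendsto_intros L)
  qed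
  have LL: "L x = (1/2) *\<^sub>R (B x + L (L x))" for x
  proof -
    have "(\<lambda>n. ?Y n (?Y n x - L x)) \<longlonglongrightarrow> 0"
    proof (rule Lim_null_comparison[OF always_eventually])
      show "\<forall>n. norm (?Y n (?Y n x - L x)) \<le> norm (?Y n x - L x)" using Ynorm by blast
      show "(\<lambda>n. norm (?Y n x - L x)) \<longlonglongrightarrow> 0"
        using L[of x] by (simp only: LIM_zero_iff tendsto_norm_zero_iff)
    qed
    from tendsto_add[OF this L[of "L x"]]
    have "(\<lambda>n. ?Y n (?Y n x)) \<longlonglongrightarrow> L (L x)" by (simp add: linear_simps(2)[OF Y])
    then have "(\<lambda>n. ?Y (Suc n) x) \<longlonglongrightarrow> (1/2) *\<^sub>R (B x + L (L x))"
      unfolding sqrt_iterate.simps by (intro tendsto_intros)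
    moreover have "(\<lambda>n. ?Y (Suc n) x) \<longlonglongrightarrow> L x" using L[of x] by (rule LIMSEQ_Suc)
    ultimately show ?thesis using LIMSEQ_unique by blast
  qed
  define R where "R x = sqrt K *\<^sub>R (x - L x)" for x
  show ?thesis
  proof (rule that[of R])
    show "bounded_linear R"
      unfolding R_def by (intro bounded_linear_const_scaleR bounded_linear_sub bounded_linear_ident BL)
    show "inner (R x) y = inner x (R y)" for x y
      by (simp add: R_def inner_diff_left inner_diff_right Lsym)
    show "0 \<le> inner (R x) x" for x
    proof -
      have "inner (L x) x \<le> norm x * norm x"
        by (rule order_trans[OF norm_cauchy_schwarz]) (intro mult_right_mono Lnorm norm_ge_zero)
      then show ?thesis
        using K(1) by (simp add: R_def inner_diff_left power2_norm_eq_inner[symmetric] power2_eq_square)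
    qed
    show "R (R x) = A x" for x
    proof -
      have "R (R x) = K *\<^sub>R (x - L x - L x + L (L x))"
        using K(1) by (simp add: R_def L.scaleR L.diff scaleR_diff_right algebra_simps)
      also have "L (L x) = 2 *\<^sub>R L x - B x"
        using arg_cong[OF LL[of x], of "\<lambda>v. 2 *\<^sub>R v"] by (simp add: algebra_simps)
      also have "x - L x - L x + (2 *\<^sub>R L x - B x) = E x"
        by (simp add: B_def scaleR_2)
      finally show ?thesis using K(1) by (simp add: E_def)
    qed
    fix C :: "'a \<Rightarrow> 'a" and x assume C: "bounded_linear C" and CA: "\<And>x. C (A x) = A (C x)"
    interpret C: bounded_linear C by (rule C)
    have "C (B x) = B (C x)" for x by (simp add: B_def E_def C.diff C.scaleR CA)
    then have "C (?Y n x) = ?Y n (C x)" for n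
      by (rule sqrt_iterate_commute[OF bounded_linear.linear[OF C]])
    then have "(\<lambda>n. ?Y n (C x)) \<longlonglongrightarrow> C (L x)" using C.tendsto[OF L[of x]] by simp
    then have "C (L x) = L (C x)" by (rule LIMSEQ_unique[OF _ L])
    then show "C (R x) = R (C x)" by (simp add: R_def C.scaleR C.diff)
  qed
qed

context summable_jacobi
begin

lemma trace_class_jac: "trace_class (jac a b)"
proof -
  let ?J = "jac a b" and ?J' = "jac (\<lambda>n. cnj (a n)) (\<lambda>n. cnj (b n))"
  interpret c: summable_jacobi "\<lambda>n. cnj (a n)" "\<lambda>n. cnj (b n)" by (rule summable_jacobi_cnj)
  have cA: "cinner (?J' (?J x)) y = cinner (?J x) (?J y)" for x y
    using c.cinner_jac[of "?J x" y] by simp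
  have iA: "inner (?J' (?J x)) y = inner (?J x) (?J y)" for x y
    unfolding inner_ell2_def cA ..
  have A: "bounded_linear (\<lambda>x. ?J' (?J x))"
    by (rule bounded_linear_compose[OF c.bounded_linear_jac bounded_linear_jac])
  obtain R where R: "bounded_linear R" "\<And>x y. inner (R x) y = inner x (R y)"
    "\<And>x. 0 \<le> inner (R x) x" "\<And>x. R (R x) = ?J' (?J x)"
    "\<And>C x. bounded_linear C \<Longrightarrow> (\<And>x. C (?J' (?J x)) = ?J' (?J (C x))) \<Longrightarrow> C (R x) = R (C x)"
  proof (rule positive_square_root[OF A])
    show "inner (?J' (?J x)) y = inner x (?J' (?J y))" for x y
      using iA[of x y] iA[of y x] by (simp add: inner_commute)
    show "0 \<le> inner (?J' (?J x)) x" for x by (simp add: iA)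
  qed blast
  have RC: "R (scaleC_ell2 c x) = scaleC_ell2 c (R x)" for c x
    by (rule R(5)[OF bounded_linear_scaleC, symmetric]) (simp add: jac_scaleC c.jac_scaleC)
  have clin: "bounded_clinear R" using R(1) RC by (simp add: bounded_clinear_def)
  have "is_abs_operator R ?J"
    unfolding is_abs_operator_def
  proof (intro conjI allI clin)
    fix x y
    have "inner (R x) (scaleC_ell2 \<i> x) = - inner (R x) (scaleC_ell2 \<i> x)"
    proof -
      have "inner (R x) (scaleC_ell2 \<i> x) = inner x (scaleC_ell2 \<i> (R x))" by (simp add: R(2) RC)
      also have "\<dots> = - inner (scaleC_ell2 \<i> x) (R x)" by (simp add: inner_scaleC_i)
      finally show ?thesis by (simp add: inner_commute)
    qed
    then have "Im (cinner (R x) x) = 0" by (simp add: Im_cinner)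
    then show "cinner (R x) x \<in> \<real>" by (simp add: complex_is_Real_iff)
    show "0 \<le> Re (cinner (R x) x)" by (simp add: Re_cinner R(3))
    show "cinner (R (R x)) y = cinner (?J x) (?J y)" by (simp add: R(4) cA)
  qed
  moreover have "summable (\<lambda>n. Re (cinner (R (unit_ell2 n)) (unit_ell2 n)))"
  proof (rule summable_comparison_test'[OF summable_jac_bound])
    fix n
    have "inner (R (unit_ell2 n)) (unit_ell2 n) \<le> norm (R (unit_ell2 n))"
      using norm_cauchy_schwarz[of "R (unit_ell2 n)" "unit_ell2 n"] by simp
    also have "norm (R (unit_ell2 n)) = norm (?J (unit_ell2 n))"
    proof -
      have "inner (R (unit_ell2 n)) (R (unit_ell2 n)) = inner (?J (unit_ell2 n)) (?J (unit_ell2 n))"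
        unfolding R(2)[of "unit_ell2 n"] R(4) inner_commute[of "unit_ell2 n"] iA ..
      then show ?thesis by (simp add: norm_eq_sqrt_inner)
    qed
    also have "\<dots> \<le> jac_bound a b n" by (rule norm_jac_unit_le)
    finally show "norm (Re (cinner (R (unit_ell2 n)) (unit_ell2 n))) \<le> jac_bound a b n"
      using R(3)[of "unit_ell2 n"] by (simp add: Re_cinner)
  qed
  ultimately show ?thesis unfolding trace_class_def using bounded_clinear_jac by blast
qed

end

section \<open>Orthogonality measures\<close>

lemma integrable_poly:
  assumes "\<And>k. integrable M (\<lambda>t::real. t ^ k)"
  shows "integrable M (poly p)"
  unfolding poly_altdef by (intro Bochner_Integration.integrable_sum Bochner_Integration.integrable_mult_right assms)

lemma orthogonality_measure_smult:
  assumes k: "\<And>n. k n \<noteq> 0"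
  shows "orthogonality_measure M (\<lambda>n. smult (k n) (p n)) \<longleftrightarrow> orthogonality_measure M p"
proof -
  have "(\<integral>t. poly (smult (k m) (p m)) t * poly (smult (k n) (p n)) t \<partial>M)
      = k m * k n * (\<integral>t. poly (p m) t * poly (p n) t \<partial>M)" for m n
  proof -
    have "(\<integral>t. poly (smult (k m) (p m)) t * poly (smult (k n) (p n)) t \<partial>M)
        = (\<integral>t. k m * k n * (poly (p m) t * poly (p n) t) \<partial>M)"
      by (intro Bochner_Integration.integral_cong) (simp_all add: mult_ac)
    then show ?thesis by simp
  qed
  moreover have "(\<integral>t. (poly (smult (k n) (p n)) t)\<^sup>2 \<partial>M) = (k n)\<^sup>2 * (\<integral>t. (poly (p n) t)\<^sup>2 \<partial>M)" for n
    by (simp add: power_mult_distrib)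
  moreover have "0 < (k n)\<^sup>2" for n using k by simp
  ultimately show ?thesis
    unfolding orthogonality_measure_def using k by (simp add: zero_less_mult_iff)
qed

lemma orthogonality_measure_integrable:
  assumes "orthogonality_measure M p"
  shows "integrable M (poly q)" and "integrable M (\<lambda>t. poly q t * poly r t)"
proof -
  have int: "integrable M (poly q)" for q
    using assms by (intro integrable_poly) (simp add: orthogonality_measure_def)
  show "integrable M (poly q)" by (rule int)
  show "integrable M (\<lambda>t. poly q t * poly r t)"
    using int[of "q * r"] by (simp add: poly_mult[abs_def])
qed

text \<open>Both sides are the integral of \<open>t P\<^sub>n P\<^sub>n\<^sub>+\<^sub>1\<close>, expanded by the recurrence for either factor. In
  particular the coefficients \<open>c\<^sub>n\<^sub>+\<^sub>1\<close> must be positive.\<close>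

lemma orthogonality_norm_ratio:
  assumes M: "orthogonality_measure M P"
    and rec: "\<And>n. pCons 0 (P n) = P (Suc n) + smult (b n) (P n)
      + smult (c n) (if n = 0 then 0 else P (n - 1))"
  shows "(\<integral>t. (poly (P (Suc n)) t)\<^sup>2 \<partial>M) = c (Suc n) * (\<integral>t. (poly (P n) t)\<^sup>2 \<partial>M)"
proof -
  note int = orthogonality_measure_integrable(2)[OF M]
  have orth: "m \<noteq> n \<Longrightarrow> (\<integral>t. poly (P m) t * poly (P n) t \<partial>M) = 0" for m n
    using M by (simp add: orthogonality_measure_def)
  have r: "t * poly (P n) t = poly (P (Suc n)) t + b n * poly (P n) t
      + c n * (if n = 0 then 0 else poly (P (n - 1)) t)" for n t
    using arg_cong[OF rec[of n], of "\<lambda>p. poly p t"] by (simp split: if_splits)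
  have "(\<integral>t. t * poly (P n) t * poly (P (Suc n)) t \<partial>M)
      = (\<integral>t. poly (P (Suc n)) t * poly (P (Suc n)) t + b n * (poly (P n) t * poly (P (Suc n)) t)
         + (if n = 0 then 0 else c n) * (poly (P (n - 1)) t * poly (P (Suc n)) t) \<partial>M)"
    by (intro Bochner_Integration.integral_cong refl) (simp add: r algebra_simps)
  also have "\<dots> = (\<integral>t. (poly (P (Suc n)) t)\<^sup>2 \<partial>M)"
    using orth[of n "Suc n"] orth[of "n - 1" "Suc n"] by (simp add: int power2_eq_square)
  finally have 1: "(\<integral>t. t * poly (P n) t * poly (P (Suc n)) t \<partial>M) = (\<integral>t. (poly (P (Suc n)) t)\<^sup>2 \<partial>M)" .
  have "(\<integral>t. t * poly (P n) t * poly (P (Suc n)) t \<partial>M)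
      = (\<integral>t. poly (P (Suc (Suc n))) t * poly (P n) t + b (Suc n) * (poly (P (Suc n)) t * poly (P n) t)
         + c (Suc n) * (poly (P n) t * poly (P n) t) \<partial>M)"
  proof (intro Bochner_Integration.integral_cong refl)
    fix t
    have "t * poly (P n) t * poly (P (Suc n)) t = (t * poly (P (Suc n)) t) * poly (P n) t" by simp
    also have "\<dots> = (poly (P (Suc (Suc n))) t + b (Suc n) * poly (P (Suc n)) t + c (Suc n) * poly (P n) t)
        * poly (P n) t" unfolding r by simp
    finally show "t * poly (P n) t * poly (P (Suc n)) t
      = poly (P (Suc (Suc n))) t * poly (P n) t + b (Suc n) * (poly (P (Suc n)) t * poly (P n) t)
         + c (Suc n) * (poly (P n) t * poly (P n) t)" by (simp add: algebra_simps)
  qed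
  also have "\<dots> = c (Suc n) * (\<integral>t. (poly (P n) t)\<^sup>2 \<partial>M)"
    using orth[of "Suc (Suc n)" n] orth[of "Suc n" n] by (simp add: int power2_eq_square)
  finally show ?thesis using 1 by simp
qed

lemma orthogonality_integral_sum_sq:
  assumes M: "orthogonality_measure M Q" and A: "finite A"
    and norm: "\<And>n. (\<integral>t. (poly (Q n) t)\<^sup>2 \<partial>M) = h"
  shows "(\<integral>t. (\<Sum>n\<in>A. g n * poly (Q n) t)\<^sup>2 \<partial>M) = h * (\<Sum>n\<in>A. (g n)\<^sup>2)"
proof -
  note int = orthogonality_measure_integrable(2)[OF M]
  have orth: "(\<integral>t. poly (Q m) t * poly (Q n) t \<partial>M) = (if m = n then h else 0)" for m n
    using M norm[of n] by (auto simp: orthogonality_measure_def power2_eq_square)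
  have "(\<integral>t. (\<Sum>n\<in>A. g n * poly (Q n) t)\<^sup>2 \<partial>M)
      = (\<integral>t. (\<Sum>m\<in>A. \<Sum>n\<in>A. (g m * g n) * (poly (Q m) t * poly (Q n) t)) \<partial>M)"
    by (intro Bochner_Integration.integral_cong refl)
      (simp add: power2_eq_square sum_product mult_ac)
  also have "\<dots> = (\<Sum>m\<in>A. \<Sum>n\<in>A. (g m * g n) * (if m = n then h else 0))"
  proof (subst Bochner_Integration.integral_sum)
    fix m
    show "integrable M (\<lambda>t. \<Sum>n\<in>A. (g m * g n) * (poly (Q m) t * poly (Q n) t))"
      by (intro Bochner_Integration.integrable_sum Bochner_Integration.integrable_mult_right int)
  next
    show "(\<Sum>m\<in>A. \<integral>t. (\<Sum>n\<in>A. (g m * g n) * (poly (Q m) t * poly (Q n) t)) \<partial>M)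
        = (\<Sum>m\<in>A. \<Sum>n\<in>A. (g m * g n) * (if m = n then h else 0))"
      by (intro sum.cong refl, subst Bochner_Integration.integral_sum)
        (intro Bochner_Integration.integrable_mult_right int, simp add: orth)
  qed
  also have "\<dots> = (\<Sum>m\<in>A. g m * g m * h)"
  proof (rule sum.cong[OF refl])
    fix m assume "m \<in> A"
    have "(\<Sum>n\<in>A. (g m * g n) * (if m = n then h else 0)) = (\<Sum>n\<in>A. if m = n then g m * g n * h else 0)"
      by (intro sum.cong) auto
    then show "(\<Sum>n\<in>A. (g m * g n) * (if m = n then h else 0)) = g m * g m * h"
      using A \<open>m \<in> A\<close> by simp
  qed
  also have "\<dots> = h * (\<Sum>n\<in>A. (g n)\<^sup>2)"
    by (simp add: sum_distrib_left power2_eq_square mult_ac)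
  finally show ?thesis .
qed

lemma finite_measure_if_orthogonality:
  assumes "orthogonality_measure M p" shows "finite_measure M"
proof -
  have "integrable M (\<lambda>t. t ^ 0)" using assms unfolding orthogonality_measure_def by blast
  then have "integrable M (\<lambda>t. 1 :: real)" by simp
  then show ?thesis by (intro finite_measureI) (simp add: integrable_iff_bounded)
qed

context real_jacobi
begin

lemma orthonormal_poly_rec:
  "t * orthonormal_poly a b (Suc n) t = a (Suc (Suc n)) * orthonormal_poly a b (Suc (Suc n)) t
     + b (Suc n) * orthonormal_poly a b (Suc n) t + a (Suc n) * orthonormal_poly a b n t"
  using a_nonzero[of "Suc n"] by (simp add: field_simps)

text \<open>Truncating the solution \<open>g = (J - s)\<^sup>-\<^sup>1 e\<^sub>0\<close> disturbs only the last two rows, in the manner of the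
  Christoffel-Darboux formula.\<close>

lemma truncated_resolvent:
  assumes row: "\<And>n. (if n = 0 then 0 else a n * g (n - 1)) + b n * g n + a (Suc n) * g (Suc n)
      = s * g n + (if n = 0 then 1 else 0)"
  shows "(t - s) * (\<Sum>k<Suc n. g k * orthonormal_poly a b k t)
    = 1 - a (Suc n) * g (Suc n) * orthonormal_poly a b n t + a (Suc n) * g n * orthonormal_poly a b (Suc n) t"
proof (induction n)
  case 0
  have "a (Suc 0) * g 0 * orthonormal_poly a b (Suc 0) t = g 0 * (t - b 0)"
    using a_nonzero[of 0] by simp
  moreover have "b 0 * g 0 + a (Suc 0) * g (Suc 0) = s * g 0 + 1" using row[of 0] by simp
  ultimately show ?case by (simp add: algebra_simps del: orthonormal_poly.simps(2))
next
  case (Suc n)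
  let ?o = "\<lambda>k. orthonormal_poly a b k t"
  have "(t - s) * (\<Sum>k<Suc (Suc n). g k * ?o k)
      = (t - s) * (\<Sum>k<Suc n. g k * ?o k) + (t * ?o (Suc n)) * g (Suc n) - (s * g (Suc n)) * ?o (Suc n)"
    unfolding sum.lessThan_Suc[of _ "Suc n"] by (simp add: algebra_simps)
  also have "s * g (Suc n) = a (Suc n) * g n + b (Suc n) * g (Suc n) + a (Suc (Suc n)) * g (Suc (Suc n))"
    using row[of "Suc n"] by simp
  finally show ?case
    unfolding Suc orthonormal_poly_rec by (simp add: algebra_simps del: orthonormal_poly.simps)
qed

text \<open>On the interval, \<open>1 \<le> 2 d\<^sup>2 q\<^sup>2 + 2 r\<^sup>2\<close> where \<open>q\<close> is the truncated resolvent polynomial and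
  \<open>r = (t - s) q - 1\<close> its error. The integral of \<open>q\<^sup>2\<close> is at most \<open>h \<parallel>u\<parallel>\<^sup>2\<close> and that of \<open>r\<^sup>2\<close> tends to \<open>0\<close>.\<close>

lemma orthogonality_measure_interval_le:
  assumes M: "orthogonality_measure M Q"
    and Q: "\<And>n t. poly (Q n) t = orthonormal_poly a b n t"
    and norm: "\<And>n. (\<integral>t. (poly (Q n) t)\<^sup>2 \<partial>M) = h"
    and u: "u \<in> real_ell2" "J u = s *\<^sub>R u + unit_ell2 0" and d: "0 < d"
  shows "measure M {s - d<..<s + d} \<le> 2 * h * d\<^sup>2 * (norm u)\<^sup>2"
proof -
  interpret finite_measure M using M by (rule finite_measure_if_orthogonality)
  have sets: "sets M = sets borel" using M by (simp add: orthogonality_measure_def)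
  have h: "0 \<le> h" unfolding norm[of 0, symmetric] by (rule integral_nonneg_AE) simp
  let ?I = "{s - d<..<s + d}"
  define g where "g n = Re (coord u n)" for n
  have gu: "coord u n = complex_of_real (g n)" for n
    using u(1) by (simp add: real_ell2_def g_def complex_eq_iff)
  have row: "(if n = 0 then 0 else a n * g (n - 1)) + b n * g n + a (Suc n) * g (Suc n)
      = s * g n + (if n = 0 then 1 else 0)" for n
    using arg_cong[OF arg_cong[OF u(2), of "\<lambda>x. coord x n"], of Re] unfolding coord_jac
    by (cases n) (simp_all add: g_def)
  have g2: "(\<lambda>n. (g n)\<^sup>2) sums (norm u)\<^sup>2"
    using norm_sq_sums[of u] by (simp add: gu)
  have bound: "measure M ?I \<le> 2 * h * d\<^sup>2 * (norm u)\<^sup>2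
      + 2 * (h * ((a (Suc n))\<^sup>2 * ((g (Suc n))\<^sup>2 + (g n)\<^sup>2)))" for n
  proof -
    define f where "f k = (if k = n then - (a (Suc n) * g (Suc n)) else a (Suc n) * g n)" for k
    define q where "q t = (\<Sum>k<Suc n. g k * poly (Q k) t)" for t
    define r where "r t = (\<Sum>k\<in>{n, Suc n}. f k * poly (Q k) t)" for t
    have qr: "(t - s) * q t = 1 + r t" for t
      unfolding q_def r_def Q by (subst truncated_resolvent[OF row]) (simp add: f_def)
    have "q t = poly (\<Sum>k<Suc n. smult (g k) (Q k)) t" "r t = poly (\<Sum>k\<in>{n, Suc n}. smult (f k) (Q k)) t" for t
      unfolding q_def r_def poly_sum poly_smult by (rule refl)+
    then have iq: "integrable M (\<lambda>t. (q t)\<^sup>2)" and ir: "integrable M (\<lambda>t. (r t)\<^sup>2)"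
      using orthogonality_measure_integrable(2)[OF M] by (simp_all only: power2_eq_square)
    have "measure M ?I = (\<integral>t. indicator ?I t \<partial>M)"
      by (simp add: sets sets_eq_imp_space_eq[OF sets])
    also have "\<dots> \<le> (\<integral>t. 2 * d\<^sup>2 * (q t)\<^sup>2 + 2 * (r t)\<^sup>2 \<partial>M)"
    proof (rule integral_mono)
      show "integrable M (indicator ?I :: real \<Rightarrow> real)"
        by (rule integrable_real_indicator) (auto simp: sets less_top[symmetric])
      show "integrable M (\<lambda>t. 2 * d\<^sup>2 * (q t)\<^sup>2 + 2 * (r t)\<^sup>2)"
        by (intro Bochner_Integration.integrable_add Bochner_Integration.integrable_mult_right iq ir)
      fix t
      show "indicator ?I t \<le> 2 * d\<^sup>2 * (q t)\<^sup>2 + 2 * (r t)\<^sup>2"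
      proof (cases "t \<in> ?I")
        case True
        have "(t - s)\<^sup>2 \<le> d\<^sup>2" using True by (intro abs_le_square_iff[THEN iffD1]) auto
        then have "((t - s) * q t)\<^sup>2 \<le> d\<^sup>2 * (q t)\<^sup>2"
          unfolding power_mult_distrib by (rule mult_right_mono) simp
        then have "(1 + r t)\<^sup>2 \<le> d\<^sup>2 * (q t)\<^sup>2" by (simp only: qr)
        moreover have "1 \<le> 2 * (1 + r t)\<^sup>2 + 2 * (r t)\<^sup>2"
          using zero_le_power2[of "1 + 2 * r t"] by (simp add: power2_eq_square algebra_simps)
        ultimately show ?thesis using True by simp
      qed simp
    qed
    also have "\<dots> = 2 * d\<^sup>2 * (\<integral>t. (q t)\<^sup>2 \<partial>M) + 2 * (\<integral>t. (r t)\<^sup>2 \<partial>M)"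
      by (simp add: iq ir)
    also have "(\<integral>t. (q t)\<^sup>2 \<partial>M) = h * (\<Sum>k<Suc n. (g k)\<^sup>2)"
      unfolding q_def by (rule orthogonality_integral_sum_sq[OF M _ norm]) simp
    also have "(\<integral>t. (r t)\<^sup>2 \<partial>M) = h * (\<Sum>k\<in>{n, Suc n}. (f k)\<^sup>2)"
      unfolding r_def by (rule orthogonality_integral_sum_sq[OF M _ norm]) simp
    also have "(\<Sum>k\<in>{n, Suc n}. (f k)\<^sup>2) = (a (Suc n))\<^sup>2 * ((g (Suc n))\<^sup>2 + (g n)\<^sup>2)"
      by (simp add: f_def power_mult_distrib algebra_simps)
    also have "2 * d\<^sup>2 * (h * (\<Sum>k<Suc n. (g k)\<^sup>2)) \<le> 2 * d\<^sup>2 * (h * (norm u)\<^sup>2)"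
    proof (intro mult_left_mono h)
      show "(\<Sum>k<Suc n. (g k)\<^sup>2) \<le> (norm u)\<^sup>2"
        using g2 sum_le_suminf[of "\<lambda>n. (g n)\<^sup>2" "{..<Suc n}"] by (simp add: sums_iff)
    qed simp
    finally show ?thesis by (simp add: mult_ac)
  qed
  have "a \<longlonglongrightarrow> 0"
    using summable_LIMSEQ_zero[OF abs_summable_a] by (simp only: tendsto_rabs_zero_iff)
  then have a0: "(\<lambda>n. a (Suc n)) \<longlonglongrightarrow> 0" by (rule LIMSEQ_Suc)
  have "(\<lambda>n. (g n)\<^sup>2) \<longlonglongrightarrow> 0" using g2 by (intro summable_LIMSEQ_zero) (simp add: sums_iff)
  note g0 = LIMSEQ_Suc[OF this] this
  have "(\<lambda>n. 2 * h * d\<^sup>2 * (norm u)\<^sup>2 + 2 * (h * ((a (Suc n))\<^sup>2 * ((g (Suc n))\<^sup>2 + (g n)\<^sup>2))))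
      \<longlonglongrightarrow> 2 * h * d\<^sup>2 * (norm u)\<^sup>2 + 2 * (h * (0\<^sup>2 * (0 + 0)))"
    by (intro tendsto_intros a0 g0)
  then show ?thesis using bound by (intro LIMSEQ_le_const) auto
qed

text \<open>Near \<open>s\<close> the resolvent is uniformly bounded, so intervals of radius \<open>d\<close> have mass at most \<open>C d\<^sup>2\<close>. Covering
  a fixed interval by \<open>n\<close> intervals of radius of order \<open>1 / n\<close> bounds its mass by a multiple of \<open>1 / n\<close>.\<close>

lemma resolvent_set_null:
  assumes M: "orthogonality_measure M Q"
    and Q: "\<And>n t. poly (Q n) t = orthonormal_poly a b n t"
    and norm: "\<And>n. (\<integral>t. (poly (Q n) t)\<^sup>2 \<partial>M) = h"
    and s: "complex_of_real s \<notin> op_spectrum J"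
  shows "\<exists>e>0. emeasure M {s - e<..<s + e} = 0"
proof -
  interpret finite_measure M using M by (rule finite_measure_if_orthogonality)
  interpret J: bounded_linear J by (rule bounded_linear_jac)
  have sets: "sets M = sets borel" using M by (simp add: orthogonality_measure_def)
  have h: "0 \<le> h" unfolding norm[of 0, symmetric] by (rule integral_nonneg_AE) simp
  have s0: "s \<noteq> 0" using s zero_in_spectrum by auto
  obtain S where "bounded_clinear S" and SJ: "\<And>x. S (J x - scaleC_ell2 (complex_of_real s) x) = x"
    using s unfolding op_spectrum_def by auto
  then have "bounded_linear S" by (simp add: bounded_clinear_def)
  then obtain K where K: "0 < K" "\<And>x. norm (S x) \<le> norm x * K"
    using bounded_linear.pos_bounded by metis
  define e where "e = min (\<bar>s\<bar> / 2) (1 / (2 * K))"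
  have e: "0 < e" using s0 K(1) by (simp add: e_def)
  have low: "norm x \<le> 2 * K * norm (J x - t *\<^sub>R x)" if t: "\<bar>t - s\<bar> < e" for t x
  proof -
    have "norm x \<le> norm (J x - s *\<^sub>R x) * K" using K(2)[of "J x - s *\<^sub>R x"] SJ[of x]
      by (simp add: scaleR_eq_scaleC)
    also have "J x - s *\<^sub>R x = (J x - t *\<^sub>R x) + (t - s) *\<^sub>R x" by (simp add: algebra_simps)
    also have "norm \<dots> * K \<le> (norm (J x - t *\<^sub>R x) + \<bar>t - s\<bar> * norm x) * K"
      using K(1) norm_triangle_ineq[of "J x - t *\<^sub>R x" "(t - s) *\<^sub>R x"] by (intro mult_right_mono) auto
    also have "\<dots> = K * norm (J x - t *\<^sub>R x) + (\<bar>t - s\<bar> * K) * norm x" by (simp add: algebra_simps)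
    also have "(\<bar>t - s\<bar> * K) * norm x \<le> (1/2) * norm x"
    proof (rule mult_right_mono)
      have "\<bar>t - s\<bar> \<le> 1 / (2 * K)" using t by (simp add: e_def)
      then show "\<bar>t - s\<bar> * K \<le> 1/2" using K(1) by (simp add: field_simps)
    qed simp
    finally show ?thesis by simp
  qed
  define C where "C = 8 * h * K\<^sup>2"
  have small: "measure M {t - d<..<t + d} \<le> C * d\<^sup>2" if t: "\<bar>t - s\<bar> < e" and d: "0 < d" for t d
  proof -
    have "t \<noteq> 0" using t by (auto simp: e_def)
    moreover have "t \<notin> eigenvalues"
    proof
      assume "t \<in> eigenvalues"
      then obtain x where "x \<noteq> 0" "J x = scaleC_ell2 (complex_of_real t) x" by (auto simp: eigenvalues_def)
      then show False using low[OF t, of x] by (simp add: scaleR_eq_scaleC)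
    qed
    ultimately obtain u where u: "u \<in> real_ell2" "J u = t *\<^sub>R u + unit_ell2 0"
      using resolvent_vector by metis
    have "norm u \<le> 2 * K" using low[OF t, of u] by (simp add: u(2))
    then have "(norm u)\<^sup>2 \<le> (2 * K)\<^sup>2" by (intro power_mono) auto
    then have "2 * h * d\<^sup>2 * (norm u)\<^sup>2 \<le> 2 * h * d\<^sup>2 * (2 * K)\<^sup>2"
      using h by (intro mult_left_mono) auto
    with orthogonality_measure_interval_le[OF M Q norm u d] show ?thesis
      by (simp add: C_def power_mult_distrib mult_ac)
  qed
  have bound: "measure M {s - e<..<s + e} \<le> (4 * C * e\<^sup>2) * inverse (real (Suc m))" for m
  proof -
    let ?n = "Suc m"
    define p where "p i = s - e + (2 * real i + 1) * e / ?n" for i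
    \<comment> \<open>Twice the necessary radius, so that the open intervals also cover the division points.\<close>
    let ?U = "\<lambda>i. {p i - 2 * e / ?n<..<p i + 2 * e / ?n}"
    have "{s - e<..<s + e} \<subseteq> (\<Union>i<?n. ?U i)"
    proof
      fix t assume t: "t \<in> {s - e<..<s + e}"
      define y where "y = ((t - s + e) / (2 * e)) * ?n"
      have q: "0 \<le> (t - s + e) / (2 * e)" "(t - s + e) / (2 * e) < 1" using t e by auto
      have y: "0 \<le> y" unfolding y_def using q(1) by (rule mult_nonneg_nonneg) simp
      have "y < 1 * real ?n" unfolding y_def using q(2) by (rule mult_strict_right_mono) simp
      then have y: "0 \<le> y" "y < ?n" using y by simp_all
      define i where "i = nat \<lfloor>y\<rfloor>"
      have i: "real i \<le> y" "y < real i + 1" "i < ?n"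
        using y by (auto simp: i_def) linarith+
      have "2 * e * y / ?n = 2 * e * ((t - s + e) / (2 * e))" unfolding y_def by simp
      then have ty: "t = s - e + 2 * e * y / ?n" using e by simp
      have "t - p i = (e / ?n) * (2 * y - 2 * i - 1)"
      proof -
        have "(s - e + 2 * e * y / L) - (s - e + (2 * i + 1) * e / L) = (e / L) * (2 * y - 2 * i - 1)"
          if "L \<noteq> 0" for L i :: real
          using that by (simp add: field_simps)
        from this[of "real ?n" "real i"] show ?thesis unfolding ty p_def by simp
      qed
      also have "\<bar>\<dots>\<bar> \<le> (e / ?n) * 1" 
        using i e unfolding abs_mult by (intro mult_mono) auto
      also have "\<dots> < 2 * e / ?n" using e divide_strict_right_mono[of e "2 * e" "real ?n"] by simp
      finally have "t \<in> ?U i" by auto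
      then show "t \<in> (\<Union>i<?n. ?U i)" using i(3) by blast
    qed
    then have "measure M {s - e<..<s + e} \<le> measure M (\<Union>i<?n. ?U i)"
      by (rule finite_measure_mono) (auto simp: sets)
    also have "\<dots> \<le> (\<Sum>i<?n. measure M (?U i))"
      by (rule finite_measure_subadditive_finite) (auto simp: sets)
    also have "\<dots> \<le> (\<Sum>i<?n. C * (2 * e / ?n)\<^sup>2)"
    proof (rule sum_mono, rule small)
      fix i assume "i \<in> {..<?n}"
      then have i: "real i + 1 \<le> ?n" by simp
      have "p i - s = (e / ?n) * (2 * real i + 1 - ?n)"
      proof -
        have "(s - e + (2 * i + 1) * e / L) - s = (e / L) * (2 * i + 1 - L)" if "L \<noteq> 0" for L i :: real
          using that by (simp add: field_simps)
        from this[of "real ?n" "real i"] show ?thesis unfolding p_def by simp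
      qed
      also have "\<bar>\<dots>\<bar> = (e / ?n) * \<bar>2 * real i + 1 - ?n\<bar>"
        using e by (simp only: abs_mult) simp
      also have "\<dots> < (e / ?n) * real ?n"
      proof (rule mult_strict_left_mono)
        show "\<bar>2 * real i + 1 - ?n\<bar> < real ?n" using i by linarith
      qed (use e in simp)
      finally show "\<bar>p i - s\<bar> < e" using e by simp
    qed (use e in simp)
    also have "\<dots> = (4 * C * e\<^sup>2) * inverse (real ?n)"
    proof -
      have "L * (C * (2 * e / L)\<^sup>2) = (4 * C * e\<^sup>2) * inverse L" if "L \<noteq> 0" for L
        using that by (simp add: power2_eq_square field_simps)
      from this[of "real ?n"] show ?thesis by simp
    qed
    finally show ?thesis .
  qed
  have "measure M {s - e<..<s + e} \<le> (4 * C * e\<^sup>2) * 0"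
    by (rule LIMSEQ_le_const[OF tendsto_mult[OF tendsto_const LIMSEQ_inverse_real_of_nat]])
      (use bound in blast)
  then have "measure M {s - e<..<s + e} = 0" using measure_nonneg[of M "{s - e<..<s + e}"] by linarith
  then show ?thesis using e by (intro exI[of _ e]) (simp add: emeasure_eq_measure)
qed

lemma orthogonality_measure_discrete:
  assumes M: "orthogonality_measure M Q"
    and Q: "\<And>n t. poly (Q n) t = orthonormal_poly a b n t"
    and norm: "\<And>n. (\<integral>t. (poly (Q n) t)\<^sup>2 \<partial>M) = h"
  shows "discrete_measure_on M {t. complex_of_real t \<in> op_spectrum J}"
proof -
  let ?S = "{t. complex_of_real t \<in> op_spectrum J}"
  have sets: "sets M = sets borel" using M by (simp add: orthogonality_measure_def)
  have space: "space M = UNIV" using sets_eq_imp_space_eq[OF sets] by simp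
  have "countable (complex_of_real ` ?S)"
    by (rule countable_subset[OF _ countable_spectrum]) auto
  then have cS: "countable ?S" by (rule countable_image_inj_on) (simp add: inj_on_def)
  have "?S = (\<Union>t\<in>?S. {t})" by blast
  also have "\<dots> \<in> sets M" unfolding sets by (intro sets.countable_UN' cS) auto
  finally have mS: "?S \<in> sets M" .
  define F where "F = {U. open U \<and> emeasure M U = 0}"
  obtain F' where F': "F' \<subseteq> F" "countable F'" "\<Union>F' = \<Union>F"
    by (rule Lindelof[of F]) (auto simp: F_def)
  have cover: "space M - ?S \<subseteq> \<Union>F'"
  proof
    fix t assume "t \<in> space M - ?S"
    then obtain e where "e > 0" "emeasure M {t - e<..<t + e} = 0"
      using resolvent_set_null[OF M Q norm, of t] by auto
    then have "{t - e<..<t + e} \<in> F" "t \<in> {t - e<..<t + e}" by (auto simp: F_def)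
    then show "t \<in> \<Union>F'" unfolding F'(3) by blast
  qed
  have "\<Union>F' \<in> null_sets M"
  proof -
    have "(\<Union>U\<in>F'. U) \<in> null_sets M"
      by (rule null_sets_UN'[OF F'(2)]) (use F'(1) in \<open>auto simp: F_def null_sets_def sets\<close>)
    then show ?thesis by simp
  qed
  then have "emeasure M (space M - ?S) = 0"
    using cover mS by (metis emeasure_mono null_setsD1 null_setsD2 le_zero_eq)
  then show ?thesis using cS mS by (simp add: discrete_measure_on_def)
qed

text \<open>The point masses \<open>w\<^sub>k\<^sup>2\<close> at the eigenvalues are the squared components of \<open>e\<^sub>0\<close>. Since the unit eigenvectors
  have entries \<open>w\<^sub>k \<pi>\<^sub>n(\<lambda>\<^sub>k)\<close>, Parseval's identity for \<open>e\<^sub>m\<close> and \<open>e\<^sub>n\<close> is the orthogonality relation.\<close>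

lemma spectral_measure:
  assumes Q: "\<And>n t. poly (Q n) t = orthonormal_poly a b n t"
  shows "\<exists>M. orthogonality_measure M Q"
proof -
  obtain lam where bij: "bij_betw lam UNIV eigenvalues"
    and expansion: "\<And>x z. x \<in> real_ell2 \<Longrightarrow> (\<lambda>k. inner x (unit_eigenvector (lam k))
        * inner (unit_eigenvector (lam k)) z) sums inner x z"
    using spectral_expansion by metis
  have lam: "lam k \<in> eigenvalues" for k using bij by (auto simp: bij_betw_def)
  define w where "w k = (weight (lam k))\<^sup>2" for k
  have w0: "0 \<le> w k" for k by (simp add: w_def)
  have sw: "summable w"
    unfolding w_def using lam expansion[OF unit_in_real_ell2] by (rule summable_weight_sq)
  obtain B where B: "\<And>k. \<bar>lam k\<bar> \<le> B" using eigenvalue_bound[OF lam] by blast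
  define D where "D = density (count_space (UNIV :: nat set)) (\<lambda>k. ennreal (w k))"
  define M where "M = distr D borel lam"
  have lm: "lam \<in> measurable D borel" by (simp add: D_def)
  have integrable_iff: "integrable M f \<longleftrightarrow> summable (\<lambda>k. \<bar>w k * f (lam k)\<bar>)"
    if "f \<in> borel_measurable borel" for f :: "real \<Rightarrow> real"
    unfolding M_def integrable_distr_eq[OF lm that] unfolding D_def
    by (subst integrable_density) (auto simp: w0 integrable_count_space_nat_iff)
  have integral_sums: "(\<lambda>k. w k * f (lam k)) sums (\<integral>t. f t \<partial>M)"
    if f: "f \<in> borel_measurable borel" "integrable M f" for f :: "real \<Rightarrow> real"
  proof -
    have s: "summable (\<lambda>k. \<bar>w k * f (lam k)\<bar>)" using integrable_iff f by simp
    have "(\<integral>t. f t \<partial>M) = (\<integral>k. w k * f (lam k) \<partial>count_space UNIV)"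
      unfolding M_def integral_distr[OF lm f(1)] unfolding D_def by (subst integral_density) (auto simp: w0)
    also have "\<dots> = (\<Sum>k. w k * f (lam k))"
      using s by (intro integral_count_space_nat) (simp add: integrable_count_space_nat_iff)
    finally show ?thesis using summable_rabs_cancel[OF s] by (simp add: sums_iff)
  qed
  have int_power: "integrable M (\<lambda>t. t ^ k)" for k
  proof (subst integrable_iff)
    show "summable (\<lambda>i. \<bar>w i * lam i ^ k\<bar>)"
    proof (rule summable_comparison_test'[OF summable_mult2[OF sw, of "B ^ k"]])
      show "norm \<bar>w i * lam i ^ k\<bar> \<le> w i * B ^ k" for i
        using w0[of i] B[of i] by (simp add: abs_mult power_abs mult_left_mono power_mono)
    qed
  qed simp
  have prod: "(\<integral>t. poly (Q m) t * poly (Q n) t \<partial>M) = (if m = n then 1 else 0)" for m n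
  proof -
    have int: "integrable M (\<lambda>t. poly (Q m) t * poly (Q n) t)"
      using integrable_poly[OF int_power, of "Q m * Q n"] by (simp add: poly_mult[abs_def])
    have meas: "(\<lambda>t. poly (Q m) t * poly (Q n) t) \<in> borel_measurable borel"
      by (intro borel_measurable_continuous_onI continuous_intros)
    have "w k * (poly (Q m) (lam k) * poly (Q n) (lam k)) = inner (unit_ell2 m) (unit_eigenvector (lam k))
        * inner (unit_eigenvector (lam k)) (unit_ell2 n)" for k
      using inner_unit_unit_eigenvector[OF lam, of m k] inner_unit_unit_eigenvector[OF lam, of n k]
      by (simp add: inner_commute[of _ "unit_ell2 n"] w_def Q power2_eq_square mult_ac)
    then have "(\<lambda>k. w k * (poly (Q m) (lam k) * poly (Q n) (lam k))) sums inner (unit_ell2 m) (unit_ell2 n)"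
      using expansion[OF unit_in_real_ell2, of m "unit_ell2 n"] by simp
    with integral_sums[OF meas int]
    have "(\<integral>t. poly (Q m) t * poly (Q n) t \<partial>M) = inner (unit_ell2 m) (unit_ell2 n)"
      by (rule sums_unique2)
    then show ?thesis by (simp add: inner_ell2_def cinner_unit)
  qed
  have "orthogonality_measure M Q"
    unfolding orthogonality_measure_def
    using int_power prod by (simp add: M_def power2_eq_square del: power_Suc)
  then show ?thesis ..
qed

end

section \<open>The recurrence coefficients and the conclusion\<close>

lemma bracket_bigo: "(\<lambda>n. 1 / bracket \<mu> \<nu> \<alpha> n) \<in> O(\<lambda>n. 1 / real n ^ 2)"
  unfolding bracket_def by real_asymp

lemma diag_term_tendsto: "diag_term \<mu> \<nu> \<longlonglongrightarrow> 0"
proof (rule Lim_transform_eventually)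
  show "(\<lambda>n. (\<nu>\<^sup>2 - \<mu>\<^sup>2) / ((2 * real n + \<mu> + \<nu>) * (2 * real n + \<mu> + \<nu> + 2))) \<longlonglongrightarrow> 0"
    by real_asymp
  have "\<forall>\<^sub>F n in sequentially. 2 * real n + \<mu> + \<nu> > 0" by real_asymp
  then show "\<forall>\<^sub>F n in sequentially. (\<nu>\<^sup>2 - \<mu>\<^sup>2) / ((2 * real n + \<mu> + \<nu>) * (2 * real n + \<mu> + \<nu> + 2))
      = diag_term \<mu> \<nu> n"
    by eventually_elim (simp add: diag_term_def)
qed

lemma rec_b_bigo: "rec_b \<mu> \<nu> \<alpha> \<theta> \<in> O(\<lambda>n. 1 / real n ^ 2)"
proof -
  have "(\<lambda>n. (cos \<theta> - diag_term \<mu> \<nu> n) / sin \<theta>) \<longlonglongrightarrow> (cos \<theta> - 0) / sin \<theta>"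
    unfolding divide_inverse by (intro tendsto_intros diag_term_tendsto)
  then have "(\<lambda>n. (cos \<theta> - diag_term \<mu> \<nu> n) / sin \<theta>) \<in> O(\<lambda>_. 1)"
    by (intro bigoI_tendsto[where c = "(cos \<theta> - 0) / sin \<theta>"]) auto
  from landau_o.big.mult[OF bracket_bigo[of \<mu> \<nu> \<alpha>] this] show ?thesis
    by (simp add: rec_b_def[abs_def] mult.commute)
qed

lemma rec_a2_bigo: "rec_a2 \<mu> \<nu> \<alpha> \<theta> \<in> O(\<lambda>n. 1 / real n ^ 4)"
proof -
  have 1: "(\<lambda>n. 4 * real n * (real n + \<mu>) * (real n + \<nu>) * (real n + \<mu> + \<nu>)
      / (((real n + (\<mu> + \<nu> + 1) / 2)\<^sup>2 + \<alpha>) * ((real n + (\<mu> + \<nu> - 1) / 2)\<^sup>2 + \<alpha>)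
         * (2 * real n + \<mu> + \<nu> + 1) * (2 * real n + \<mu> + \<nu>)\<^sup>2 * (2 * real n + \<mu> + \<nu> - 1)))
      \<in> O(\<lambda>n. 1 / real n ^ 4)"
    by real_asymp
  have "\<forall>\<^sub>F n in sequentially. 2 * real n + \<mu> + \<nu> - 1 > 0" by real_asymp
  then have "\<forall>\<^sub>F n in sequentially. rec_a2 \<mu> \<nu> \<alpha> \<theta> n = 1 / (sin \<theta>)\<^sup>2 *
      (4 * real n * (real n + \<mu>) * (real n + \<nu>) * (real n + \<mu> + \<nu>)
      / (((real n + (\<mu> + \<nu> + 1) / 2)\<^sup>2 + \<alpha>) * ((real n + (\<mu> + \<nu> - 1) / 2)\<^sup>2 + \<alpha>)
         * (2 * real n + \<mu> + \<nu> + 1) * (2 * real n + \<mu> + \<nu>)\<^sup>2 * (2 * real n + \<mu> + \<nu> - 1)))"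
  proof eventually_elim
    case (elim n)
    then have "\<not> 2 * real n + \<mu> + \<nu> - 1 = 0" by simp
    then show ?case unfolding rec_a2_def by (simp only: if_False) (simp add: mult.assoc)
  qed
  moreover have "(\<lambda>n. 1 / (sin \<theta>)\<^sup>2 *
      (4 * real n * (real n + \<mu>) * (real n + \<nu>) * (real n + \<mu> + \<nu>)
      / (((real n + (\<mu> + \<nu> + 1) / 2)\<^sup>2 + \<alpha>) * ((real n + (\<mu> + \<nu> - 1) / 2)\<^sup>2 + \<alpha>)
         * (2 * real n + \<mu> + \<nu> + 1) * (2 * real n + \<mu> + \<nu>)\<^sup>2 * (2 * real n + \<mu> + \<nu> - 1))))
      \<in> O(\<lambda>n. 1 * (1 / real n ^ 4))"
    by (rule landau_o.big.mult[OF _ 1]) simp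
  ultimately show ?thesis using landau_o.big.in_cong by force
qed

text \<open>The factor \<open>n + \<mu> + \<nu>\<close> vanishes only at \<open>n = 1\<close>, \<open>\<mu> + \<nu> = -1\<close>, exactly where it is cancelled. Passing through
  the product of a lower and an upper term handles that case.\<close>

lemma rec_a2_nonzero:
  assumes "\<mu> > -1" "\<nu> > -1" "sin \<theta> \<noteq> 0" "\<And>n. bracket \<mu> \<nu> \<alpha> n \<noteq> 0"
  shows "rec_a2 \<mu> \<nu> \<alpha> \<theta> (Suc n) \<noteq> 0"
proof -
  have "lower_term \<mu> \<nu> (Suc n) \<noteq> 0" unfolding lower_term_def using assms by auto
  then have "lower_term \<mu> \<nu> (Suc n) * upper_term \<mu> \<nu> n
     / ((sin \<theta>)\<^sup>2 * bracket \<mu> \<nu> \<alpha> (Suc n) * bracket \<mu> \<nu> \<alpha> n) \<noteq> 0"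
    using upper_term_nonzero[OF assms(1,2), of n] assms by simp
  then show ?thesis unfolding lower_upper_rec_a2[OF assms(1,2)] .
qed

lemma rec_a2_eventually_pos:
  assumes "sin \<theta> \<noteq> 0" 
  shows "\<exists>N. \<forall>n>N. 0 < rec_a2 \<mu> \<nu> \<alpha> \<theta> n"
proof -
  have "\<forall>\<^sub>F n in sequentially. 0 < real n + \<mu>" by real_asymp
  moreover have "\<forall>\<^sub>F n in sequentially. 0 < real n + \<nu>" by real_asymp
  moreover have "\<forall>\<^sub>F n in sequentially. 0 < real n + \<mu> + \<nu>" by real_asymp
  moreover have "\<forall>\<^sub>F n in sequentially. 0 < 2 * real n + \<mu> + \<nu> - 1" by real_asymp
  moreover have "\<forall>\<^sub>F n in sequentially. 0 < (real n + (\<mu> + \<nu> + 1) / 2)\<^sup>2 + \<alpha>" by real_asymp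
  moreover have "\<forall>\<^sub>F n in sequentially. 0 < (real n + (\<mu> + \<nu> - 1) / 2)\<^sup>2 + \<alpha>" by real_asymp
  moreover have "\<forall>\<^sub>F n in sequentially. 0 < real n" by real_asymp
  ultimately have "\<forall>\<^sub>F n in sequentially. 0 < rec_a2 \<mu> \<nu> \<alpha> \<theta> n"
  proof eventually_elim
    case (elim n)
    have "0 < 2 * real n + \<mu> + \<nu> + 1" "0 < (2 * real n + \<mu> + \<nu>)\<^sup>2" using elim(4) by auto
    moreover have "0 < (sin \<theta>)\<^sup>2" using assms by simp
    ultimately show ?case unfolding rec_a2_def using elim by auto
  qed
  then obtain N where "\<forall>n\<ge>N. 0 < rec_a2 \<mu> \<nu> \<alpha> \<theta> n" by (auto simp: eventually_sequentially)
  then show ?thesis by (intro exI[of _ N]) simp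
qed

lemma summable_sqrt_rec_a2: "summable (\<lambda>n. sqrt \<bar>rec_a2 \<mu> \<nu> \<alpha> \<theta> n\<bar>)"
proof -
  obtain C where C: "C > 0" "\<forall>\<^sub>F n in sequentially. norm (rec_a2 \<mu> \<nu> \<alpha> \<theta> n) \<le> C * norm (1 / real n ^ 4)"
    using landau_o.bigE[OF rec_a2_bigo] by metis
  have "summable (\<lambda>n. sqrt C * (1 / real n ^ 2))"
    using inverse_power_summable[of 2, where ?'a = real] by (intro summable_mult) (simp add: field_simps)
  then show ?thesis
  proof (rule summable_comparison_test_ev[rotated])
    show "\<forall>\<^sub>F n in sequentially. norm (sqrt \<bar>rec_a2 \<mu> \<nu> \<alpha> \<theta> n\<bar>) \<le> sqrt C * (1 / real n ^ 2)"
      using C(2)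
    proof eventually_elim
      case (elim n)
      have "sqrt \<bar>rec_a2 \<mu> \<nu> \<alpha> \<theta> n\<bar> \<le> sqrt (C * (1 / real n ^ 4))"
        using elim by (intro real_sqrt_le_mono) simp
      also have "\<dots> = sqrt C * (1 / real n ^ 2)"
      proof -
        have "real n ^ 4 = (real n ^ 2)\<^sup>2" by simp
        then show ?thesis by (simp only: real_sqrt_mult real_sqrt_divide real_sqrt_one real_sqrt_abs abs_power2)
      qed
      finally show ?case by simp
    qed
  qed
qed

lemma summable_rec_b: "summable (\<lambda>n. \<bar>rec_b \<mu> \<nu> \<alpha> \<theta> n\<bar>)"
proof -
  obtain C where C: "\<forall>\<^sub>F n in sequentially. norm (rec_b \<mu> \<nu> \<alpha> \<theta> n) \<le> C * norm (1 / real n ^ 2)"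
    using landau_o.bigE[OF rec_b_bigo] by metis
  have "summable (\<lambda>n. C * (1 / real n ^ 2))"
    using inverse_power_summable[of 2, where ?'a = real] by (intro summable_mult) (simp add: field_simps)
  then show ?thesis
    by (rule summable_comparison_test_ev[rotated]) (use C in simp)
qed

lemma (in summable_jacobi) spectrum_enumeration:
  assumes "infinite (op_spectrum (jac a b))"
  shows "{z. z islimpt op_spectrum (jac a b)} = {0}" (is "?L = _")
    and "\<exists>x :: nat \<Rightarrow> complex. bij_betw x UNIV (op_spectrum (jac a b)) \<and> x \<longlonglongrightarrow> 0
      \<and> summable (\<lambda>k. cmod (x k))"
proof -
  let ?S = "op_spectrum (jac a b)"
  let ?x = "from_nat_into ?S"
  have bij: "bij_betw ?x UNIV ?S" by (rule bij_betw_from_nat_into[OF countable_spectrum assms])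
  have sum: "summable (\<lambda>k. cmod (?x k))"
  proof (rule bounded_imp_summable[where B = "suminf (jac_bound a b)"])
    fix n
    have "(\<Sum>k\<le>n. cmod (?x k)) = (\<Sum>z\<in>?x ` {..n}. cmod z)"
      using bij by (subst sum.reindex) (auto simp: bij_betw_def intro: inj_on_subset)
    also have "\<dots> \<le> suminf (jac_bound a b)"
      using bij by (intro sum_cmod_spectrum_le) (auto simp: bij_betw_def)
    finally show "(\<Sum>k\<le>n. cmod (?x k)) \<le> suminf (jac_bound a b)" .
  qed simp
  have lim: "?x \<longlonglongrightarrow> 0"
    using summable_LIMSEQ_zero[OF sum] by (simp only: tendsto_norm_zero_iff)
  show "\<exists>x :: nat \<Rightarrow> complex. bij_betw x UNIV ?S \<and> x \<longlonglongrightarrow> 0 \<and> summable (\<lambda>k. cmod (x k))"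
    using bij lim sum by (intro exI[of _ ?x]) simp
  show "?L = {0}"
  proof (intro set_eqI iffI)
    fix z :: complex assume "z \<in> {0}"
    moreover have "0 islimpt ?S"
      unfolding islimpt_approachable
    proof (intro allI impI)
      fix e :: real assume "0 < e"
      then obtain M where M: "\<And>k. k \<ge> M \<Longrightarrow> cmod (?x k) < e" using LIMSEQ_D[OF lim] by auto
      have "?x M \<noteq> ?x (Suc M)" using bij injD[of ?x M "Suc M"] unfolding bij_betw_def by auto
      then obtain k where "k \<ge> M" "?x k \<noteq> 0" by (metis le_Suc_eq le_refl)
      then show "\<exists>x'\<in>?S. x' \<noteq> 0 \<and> dist x' 0 < e"
        using M[of k] bij by (intro bexI[of _ "?x k"]) (auto simp: bij_betw_def)
    qed
    ultimately show "z \<in> ?L" by simp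
  next
    fix z assume "z \<in> ?L"
    then have z: "z islimpt ?S" by simp
    show "z \<in> {0}"
    proof (rule ccontr)
      assume "z \<notin> {0}"
      then have z0: "0 < cmod z" by simp
      have "infinite (?S \<inter> ball z (cmod z / 2))"
        using z z0 unfolding islimpt_eq_infinite_ball by (meson half_gt_zero)
      moreover have "?S \<inter> ball z (cmod z / 2) \<subseteq> {w \<in> ?S. cmod z / 2 \<le> cmod w}"
      proof
        fix w assume w: "w \<in> ?S \<inter> ball z (cmod z / 2)"
        then have "cmod (z - w) < cmod z / 2" by (simp add: dist_norm)
        then show "w \<in> {w \<in> ?S. cmod z / 2 \<le> cmod w}"
          using norm_triangle_ineq2[of z w] w by auto
      qed
      then have "finite (?S \<inter> ball z (cmod z / 2))"
        by (rule finite_subset) (rule finite_spectrum_outside, use z0 in simp)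
      ultimately show False by simp
    qed
  qed
qed

theorem mainTheorem2:
  fixes \<mu> \<nu> \<alpha> \<theta> :: real
  assumes "\<mu> > -1" and "\<nu> > -1" and "0 \<le> \<theta>" and "\<theta> \<le> pi"
    and "sin \<theta> \<noteq> 0"
    and "\<And>n. bracket \<mu> \<nu> \<alpha> n \<noteq> 0"
  shows "rec_a2 \<mu> \<nu> \<alpha> \<theta> \<longlonglongrightarrow> 0
    \<and> rec_b \<mu> \<nu> \<alpha> \<theta> \<longlonglongrightarrow> 0
    \<and> rec_a2 \<mu> \<nu> \<alpha> \<theta> \<in> O(\<lambda>n. 1 / real n ^ 4)
    \<and> rec_b \<mu> \<nu> \<alpha> \<theta> \<in> O(\<lambda>n. 1 / real n ^ 2)
    \<and> compact_operator (J_operator \<mu> \<nu> \<alpha> \<theta>)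
    \<and> trace_class (J_operator \<mu> \<nu> \<alpha> \<theta>)
    \<and> {z. z islimpt op_spectrum (J_operator \<mu> \<nu> \<alpha> \<theta>)} = {0}
    \<and> (\<exists>x :: nat \<Rightarrow> complex. bij_betw x UNIV (op_spectrum (J_operator \<mu> \<nu> \<alpha> \<theta>))
         \<and> x \<longlonglongrightarrow> 0 \<and> summable (\<lambda>k. cmod (x k)))
    \<and> (\<forall>M. orthogonality_measure M (Hpoly \<mu> \<nu> \<alpha> \<theta>) \<longrightarrow>
         discrete_measure_on M {t. complex_of_real t \<in> op_spectrum (J_operator \<mu> \<nu> \<alpha> \<theta>)})
    \<and> ((\<forall>n\<ge>1. rec_a2 \<mu> \<nu> \<alpha> \<theta> n > 0) \<longrightarrow>
         (\<exists>M. orthogonality_measure M (Hpoly \<mu> \<nu> \<alpha> \<theta>)))"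
proof -
  let ?a2 = "rec_a2 \<mu> \<nu> \<alpha> \<theta>" and ?b = "rec_b \<mu> \<nu> \<alpha> \<theta>"
  let ?P = "Ppoly \<mu> \<nu> \<alpha> \<theta>" and ?H = "Hpoly \<mu> \<nu> \<alpha> \<theta>"
  let ?a = "\<lambda>n. csqrt (complex_of_real (?a2 n))"
  note par = assms(1,2,5,6)
  have H0: "?H n \<noteq> 0" for n using degree_Hpoly[OF par, of n] by blast
  have P0: "?P n \<noteq> 0" for n using H0[of n] by (simp add: Ppoly_def)
  have sq: "(?a n)\<^sup>2 = complex_of_real (?a2 n)" for n by simp
  have a2_0: "?a2 0 = 0" by (simp add: rec_a2_def)
  have cm: "cmod (?a n) = sqrt \<bar>?a2 n\<bar>" for n
    by simp
  have Prec: "pCons 0 (?P n) = ?P (Suc n) + smult (?b n) (?P n)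
      + smult (?a2 n) (if n = 0 then 0 else ?P (n - 1))" for n
    by (rule Ppoly_recurrence[OF par])
  obtain N where N: "\<And>n. N < n \<Longrightarrow> 0 < ?a2 n" using rec_a2_eventually_pos[OF assms(5)] by blast
  interpret J: eventually_real_jacobi ?a ?b ?P N
  proof
    show "summable (\<lambda>n. cmod (?a n))" unfolding cm by (rule summable_sqrt_rec_a2)
    show "summable (\<lambda>n. \<bar>?b n\<bar>)" by (rule summable_rec_b)
    show "?a (Suc n) \<noteq> 0" for n using rec_a2_nonzero[OF par, of n] by simp
    show "Im ((?a n)\<^sup>2) = 0" for n by simp
    show "?P 0 = 1" by (simp add: Ppoly_def)
    show "?P n \<noteq> 0" for n by (rule P0)
    show "pCons 0 (?P n) = ?P (Suc n) + smult (?b n) (?P n)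
      + smult (Re ((?a n)\<^sup>2)) (if n = 0 then 0 else ?P (n - 1))" for n
      using Prec[of n] by simp
    show "Im (?a n) = 0" if "N < n" for n using N[OF that] by (simp add: csqrt_of_real_nonneg)
  qed
  have JJ: "J_operator \<mu> \<nu> \<alpha> \<theta> = jac ?a (\<lambda>n. complex_of_real (?b n))"
    by (simp add: J_operator_def)
  have lim_a: "?a2 \<longlonglongrightarrow> 0"
    by (rule landau_o.big_small_trans[OF rec_a2_bigo, THEN smalloD_tendsto, of "\<lambda>_. 1", simplified]) real_asymp
  have lim_b: "?b \<longlonglongrightarrow> 0"
    using summable_LIMSEQ_zero[OF summable_rec_b] by (simp only: tendsto_rabs_zero_iff)
  have H: "?H = (\<lambda>n. smult (lead_coeff (?H n)) (?P n))"
    by (rule ext) (simp add: Ppoly_def H0)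
  have MP: "orthogonality_measure M ?H \<longleftrightarrow> orthogonality_measure M ?P" for M
    by (subst H, rule orthogonality_measure_smult) (simp add: H0)
  \<comment> \<open>Rescaling the monic polynomials by \<open>a\<^sub>1 \<cdots> a\<^sub>n\<close> symmetrises their recurrence.\<close>
  define r where "r n = sqrt (?a2 n)" for n
  define c where "c n = (\<Prod>i<n. r (Suc i))" for n
  define Q where "Q n = smult (1 / c n) (?P n)" for n
  have real_case: "real_jacobi r ?b" "J_operator \<mu> \<nu> \<alpha> \<theta> = real_jacobi.J r ?b"
    "\<And>n. c n \<noteq> 0" "\<And>n t. poly (Q n) t = orthonormal_poly r ?b n t"
    if pos: "\<And>n. 0 < ?a2 (Suc n)"
  proof -
    have nn: "0 \<le> ?a2 n" for n using pos a2_0 by (cases n) (auto simp: less_imp_le)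
    have rpos: "0 < r (Suc n)" for n using pos by (simp add: r_def)
    show "real_jacobi r ?b"
    proof
      have "\<bar>r n\<bar> = sqrt \<bar>?a2 n\<bar>" for n using nn[of n] by (simp add: r_def)
      then show "summable (\<lambda>n. \<bar>r n\<bar>)" by (simp add: summable_sqrt_rec_a2)
      show "summable (\<lambda>n. \<bar>?b n\<bar>)" by (rule summable_rec_b)
      show "r (Suc n) \<noteq> 0" for n using rpos[of n] by simp
    qed
    then interpret real_jacobi r ?b .
    show "J_operator \<mu> \<nu> \<alpha> \<theta> = J"
      unfolding JJ r_def using nn by (simp add: csqrt_of_real_nonneg)
    show c0: "c n \<noteq> 0" for n using rpos by (simp add: c_def less_imp_neq[symmetric])
    have r2: "r n * r n = ?a2 n" for n using nn by (simp add: r_def)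
    show "poly (Q n) t = orthonormal_poly r ?b n t" for n t
    proof -
      have rec: "t * poly (?P n) t = poly (?P (Suc n)) t + ?b n * poly (?P n) t
          + ?a2 n * (if n = 0 then 0 else poly (?P (n - 1)) t)" for n
        using arg_cong[OF Prec[of n], of "\<lambda>p. poly p t"] by (simp split: if_splits)
      have P_zero: "poly (?P 0) t = 1" by (simp add: Ppoly_def)
      have "poly (?P n) t = c n * orthonormal_poly r ?b n t"
      proof (induction n rule: induct_nat_012)
        case 1
        show ?case using rec[of 0] rpos[of 0] P_zero by (simp add: c_def)
      next
        case (ge2 n)
        have cS: "c (Suc (Suc n)) = c n * r (Suc n) * r (Suc (Suc n))" "c (Suc n) = c n * r (Suc n)"
          by (simp_all add: c_def)
        have "poly (?P (Suc (Suc n))) t = (t - ?b (Suc n)) * poly (?P (Suc n)) t - ?a2 (Suc n) * poly (?P n) t"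
          using rec[of "Suc n"] by (simp add: algebra_simps)
        also have "\<dots> = c n * r (Suc n) * ((t - ?b (Suc n)) * orthonormal_poly r ?b (Suc n) t
            - r (Suc n) * orthonormal_poly r ?b n t)"
          unfolding ge2 cS r2[symmetric] by (simp add: algebra_simps del: orthonormal_poly.simps)
        also have "\<dots> = c (Suc (Suc n)) * orthonormal_poly r ?b (Suc (Suc n)) t"
          unfolding cS using rpos[of "Suc n"] by simp
        finally show ?case .
      qed (simp add: P_zero c_def)
      then show ?thesis using c0[of n] by (simp add: Q_def)
    qed
  qed
  have MQ: "orthogonality_measure M Q \<longleftrightarrow> orthogonality_measure M ?P" if "\<And>n. 0 < ?a2 (Suc n)" for M
    unfolding Q_def by (rule orthogonality_measure_smult) (simp add: real_case(3)[OF that])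
  have discrete: "discrete_measure_on M {t. complex_of_real t \<in> op_spectrum (J_operator \<mu> \<nu> \<alpha> \<theta>)}"
    if "orthogonality_measure M ?H" for M
  proof -
    have M: "orthogonality_measure M ?P" using that MP by simp
    have hpos: "0 < (\<integral>t. (poly (?P n) t)\<^sup>2 \<partial>M)" for n
      using M by (simp add: orthogonality_measure_def)
    note ratio = orthogonality_norm_ratio[OF M Prec]
    have pos: "0 < ?a2 (Suc n)" for n
      using hpos[of n] hpos[of "Suc n"] unfolding ratio[of n] by (simp add: zero_less_mult_iff)
    interpret R: real_jacobi r ?b by (rule real_case(1)[OF pos])
    have c2: "(c n)\<^sup>2 * (\<integral>t. (poly (?P 0) t)\<^sup>2 \<partial>M) = (\<integral>t. (poly (?P n) t)\<^sup>2 \<partial>M)" for n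
    proof (induction n)
      case (Suc n)
      have "(r (Suc n))\<^sup>2 = ?a2 (Suc n)" using pos[of n] by (simp add: r_def)
      then show ?case unfolding ratio[of n] Suc[symmetric] by (simp add: c_def power_mult_distrib)
    qed (simp add: c_def)
    have norm: "(\<integral>t. (poly (Q n) t)\<^sup>2 \<partial>M) = (\<integral>t. (poly (?P 0) t)\<^sup>2 \<partial>M)" for n
      using real_case(3)[OF pos, of n]
      by (simp add: Q_def power_mult_distrib power_divide c2[of n, symmetric])
    show ?thesis
      unfolding real_case(2)[OF pos]
      using M MQ[OF pos] by (intro R.orthogonality_measure_discrete[OF _ real_case(4)[OF pos] norm]) simp
  qed
  have ex: "\<exists>M. orthogonality_measure M ?H" if pos1: "\<forall>n\<ge>1. ?a2 n > 0"
  proof -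
    have pos: "0 < ?a2 (Suc n)" for n using pos1 by simp
    interpret R: real_jacobi r ?b by (rule real_case(1)[OF pos])
    show ?thesis using R.spectral_measure[OF real_case(4)[OF pos]] MP MQ[OF pos] by simp
  qed
  show ?thesis
    using lim_a lim_b rec_a2_bigo rec_b_bigo J.compact_operator_jac J.trace_class_jac
      J.spectrum_enumeration[OF J.infinite_spectrum] discrete ex
    unfolding JJ by blast
qed

end
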